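(* Let $\alpha\in(0,1)$, let $\Omega\subset\mathbb{R}^d$ ($d\in\mathbb{N}$) be a bounded domain with sufficiently smooth boundary, let $\eta\in\mathbb{R}^d$ be a constant vector, and let $H(u)=(\eta\cdot\nabla)u=\sum_{j=1}^d\eta_j\,\partial u/\partial x_j$. Let $\mathscr{T}\in(0,\infty)$, $I=[0,\mathscr{T}]$, and $u_0\in D^1(\Omega)$. Then the problem $$\partial_t^\alpha u-\partial_t^\alpha\Delta u-\Delta u=H(u)\ \text{ in }\Omega\times(0,\infty),\qquad u=0\ \text{ on }\partial\Omega\times(0,\infty),\qquad u(\cdot,0)=u_0\ \text{ in }\Omega,$$ possesses at least one mild solution $u$ in $C(I\to D^1(\Omega))$.
   Context: $\partial_t^\alpha$ is the Caputo time derivative of order $\alpha$. Let $0<\theta_1\le\theta_2\le\dots$ be the eigenvalues of $-\Delta$ on $\Omega$ with homogeneous Dirichlet condition, and $\{\phi_k\}_{k\in\mathbb{N}}$ corresponding eigenfunctions forming a complete orthonormal system of $L^2(\Omega)$; $\langle w,v\rangle=\int_\Omega wv\,dz$. For $\nu\ge 0$, $D^\nu(\Omega)=\{w\in L^2(\Omega): \|w\|_{D^\nu(\Omega)}^2=\sum_{k}\theta_k^\nu\langle w,\phi_k\rangle^2<\infty\}$. For a Banach space $X$ and a compact interval $I$, $C(I\to X)$ is the space of continuous functions $w:I\to X$ with norm $\sup_{t\in I}\|w(t)\|_X$. The Mittag-Leffler functions are $E_{\alpha,\zeta}(z)=\sum_{k=0}^\infty z^k/\Gamma(\alpha k+\zeta)$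 and $E_\alpha=E_{\alpha,1}$. Define $$\mathscr{S}(t)w=\sum_{k=1}^\infty E_\alpha\Big(\frac{-\theta_kt^\alpha}{1+\theta_k}\Big)\langle w,\phi_k\rangle\phi_k,\qquad \mathscr{R}(t)w=\sum_{k=1}^\infty\frac{t^{\alpha-1}}{1+\theta_k}E_{\alpha,\alpha}\Big(\frac{-\theta_kt^\alpha}{1+\theta_k}\Big)\langle w,\phi_k\rangle\phi_k .$$ A mild solution on $I=[0,\mathscr{T}]$ is a function $u$ satisfying, for $t\in I$, $$u(t)=\mathscr{S}(t)u_0+\int_0^t\mathscr{R}(t-\tau)H(u(\tau))\,d\tau .$$ *)

theory Defs
  imports "HOL-Analysis.Analysis"
begin

section \<open>Smooth functions, test functions and domains with smooth boundary\<close>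

definition partial_deriv :: "'a::euclidean_space \<Rightarrow> ('a \<Rightarrow> real) \<Rightarrow> 'a \<Rightarrow> real" where
  "partial_deriv j f x = frechet_derivative f (at x) j"

text \<open>Meaningful for open \<open>S\<close>.\<close>

primrec Ck_on :: "nat \<Rightarrow> 'a::euclidean_space set \<Rightarrow> ('a \<Rightarrow> real) \<Rightarrow> bool" where
  "Ck_on 0 S f \<longleftrightarrow> continuous_on S f"
| "Ck_on (Suc k) S f \<longleftrightarrow>
     (\<forall>x\<in>S. f differentiable (at x)) \<and> (\<forall>j\<in>Basis. Ck_on k S (partial_deriv j f))"

definition test_functions :: "'a::euclidean_space set \<Rightarrow> ('a \<Rightarrow> real) set" where
  "test_functions \<Omega> =
     {\<psi>. (\<forall>k. Ck_on k UNIV \<psi>) \<and> compact (closure {x. \<psi> x \<noteq> 0}) \<and> closure {x. \<psi> x \<noteq> 0} \<subseteq> \<Omega>}"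

text \<open>Near each boundary point, \<open>\<Omega>\<close> is the strict sublevel set \<open>{\<rho> < 0}\<close> of a
  \<open>C\<^sup>k\<close> defining function with nowhere vanishing differential.\<close>

definition Ck_boundary :: "nat \<Rightarrow> 'a::euclidean_space set \<Rightarrow> bool" where
  "Ck_boundary k \<Omega> \<longleftrightarrow>
     (\<forall>z\<in>frontier \<Omega>. \<exists>r>0. \<exists>\<rho>. Ck_on k (ball z r) \<rho> \<and>
        (\<forall>x\<in>ball z r. \<exists>j\<in>Basis. partial_deriv j \<rho> x \<noteq> 0) \<and>
        \<Omega> \<inter> ball z r = {x \<in> ball z r. \<rho> x < 0})"


section \<open>The space \<open>L\<^sup>2(\<Omega>)\<close>\<close>

text \<open>Elements of \<open>L\<^sup>2(\<Omega>)\<close> are represented by functions; two functions agreeing almost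
  everywhere on \<open>\<Omega>\<close> represent the same element. Values outside \<open>\<Omega>\<close> are irrelevant.\<close>

definition L2_space :: "'a::euclidean_space set \<Rightarrow> ('a \<Rightarrow> real) set" where
  "L2_space \<Omega> = {w \<in> borel_measurable (lebesgue_on \<Omega>). integrable (lebesgue_on \<Omega>) (\<lambda>x. (w x)\<^sup>2)}"

definition L2_inner :: "'a::euclidean_space set \<Rightarrow> ('a \<Rightarrow> real) \<Rightarrow> ('a \<Rightarrow> real) \<Rightarrow> real" where
  "L2_inner \<Omega> w v = (LINT x|lebesgue_on \<Omega>. w x * v x)"

definition L2_norm :: "'a::euclidean_space set \<Rightarrow> ('a \<Rightarrow> real) \<Rightarrow> real" where
  "L2_norm \<Omega> w = sqrt (L2_inner \<Omega> w w)"

definition L2_eq :: "'a::euclidean_space set \<Rightarrow> ('a \<Rightarrow> real) \<Rightarrow> ('a \<Rightarrow> real) \<Rightarrow> bool" where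
  "L2_eq \<Omega> w v \<longleftrightarrow> (AE x in lebesgue_on \<Omega>. w x = v x)"

definition L2_sums ::
  "'a::euclidean_space set \<Rightarrow> (nat \<Rightarrow> 'a \<Rightarrow> real) \<Rightarrow> ('a \<Rightarrow> real) \<Rightarrow> bool" where
  "L2_sums \<Omega> f g \<longleftrightarrow> (\<forall>k. f k \<in> L2_space \<Omega>) \<and> g \<in> L2_space \<Omega> \<and>
     (\<lambda>n. L2_norm \<Omega> (\<lambda>x. (\<Sum>k<n. f k x) - g x)) \<longlonglongrightarrow> 0"

text \<open>The \<open>L\<^sup>2(\<Omega>)\<close>-limit of a series is unique up to a null set; a representative is chosen.\<close>

definition L2_suminf :: "'a::euclidean_space set \<Rightarrow> (nat \<Rightarrow> 'a \<Rightarrow> real) \<Rightarrow> 'a \<Rightarrow> real" where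
  "L2_suminf \<Omega> f = (SOME g. L2_sums \<Omega> f g)"

text \<open>Bochner integral over \<open>[a,b]\<close> with values in \<open>L\<^sup>2(\<Omega>)\<close>: \<open>F\<close> is approximated in
  \<open>L\<^sup>1([a,b]; L\<^sup>2(\<Omega>))\<close> by simple functions \<open>s n\<close> whose elementary integrals converge to \<open>J\<close>
  in \<open>L\<^sup>2(\<Omega>)\<close>. The library's Bochner integral applies only to types that are normed spaces.\<close>

definition L2_simple_integral ::
  "real measure \<Rightarrow> (real \<Rightarrow> 'a \<Rightarrow> real) \<Rightarrow> 'a \<Rightarrow> real" where
  "L2_simple_integral M s x = (\<Sum>v\<in>s ` space M. measure M {\<tau> \<in> space M. s \<tau> = v} * v x)"

definition has_L2_integral ::
  "'a::euclidean_space set \<Rightarrow> real \<Rightarrow> real \<Rightarrow> (real \<Rightarrow> 'a \<Rightarrow> real) \<Rightarrow> ('a \<Rightarrow> real) \<Rightarrow> bool" where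
  "has_L2_integral \<Omega> a b F J \<longleftrightarrow>
     (let M = lebesgue_on {a..b} in
       (AE \<tau> in M. F \<tau> \<in> L2_space \<Omega>) \<and> J \<in> L2_space \<Omega> \<and>
       (\<exists>s. (\<forall>n. simple_function M (s n) \<and> s n ` space M \<subseteq> L2_space \<Omega> \<and>
                  integrable M (\<lambda>\<tau>. L2_norm \<Omega> (\<lambda>x. F \<tau> x - s n \<tau> x))) \<and>
            (\<lambda>n. LINT \<tau>|M. L2_norm \<Omega> (\<lambda>x. F \<tau> x - s n \<tau> x)) \<longlonglongrightarrow> 0 \<and>
            (\<lambda>n. L2_norm \<Omega> (\<lambda>x. L2_simple_integral M (s n) x - J x)) \<longlonglongrightarrow> 0))"


section \<open>Weak derivatives, \<open>H\<^sup>1\<^sub>0(\<Omega>)\<close> and the Dirichlet eigensystem of the Laplacian\<close>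

definition locally_integrable_on :: "('a::euclidean_space \<Rightarrow> real) \<Rightarrow> 'a set \<Rightarrow> bool" where
  "locally_integrable_on w \<Omega> \<longleftrightarrow> (\<forall>K. compact K \<and> K \<subseteq> \<Omega> \<longrightarrow> integrable (lebesgue_on K) w)"

definition is_weak_deriv ::
  "'a::euclidean_space set \<Rightarrow> 'a \<Rightarrow> ('a \<Rightarrow> real) \<Rightarrow> ('a \<Rightarrow> real) \<Rightarrow> bool" where
  "is_weak_deriv \<Omega> j w g \<longleftrightarrow> locally_integrable_on w \<Omega> \<and> locally_integrable_on g \<Omega> \<and>
     (\<forall>\<psi>\<in>test_functions \<Omega>.
        (LINT x|lebesgue_on \<Omega>. w x * partial_deriv j \<psi> x) = - (LINT x|lebesgue_on \<Omega>. g x * \<psi> x))"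

text \<open>Unique up to a null set; a representative is chosen.\<close>

definition weak_deriv :: "'a::euclidean_space set \<Rightarrow> 'a \<Rightarrow> ('a \<Rightarrow> real) \<Rightarrow> 'a \<Rightarrow> real" where
  "weak_deriv \<Omega> j w = (SOME g. is_weak_deriv \<Omega> j w g)"

definition H1_space :: "'a::euclidean_space set \<Rightarrow> ('a \<Rightarrow> real) set" where
  "H1_space \<Omega> = {w \<in> L2_space \<Omega>. \<forall>j\<in>Basis. \<exists>g\<in>L2_space \<Omega>. is_weak_deriv \<Omega> j w g}"

definition H1_norm :: "'a::euclidean_space set \<Rightarrow> ('a \<Rightarrow> real) \<Rightarrow> real" where
  "H1_norm \<Omega> w = sqrt ((L2_norm \<Omega> w)\<^sup>2 + (\<Sum>j\<in>Basis. (L2_norm \<Omega> (weak_deriv \<Omega> j w))\<^sup>2))"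

definition H10_space :: "'a::euclidean_space set \<Rightarrow> ('a \<Rightarrow> real) set" where
  "H10_space \<Omega> = {w \<in> H1_space \<Omega>.
     \<exists>\<psi>. (\<forall>n. \<psi> n \<in> test_functions \<Omega>) \<and> (\<lambda>n. H1_norm \<Omega> (\<lambda>x. w x - \<psi> n x)) \<longlonglongrightarrow> 0}"

text \<open>Weak form of \<open>-\<Delta> v = \<mu> v\<close> in \<open>\<Omega>\<close>, \<open>v = 0\<close> on the boundary, \<open>v \<noteq> 0\<close>.\<close>

definition dirichlet_eigenfunction ::
  "'a::euclidean_space set \<Rightarrow> real \<Rightarrow> ('a \<Rightarrow> real) \<Rightarrow> bool" where
  "dirichlet_eigenfunction \<Omega> \<mu> v \<longleftrightarrow> v \<in> H10_space \<Omega> \<and> \<not> L2_eq \<Omega> v (\<lambda>x. 0) \<and>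
     (\<forall>\<psi>\<in>test_functions \<Omega>.
        (\<Sum>j\<in>Basis. L2_inner \<Omega> (weak_deriv \<Omega> j v) (partial_deriv j \<psi>)) = \<mu> * L2_inner \<Omega> v \<psi>)"

text \<open>Indices start at \<open>0\<close>. Completeness of the \<open>\<phi> k\<close> forces \<open>\<theta>\<close> to list all eigenvalues,
  with multiplicity.\<close>

definition dirichlet_eigensystem ::
  "'a::euclidean_space set \<Rightarrow> (nat \<Rightarrow> real) \<Rightarrow> (nat \<Rightarrow> 'a \<Rightarrow> real) \<Rightarrow> bool" where
  "dirichlet_eigensystem \<Omega> \<theta> \<phi> \<longleftrightarrow>
     0 < \<theta> 0 \<and> mono \<theta> \<and>
     (\<forall>k. dirichlet_eigenfunction \<Omega> (\<theta> k) (\<phi> k)) \<and>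
     (\<forall>i k. L2_inner \<Omega> (\<phi> i) (\<phi> k) = (if i = k then 1 else 0)) \<and>
     (\<forall>w\<in>L2_space \<Omega>. (\<forall>k. L2_inner \<Omega> w (\<phi> k) = 0) \<longrightarrow> L2_eq \<Omega> w (\<lambda>x. 0))"


section \<open>The spaces \<open>D\<^sup>\<nu>(\<Omega>)\<close> and \<open>C(I \<rightarrow> D\<^sup>\<nu>(\<Omega>))\<close>\<close>

definition D_space ::
  "'a::euclidean_space set \<Rightarrow> (nat \<Rightarrow> real) \<Rightarrow> (nat \<Rightarrow> 'a \<Rightarrow> real) \<Rightarrow> real \<Rightarrow> ('a \<Rightarrow> real) set" where
  "D_space \<Omega> \<theta> \<phi> \<nu> = {w \<in> L2_space \<Omega>. summable (\<lambda>k. \<theta> k powr \<nu> * (L2_inner \<Omega> w (\<phi> k))\<^sup>2)}"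

definition D_norm ::
  "'a::euclidean_space set \<Rightarrow> (nat \<Rightarrow> real) \<Rightarrow> (nat \<Rightarrow> 'a \<Rightarrow> real) \<Rightarrow> real \<Rightarrow> ('a \<Rightarrow> real) \<Rightarrow> real" where
  "D_norm \<Omega> \<theta> \<phi> \<nu> w = sqrt (\<Sum>k. \<theta> k powr \<nu> * (L2_inner \<Omega> w (\<phi> k))\<^sup>2)"

definition C_into_D ::
  "real set \<Rightarrow> 'a::euclidean_space set \<Rightarrow> (nat \<Rightarrow> real) \<Rightarrow> (nat \<Rightarrow> 'a \<Rightarrow> real) \<Rightarrow> real \<Rightarrow>
     (real \<Rightarrow> 'a \<Rightarrow> real) set" where
  "C_into_D I \<Omega> \<theta> \<phi> \<nu> = {u. \<forall>t\<in>I. u t \<in> D_space \<Omega> \<theta> \<phi> \<nu> \<and>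
     ((\<lambda>s. D_norm \<Omega> \<theta> \<phi> \<nu> (\<lambda>x. u s x - u t x)) \<longlongrightarrow> 0) (at t within I)}"


section \<open>Mittag-Leffler functions, solution operators and mild solutions\<close>

definition mittag_leffler :: "real \<Rightarrow> real \<Rightarrow> real \<Rightarrow> real" where
  "mittag_leffler \<alpha> \<zeta> z = (\<Sum>k. z ^ k / Gamma (\<alpha> * real k + \<zeta>))"

definition S_op ::
  "'a::euclidean_space set \<Rightarrow> (nat \<Rightarrow> real) \<Rightarrow> (nat \<Rightarrow> 'a \<Rightarrow> real) \<Rightarrow> real \<Rightarrow> real \<Rightarrow>
     ('a \<Rightarrow> real) \<Rightarrow> 'a \<Rightarrow> real" where
  "S_op \<Omega> \<theta> \<phi> \<alpha> t w = L2_suminf \<Omega> (\<lambda>k x.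
     mittag_leffler \<alpha> 1 (- \<theta> k * t powr \<alpha> / (1 + \<theta> k)) * L2_inner \<Omega> w (\<phi> k) * \<phi> k x)"

text \<open>\<open>\<R>(t)\<close> is only used for \<open>t > 0\<close> up to a null set of times: at \<open>t = 0\<close> the convention
  \<open>0 powr (\<alpha> - 1) = 0\<close> makes it the zero operator.\<close>

definition R_op ::
  "'a::euclidean_space set \<Rightarrow> (nat \<Rightarrow> real) \<Rightarrow> (nat \<Rightarrow> 'a \<Rightarrow> real) \<Rightarrow> real \<Rightarrow> real \<Rightarrow>
     ('a \<Rightarrow> real) \<Rightarrow> 'a \<Rightarrow> real" where
  "R_op \<Omega> \<theta> \<phi> \<alpha> t w = L2_suminf \<Omega> (\<lambda>k x.
     t powr (\<alpha> - 1) / (1 + \<theta> k) * mittag_leffler \<alpha> \<alpha> (- \<theta> k * t powr \<alpha> / (1 + \<theta> k))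
       * L2_inner \<Omega> w (\<phi> k) * \<phi> k x)"

text \<open>Mild solutions on \<open>[0,T]\<close> of
  \<open>\<partial>\<^sub>t\<^sup>\<alpha> u - \<partial>\<^sub>t\<^sup>\<alpha> \<Delta>u - \<Delta>u = H(u)\<close> with homogeneous Dirichlet condition and
  \<open>u(\<cdot>,0) = u0\<close>. The existence of the integral is part of the definition.\<close>

definition mild_solution ::
  "'a::euclidean_space set \<Rightarrow> (nat \<Rightarrow> real) \<Rightarrow> (nat \<Rightarrow> 'a \<Rightarrow> real) \<Rightarrow> real \<Rightarrow>
     (('a \<Rightarrow> real) \<Rightarrow> 'a \<Rightarrow> real) \<Rightarrow> ('a \<Rightarrow> real) \<Rightarrow> real \<Rightarrow> (real \<Rightarrow> 'a \<Rightarrow> real) \<Rightarrow> bool" where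
  "mild_solution \<Omega> \<theta> \<phi> \<alpha> H u0 T u \<longleftrightarrow>
     (\<forall>t\<in>{0..T}. \<exists>J. has_L2_integral \<Omega> 0 t (\<lambda>\<tau>. R_op \<Omega> \<theta> \<phi> \<alpha> (t - \<tau>) (H (u \<tau>))) J \<and>
        L2_eq \<Omega> (u t) (\<lambda>x. S_op \<Omega> \<theta> \<phi> \<alpha> t u0 x + J x))"

text \<open>The operator \<open>\<eta> \<cdot> \<nabla>\<close>.\<close>

definition directional_op ::
  "'a::euclidean_space set \<Rightarrow> 'a \<Rightarrow> ('a \<Rightarrow> real) \<Rightarrow> 'a \<Rightarrow> real" where
  "directional_op \<Omega> \<eta> w = (\<lambda>x. \<Sum>j\<in>Basis. (\<eta> \<bullet> j) * weak_deriv \<Omega> j w x)"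

end

theory Submission
  imports Defs
begin

text \<open>Weighting coefficients by \<open>\<surd>\<theta>\<^sub>k\<close> identifies \<open>D\<^sup>1(\<Omega>)\<close> with \<open>\<ell>\<^sup>2\<close>. The gradients of the
  eigenfunctions are orthogonal with squared norms \<open>\<theta>\<^sub>k\<close>, so \<open>\<eta> \<cdot> \<nabla>\<close> is bounded from \<open>D\<^sup>1(\<Omega>)\<close> to \<open>L\<^sup>2(\<Omega>)\<close>,
  while \<open>\<R>(t)\<close> maps \<open>L\<^sup>2(\<Omega>)\<close> back to \<open>D\<^sup>1(\<Omega>)\<close> with norm \<open>O(t\<^bsup>\<alpha>-1\<^esup>)\<close>, because
  \<open>\<surd>\<theta>\<^sub>k / (1 + \<theta>\<^sub>k)\<close> is bounded. The mild equation thus becomes a linear Volterra equation in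
  \<open>\<ell>\<^sup>2\<close> with an integrable kernel, which is a contraction in an exponentially weighted supremum norm.\<close>

section \<open>The Hilbert space of square summable sequences\<close>

text \<open>Elements of \<open>L2_space\<close> are functions up to null sets, and weak derivatives,
  series limits and hence \<open>S_op\<close> and \<open>R_op\<close> are arbitrarily chosen
  representatives. Operator norms, Bochner integrals and Banach's fixed point theorem, however,
  concern a Banach space given as a type. The equation is therefore solved in the type
  \<open>l2\<close> and carried back by \<open>embed\<close>. Two facts make the return harmless. A
  chosen series limit depends on its coefficient sequence alone, so both operators agree literally
  with embedded \<open>l2\<close> expressions. Weak derivatives are unique almost everywhere; this
  is the fundamental lemma of the calculus of variations and accounts for the explicit smooth bumps.
  The multipliers \<theta>/(1 + \<theta>) lie between 0 and 1, so for bounded times the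
  Mittag-Leffler arguments of all modes share one compact interval. This gives continuity in
  operator norm rather than only strong continuity.\<close>

lemma summable_mult_square_summable:
  fixes x y :: "nat \<Rightarrow> real"
  assumes "summable (\<lambda>k. (x k)\<^sup>2)" "summable (\<lambda>k. (y k)\<^sup>2)"
  shows "summable (\<lambda>k. x k * y k)"
proof (rule summable_comparison_test')
  show "summable (\<lambda>k. (x k)\<^sup>2 + (y k)\<^sup>2)"
    using assms by (rule summable_add)
  show "norm (x k * y k) \<le> (x k)\<^sup>2 + (y k)\<^sup>2" for k
  proof -
    have "2 * (\<bar>x k\<bar> * \<bar>y k\<bar>) \<le> (x k)\<^sup>2 + (y k)\<^sup>2"
      using sum_squares_bound[of "\<bar>x k\<bar>" "\<bar>y k\<bar>"] by (simp add: mult.assoc)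
    moreover have "0 \<le> \<bar>x k\<bar> * \<bar>y k\<bar>"
      by simp
    ultimately show ?thesis
      unfolding real_norm_def abs_mult by linarith
  qed
qed

lemma square_summable_add:
  fixes x y :: "nat \<Rightarrow> real"
  assumes "summable (\<lambda>k. (x k)\<^sup>2)" "summable (\<lambda>k. (y k)\<^sup>2)"
  shows "summable (\<lambda>k. (x k + y k)\<^sup>2)"
  unfolding power2_sum
  by (intro summable_add assms summable_mult2 summable_mult_square_summable)
    (simp add: mult.assoc summable_mult summable_mult_square_summable assms)

typedef l2 = "{x :: nat \<Rightarrow> real. summable (\<lambda>k. (x k)\<^sup>2)}"
  morphisms coord Abs_l2
  by (rule exI[of _ "\<lambda>_. 0"]) simp

setup_lifting type_definition_l2

lemma summable_coord [simp]: "summable (\<lambda>k. (coord x k)\<^sup>2)"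
  using coord[of x] by simp

lemma summable_coord_mult: "summable (\<lambda>k. coord x k * coord y k)"
  by (simp add: summable_mult_square_summable)

lemma coord_Abs_l2: "summable (\<lambda>k. (x k)\<^sup>2) \<Longrightarrow> coord (Abs_l2 x) = x"
  by (simp add: Abs_l2_inverse)

lemma l2_eqI: "(\<And>k. coord x k = coord y k) \<Longrightarrow> x = y"
  by (metis coord_inject ext)

instantiation l2 :: real_inner
begin

lift_definition zero_l2 :: l2 is "\<lambda>_. 0" by simp
lift_definition plus_l2 :: "l2 \<Rightarrow> l2 \<Rightarrow> l2" is "\<lambda>x y k. x k + y k"
  by (rule square_summable_add)
lift_definition uminus_l2 :: "l2 \<Rightarrow> l2" is "\<lambda>x k. - x k" by simp
lift_definition minus_l2 :: "l2 \<Rightarrow> l2 \<Rightarrow> l2" is "\<lambda>x y k. x k - y k"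
  using square_summable_add[where y = "\<lambda>k. - _ k"] by simp
lift_definition scaleR_l2 :: "real \<Rightarrow> l2 \<Rightarrow> l2" is "\<lambda>r x k. r * x k"
  by (simp add: power_mult_distrib summable_mult)
definition inner_l2 :: "l2 \<Rightarrow> l2 \<Rightarrow> real" where
  "inner_l2 x y = (\<Sum>k. coord x k * coord y k)"
definition norm_l2 :: "l2 \<Rightarrow> real" where "norm_l2 x = sqrt (inner x x)"
definition sgn_l2 :: "l2 \<Rightarrow> l2" where "sgn_l2 x = inverse (norm x) *\<^sub>R x"
definition dist_l2 :: "l2 \<Rightarrow> l2 \<Rightarrow> real" where "dist_l2 x y = norm (x - y)"
definition uniformity_l2 :: "(l2 \<times> l2) filter" where
  "uniformity_l2 = (INF e\<in>{0 <..}. principal {(x, y). dist x y < e})"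
definition open_l2 :: "l2 set \<Rightarrow> bool" where
  "open_l2 S = (\<forall>x\<in>S. \<forall>\<^sub>F (x', y) in uniformity. x' = x \<longrightarrow> y \<in> S)"

instance
proof
  fix x y z :: l2 and r s :: real
  show "x + y + z = x + (y + z)" "x + y = y + x" "0 + x = x" "- x + x = 0" "x - y = x + - y"
    "r *\<^sub>R (x + y) = r *\<^sub>R x + r *\<^sub>R y" "(r + s) *\<^sub>R x = r *\<^sub>R x + s *\<^sub>R x"
    "r *\<^sub>R s *\<^sub>R x = (r * s) *\<^sub>R x" "1 *\<^sub>R x = x"
    by (transfer; simp add: algebra_simps)+
  show "inner x y = inner y x" "norm x = sqrt (inner x x)"
    by (simp_all add: inner_l2_def norm_l2_def mult.commute)
  show "inner (x + y) z = inner x z + inner y z"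
    by (simp add: inner_l2_def plus_l2.rep_eq distrib_right suminf_add summable_coord_mult)
  show "inner (r *\<^sub>R x) y = r * inner x y"
    by (simp add: inner_l2_def scaleR_l2.rep_eq mult.assoc suminf_mult summable_coord_mult)
  show "0 \<le> inner x x"
    by (simp add: inner_l2_def suminf_nonneg summable_coord_mult)
  show "inner x x = 0 \<longleftrightarrow> x = 0"
  proof
    assume "inner x x = 0"
    then have "\<forall>k. coord x k * coord x k = 0"
      using suminf_eq_zero_iff[OF summable_coord_mult, of x x] by (simp add: inner_l2_def)
    then show "x = 0"
      by (intro l2_eqI) (simp add: zero_l2.rep_eq)
  qed (simp add: inner_l2_def zero_l2.rep_eq)
qed (rule sgn_l2_def dist_l2_def uniformity_l2_def open_l2_def)+

end

lemmas coord_simps [simp] =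
  zero_l2.rep_eq plus_l2.rep_eq uminus_l2.rep_eq minus_l2.rep_eq scaleR_l2.rep_eq

lemma norm_l2_sq: "(norm x)\<^sup>2 = (\<Sum>k. (coord x k)\<^sup>2)"
  unfolding power2_norm_eq_inner inner_l2_def by (simp add: power2_eq_square)

lemma norm_l2_eq: "norm x = sqrt (\<Sum>k. (coord x k)\<^sup>2)"
  by (simp flip: norm_l2_sq)

lemma coord_sum [simp]: "coord (sum f A) k = (\<Sum>i\<in>A. coord (f i) k)"
  by (induction A rule: infinite_finite_induct) auto

lemma sum_coord_sq_le: "(\<Sum>k<n. (coord x k)\<^sup>2) \<le> (norm x)\<^sup>2"
  unfolding norm_l2_sq by (rule sum_le_suminf) auto

lemma abs_coord_le: "\<bar>coord x k\<bar> \<le> norm x"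
proof -
  have "(coord x k)\<^sup>2 \<le> (norm x)\<^sup>2"
    using sum_coord_sq_le[where n = "Suc k" and x = x] sum_nonneg[of "{..<k}" "\<lambda>k. (coord x k)\<^sup>2"]
    by simp
  then show ?thesis
    using power2_le_imp_le[of "\<bar>coord x k\<bar>" "norm x"] by simp
qed

text \<open>Bounds on partial sums are what Bessel's inequality, diagonal operators and limits of
  Cauchy sequences supply; membership in \<open>l2\<close> and the norm estimate both follow by
  passing to the full series.\<close>

lemma l2_boundI:
  assumes "\<And>n. (\<Sum>k<n. (x k)\<^sup>2) \<le> B\<^sup>2" "0 \<le> B"
  shows "summable (\<lambda>k. (x k)\<^sup>2)" and "norm (Abs_l2 x) \<le> B"
proof -
  show s: "summable (\<lambda>k. (x k)\<^sup>2)"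
    using assms(1) by (intro summableI_nonneg_bounded) auto
  then have "(norm (Abs_l2 x))\<^sup>2 \<le> B\<^sup>2"
    using assms(1) by (auto simp: norm_l2_sq coord_Abs_l2 intro!: suminf_le_const)
  with assms(2) show "norm (Abs_l2 x) \<le> B"
    by (rule power2_le_imp_le[rotated])
qed

text \<open>Coordinates converge because each is dominated by the norm. The Cauchy estimate is
  applied to a fixed finite block of coordinates, where the limit may be taken; since the bound does
  not depend on the block, it extends to the whole series.\<close>

instance l2 :: banach
proof
  fix X :: "nat \<Rightarrow> l2" assume X: "Cauchy X"
  have "convergent (\<lambda>n. coord (X n) k)" for k
  proof (rule real_Cauchy_convergent, rule CauchyI)
    fix e :: real assume "e > 0"
    then obtain N where N: "\<And>m n. m \<ge> N \<Longrightarrow> n \<ge> N \<Longrightarrow> norm (X m - X n) < e"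
      using CauchyD[OF X] by blast
    show "\<exists>M. \<forall>m\<ge>M. \<forall>n\<ge>M. norm (coord (X m) k - coord (X n) k) < e"
    proof (intro exI[of _ N] allI impI)
      fix m n assume "m \<ge> N" "n \<ge> N"
      then show "norm (coord (X m) k - coord (X n) k) < e"
        using N[of m n] abs_coord_le[of "X m - X n" k] by simp
    qed
  qed
  then obtain c where c: "\<And>k. (\<lambda>n. coord (X n) k) \<longlonglongrightarrow> c k"
    unfolding convergent_def by metis
  have main: "\<exists>N. \<forall>m\<ge>N. summable (\<lambda>k. (coord (X m) k - c k)\<^sup>2) \<and>
      norm (Abs_l2 (\<lambda>k. coord (X m) k - c k)) \<le> e" if "e > 0" for e
  proof -
    obtain N where N: "\<And>m n. m \<ge> N \<Longrightarrow> n \<ge> N \<Longrightarrow> norm (X m - X n) < e"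
      using CauchyD[OF X \<open>e > 0\<close>] by blast
    have "(\<Sum>k<j. (coord (X m) k - c k)\<^sup>2) \<le> e\<^sup>2" if "m \<ge> N" for m j
    proof (rule LIMSEQ_le_const2)
      show "(\<lambda>n. \<Sum>k<j. (coord (X m) k - coord (X n) k)\<^sup>2) \<longlonglongrightarrow> (\<Sum>k<j. (coord (X m) k - c k)\<^sup>2)"
        by (intro tendsto_intros c)
      show "\<exists>M. \<forall>n\<ge>M. (\<Sum>k<j. (coord (X m) k - coord (X n) k)\<^sup>2) \<le> e\<^sup>2"
      proof (intro exI[of _ N] allI impI)
        fix n assume "n \<ge> N"
        have "(\<Sum>k<j. (coord (X m) k - coord (X n) k)\<^sup>2) \<le> (norm (X m - X n))\<^sup>2"
          using sum_coord_sq_le[of "X m - X n" j] by simp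
        also have "\<dots> \<le> e\<^sup>2"
          using N[OF that \<open>n \<ge> N\<close>] by (intro power_mono) auto
        finally show "(\<Sum>k<j. (coord (X m) k - coord (X n) k)\<^sup>2) \<le> e\<^sup>2" .
      qed
    qed
    then show ?thesis
      using \<open>e > 0\<close> by (intro exI[of _ N] allI impI conjI l2_boundI) auto
  qed
  obtain N where "summable (\<lambda>k. (coord (X N) k - c k)\<^sup>2)"
    using main[of 1] by auto
  \<comment> \<open>The coordinatewise limit is a member of the sequence minus a square summable
    difference, hence square summable itself.\<close>
  then have "summable (\<lambda>k. (coord (X N) k + - 1 * (coord (X N) k - c k))\<^sup>2)"
    by (intro square_summable_add summable_coord) (simp only: power_mult_distrib, simp)
  then have sc: "summable (\<lambda>k. (c k)\<^sup>2)"
    by simp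
  have "X \<longlonglongrightarrow> Abs_l2 c"
  proof (rule LIMSEQ_I)
    fix r :: real assume "r > 0"
    obtain N where N: "\<And>m. m \<ge> N \<Longrightarrow> summable (\<lambda>k. (coord (X m) k - c k)\<^sup>2) \<and>
      norm (Abs_l2 (\<lambda>k. coord (X m) k - c k)) \<le> r / 2"
      using main[of "r/2"] \<open>r > 0\<close> by auto
    have "norm (X m - Abs_l2 c) < r" if "m \<ge> N" for m
    proof -
      have "X m - Abs_l2 c = Abs_l2 (\<lambda>k. coord (X m) k - c k)"
        using N[OF that] sc by (intro l2_eqI) (simp add: coord_Abs_l2)
      then show ?thesis
        using N[OF that] \<open>r > 0\<close> by simp
    qed
    then show "\<exists>no. \<forall>n\<ge>no. norm (X n - Abs_l2 c) < r" by auto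
  qed
  then show "convergent X"
    by (auto simp: convergent_def)
qed

section \<open>Separability of \<open>l2\<close>\<close>

lemma finite_support_summable: "summable (\<lambda>k. ((if k < n then x k else 0)::real)\<^sup>2)"
  by (rule summable_finite[of "{..<n}"]) auto

text \<open>The squared error of a truncation is the tail of the convergent series for the squared
  norm.\<close>

lemma l2_truncation_tendsto: "(\<lambda>n. Abs_l2 (\<lambda>k. if k < n then coord x k else 0)) \<longlonglongrightarrow> x"
proof (rule Lim_null_comparison[THEN LIM_zero_cancel])
  have "(norm (Abs_l2 (\<lambda>k. if k < n then coord x k else 0) - x))\<^sup>2 = (norm x)\<^sup>2 - (\<Sum>k<n. (coord x k)\<^sup>2)" for n
  proof -
    have "(\<lambda>k. (coord x k)\<^sup>2 - (if k < n then (coord x k)\<^sup>2 else 0)) sums ((norm x)\<^sup>2 - (\<Sum>k<n. (coord x k)\<^sup>2))"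
      using sums_If_finite_set[of "{..<n}" "\<lambda>k. (coord x k)\<^sup>2"]
      by (intro sums_diff) (auto simp: norm_l2_sq summable_sums)
    moreover have "(coord x k)\<^sup>2 - (if k < n then (coord x k)\<^sup>2 else 0) =
       (coord (Abs_l2 (\<lambda>k. if k < n then coord x k else 0) - x) k)\<^sup>2" for k
      by (simp add: coord_Abs_l2 finite_support_summable)
    ultimately show ?thesis
      unfolding norm_l2_sq[of "_ - _"] by (simp add: sums_iff)
  qed
  then have "norm (Abs_l2 (\<lambda>k. if k < n then coord x k else 0) - x) = sqrt ((norm x)\<^sup>2 - (\<Sum>k<n. (coord x k)\<^sup>2))" for n
    by (rule real_sqrt_unique[symmetric]) simp
  then show "\<forall>\<^sub>F n in sequentially. norm (Abs_l2 (\<lambda>k. if k < n then coord x k else 0) - x)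
      \<le> sqrt ((norm x)\<^sup>2 - (\<Sum>k<n. (coord x k)\<^sup>2))"
    by simp
  have "(\<lambda>n. \<Sum>k<n. (coord x k)\<^sup>2) \<longlonglongrightarrow> (norm x)\<^sup>2"
    by (simp add: norm_l2_sq summable_LIMSEQ)
  then have "(\<lambda>n. sqrt ((norm x)\<^sup>2 - (\<Sum>k<n. (coord x k)\<^sup>2))) \<longlonglongrightarrow> sqrt ((norm x)\<^sup>2 - (norm x)\<^sup>2)"
    by (intro tendsto_intros)
  then show "(\<lambda>n. sqrt ((norm x)\<^sup>2 - (\<Sum>k<n. (coord x k)\<^sup>2))) \<longlonglongrightarrow> 0"
    by simp
qed

lemma l2_countable_dense: "\<exists>D :: l2 set. countable D \<and> (\<forall>x e. e > 0 \<longrightarrow> (\<exists>d\<in>D. dist x d < e))"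
proof -
  define F :: "real list \<Rightarrow> nat \<Rightarrow> real" where "F qs = (\<lambda>k. if k < length qs then qs ! k else 0)" for qs
  have sF: "summable (\<lambda>k. (F qs k)\<^sup>2)" for qs
    by (rule summable_finite[of "{..<length qs}"]) (auto simp: F_def)
  define D where "D = (\<lambda>qs. Abs_l2 (F qs)) ` lists \<rat>"
  have "countable D"
    unfolding D_def by (intro countable_image countable_lists countable_rat)
  moreover have "\<exists>d\<in>D. dist x d < e" if "e > 0" for x e
  proof -
    obtain n where n: "dist (Abs_l2 (\<lambda>k. if k < n then coord x k else 0)) x < e / 2"
      using metric_LIMSEQ_D[OF l2_truncation_tendsto[of x], of "e/2"] \<open>e > 0\<close> by auto
    define y where "y = Abs_l2 (\<lambda>k. if k < n then coord x k else 0)"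
    \<comment> \<open>The truncation costs e/2. The n remaining coordinates contribute at most n *
      \<delta>^2 \<le> ((n + 1) * \<delta>)^2 = (e/2)^2 to the squared distance; n + 1 also avoids a
      division by zero for n = 0.\<close>
    define \<delta> where "\<delta> = e / (2 * (real n + 1))"
    have "\<delta> > 0" using \<open>e > 0\<close> by (simp add: \<delta>_def)
    have "\<exists>q\<in>\<rat>. \<bar>coord x k - q\<bar> < \<delta>" for k
    proof -
      obtain q where "q \<in> \<rat>" "coord x k - \<delta> < q" "q < coord x k + \<delta>"
        using Rats_dense_in_real[of "coord x k - \<delta>" "coord x k + \<delta>"] \<open>\<delta> > 0\<close> by auto
      then show ?thesis by (intro bexI[of _ q]) auto
    qed
    then obtain q where q: "\<And>k. q k \<in> \<rat>" "\<And>k. \<bar>coord x k - q k\<bar> < \<delta>" by metis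
    define d where "d = Abs_l2 (F (map q [0..<n]))"
    have "d \<in> D" unfolding D_def d_def using q(1) by (intro imageI) auto
    have cd: "coord d k = (if k < n then q k else 0)" for k
      unfolding d_def by (simp add: coord_Abs_l2[OF sF]) (simp add: F_def)
    have cy: "coord y k = (if k < n then coord x k else 0)" for k
      unfolding y_def by (simp add: coord_Abs_l2 finite_support_summable)
    have "norm (y - d) = sqrt (\<Sum>k. (coord (y - d) k)\<^sup>2)"
      by (rule norm_l2_eq)
    also have "(\<Sum>k. (coord (y - d) k)\<^sup>2) = (\<Sum>k<n. (coord x k - q k)\<^sup>2)"
      by (subst suminf_finite[of "{..<n}"]) (auto simp: cd cy)
    also have "\<dots> \<le> (\<Sum>k<n. \<delta>\<^sup>2)"
      using q(2) \<open>\<delta> > 0\<close> by (intro sum_mono) (metis abs_le_square_iff abs_of_pos less_imp_le)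
    also have "\<dots> \<le> ((real n + 1) * \<delta>)\<^sup>2"
    proof -
      have "real n \<le> (real n + 1)\<^sup>2" by (simp add: power2_eq_square algebra_simps)
      then show ?thesis by (simp add: power_mult_distrib mult_right_mono)
    qed
    also have "sqrt \<dots> = e / 2"
    proof -
      have "(real n + 1) * \<delta> = e / 2"
        by (simp add: \<delta>_def divide_simps)
      then show ?thesis using \<open>e > 0\<close> by simp
    qed
    finally have "dist y d \<le> e / 2"
      by (simp add: dist_norm)
    then have "dist x d < e"
      using n dist_triangle[of x d y] unfolding y_def by (simp add: dist_commute)
    then show ?thesis using \<open>d \<in> D\<close> by blast
  qed
  ultimately show ?thesis by blast
qed

text \<open>The Bochner integral and the locale \<open>volterra_kernel\<close> require this class.
  The base consists of balls of radius 1/(n + 1) about a countable dense set.\<close>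

instance l2 :: second_countable_topology
proof
  obtain D :: "l2 set" where D: "countable D" "\<And>x e. e > 0 \<Longrightarrow> \<exists>d\<in>D. dist x d < e"
    using l2_countable_dense by blast
  define B where "B = (\<lambda>(d, n). ball d (1 / real (Suc n))) ` (D \<times> UNIV)"
  have "topological_basis B"
  proof (rule topological_basisI)
    fix S :: "l2 set" and x assume "open S" "x \<in> S"
    then obtain e where e: "e > 0" "ball x e \<subseteq> S"
      by (meson open_contains_ball)
    obtain n where n: "1 / real (Suc n) < e / 2"
      using nat_approx_posE[of "e / 2"] \<open>e > 0\<close> by auto
    obtain d where d: "d \<in> D" "dist x d < 1 / real (Suc n)"
      using D(2)[of "1 / real (Suc n)" x] by auto
    have "ball d (1 / real (Suc n)) \<subseteq> S"
    proof
      fix y assume "y \<in> ball d (1 / real (Suc n))"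
      then have "dist x y < e"
        using d(2) n dist_triangle[of x y d] by simp
      then show "y \<in> S" using e by auto
    qed
    moreover have "x \<in> ball d (1 / real (Suc n))"
      using d by (simp add: dist_commute)
    ultimately show "\<exists>B'\<in>B. x \<in> B' \<and> B' \<subseteq> S"
      using d(1) by (auto simp: B_def)
  qed (auto simp: B_def)
  moreover have "countable B"
    unfolding B_def using D(1) by (intro countable_image) auto
  ultimately show "\<exists>B :: l2 set set. countable B \<and> open = generate_topology B"
    using topological_basis_imp_subbasis by blast
qed

section \<open>The semi-inner product space \<open>L\<^sup>2(\<Omega>)\<close>\<close>

locale bounded_open =
  fixes \<Omega> :: "'a::euclidean_space set"
  assumes open_domain: "open \<Omega>" and bounded_domain: "bounded \<Omega>"
begin

lemma domain_lmeasurable: "\<Omega> \<in> lmeasurable"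
  using open_domain bounded_domain by (rule lmeasurable_open[rotated])

lemma domain_sets [measurable, simp]: "\<Omega> \<in> sets lebesgue"
  using domain_lmeasurable by blast

sublocale finite_measure "lebesgue_on \<Omega>"
  by (rule finite_measure_lebesgue_on[OF domain_lmeasurable])

text \<open>Completeness of Lebesgue measure. Extension by zero moves the question from
  \<open>lebesgue_on \<Omega>\<close> to \<open>lebesgue\<close> on the whole space.\<close>

lemma measurable_AE_cong:
  fixes f g :: "'a \<Rightarrow> real"
  assumes "f \<in> borel_measurable (lebesgue_on \<Omega>)" "AE x in lebesgue_on \<Omega>. f x = g x"
  shows "g \<in> borel_measurable (lebesgue_on \<Omega>)"
proof -
  have "(\<lambda>x. if x \<in> \<Omega> then f x else 0) \<in> borel_measurable lebesgue"
    using assms(1) by (rule borel_measurable_if_I) simp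
  moreover have "AE x in lebesgue. (if x \<in> \<Omega> then f x else 0) = (if x \<in> \<Omega> then g x else 0)"
    using assms(2) by (subst (asm) AE_restrict_space_iff) auto
  ultimately have "(\<lambda>x. if x \<in> \<Omega> then g x else 0) \<in> borel_measurable lebesgue"
    by (rule borel_measurable_AE)
  then show ?thesis
    by (rule borel_measurable_if_D)
qed

lemma L2_measurable: "w \<in> L2_space \<Omega> \<Longrightarrow> w \<in> borel_measurable (lebesgue_on \<Omega>)"
  and L2_integrable_sq: "w \<in> L2_space \<Omega> \<Longrightarrow> integrable (lebesgue_on \<Omega>) (\<lambda>x. (w x)\<^sup>2)"
  by (auto simp: L2_space_def)

lemma L2_integrable_mult:
  assumes "u \<in> L2_space \<Omega>" "v \<in> L2_space \<Omega>"
  shows "integrable (lebesgue_on \<Omega>) (\<lambda>x. u x * v x)"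
proof (rule Bochner_Integration.integrable_bound)
  show "integrable (lebesgue_on \<Omega>) (\<lambda>x. (u x)\<^sup>2 + (v x)\<^sup>2)"
    using assms by (intro Bochner_Integration.integrable_add L2_integrable_sq)
  show "(\<lambda>x. u x * v x) \<in> borel_measurable (lebesgue_on \<Omega>)"
    using assms by (intro borel_measurable_times L2_measurable)
  have "\<bar>a * b\<bar> \<le> \<bar>a\<^sup>2 + b\<^sup>2\<bar>" for a b :: real
  proof -
    have "2 * (\<bar>a\<bar> * \<bar>b\<bar>) \<le> a\<^sup>2 + b\<^sup>2"
      using sum_squares_bound[of "\<bar>a\<bar>" "\<bar>b\<bar>"] by (simp add: mult.assoc)
    moreover have "0 \<le> \<bar>a\<bar> * \<bar>b\<bar>"
      by simp
    ultimately show ?thesis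
      unfolding abs_mult by linarith
  qed
  then show "AE x in lebesgue_on \<Omega>. norm (u x * v x) \<le> norm ((u x)\<^sup>2 + (v x)\<^sup>2)"
    by simp
qed

lemma L2_const [simp]: "(\<lambda>x. c) \<in> L2_space \<Omega>"
  by (simp add: L2_space_def)

lemma L2_scale: "u \<in> L2_space \<Omega> \<Longrightarrow> (\<lambda>x. c * u x) \<in> L2_space \<Omega>"
  by (auto simp: L2_space_def power_mult_distrib intro!: borel_measurable_times)

lemma L2_add:
  assumes "u \<in> L2_space \<Omega>" "v \<in> L2_space \<Omega>"
  shows "(\<lambda>x. u x + v x) \<in> L2_space \<Omega>"
  using assms L2_integrable_mult[OF assms]
  by (auto simp: L2_space_def power2_sum mult.assoc)

lemma L2_diff:
  assumes "u \<in> L2_space \<Omega>" "v \<in> L2_space \<Omega>"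
  shows "(\<lambda>x. u x - v x) \<in> L2_space \<Omega>"
  using L2_add[OF assms(1) L2_scale[OF assms(2), of "-1"]] by simp

lemma L2_sum: "(\<And>i. i \<in> I \<Longrightarrow> u i \<in> L2_space \<Omega>) \<Longrightarrow> (\<lambda>x. \<Sum>i\<in>I. u i x) \<in> L2_space \<Omega>"
  by (induction I rule: infinite_finite_induct) (auto intro: L2_add)

lemma L2_space_cong:
  assumes "u \<in> L2_space \<Omega>" "L2_eq \<Omega> u v"
  shows "v \<in> L2_space \<Omega>"
proof -
  have m: "v \<in> borel_measurable (lebesgue_on \<Omega>)"
    using assms by (auto simp: L2_eq_def intro: measurable_AE_cong L2_measurable)
  have "integrable (lebesgue_on \<Omega>) (\<lambda>x. (u x)\<^sup>2) \<longleftrightarrow> integrable (lebesgue_on \<Omega>) (\<lambda>x. (v x)\<^sup>2)"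
    using assms(2) m L2_measurable[OF assms(1)]
    by (intro integrable_cong_AE borel_measurable_power) (auto simp: L2_eq_def)
  then show ?thesis
    using m assms(1) by (simp add: L2_space_def)
qed

lemma L2_eq_refl [simp]: "L2_eq \<Omega> u u"
  by (simp add: L2_eq_def)

lemma L2_eq_sym: "L2_eq \<Omega> u v \<Longrightarrow> L2_eq \<Omega> v u"
  unfolding L2_eq_def by (elim eventually_mono) simp

lemma L2_eq_add: "L2_eq \<Omega> u u' \<Longrightarrow> L2_eq \<Omega> v v' \<Longrightarrow> L2_eq \<Omega> (\<lambda>x. u x + v x) (\<lambda>x. u' x + v' x)"
  unfolding L2_eq_def by (erule (1) eventually_elim2) simp

lemma L2_eq_diff: "L2_eq \<Omega> u u' \<Longrightarrow> L2_eq \<Omega> v v' \<Longrightarrow> L2_eq \<Omega> (\<lambda>x. u x - v x) (\<lambda>x. u' x - v' x)"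
  unfolding L2_eq_def by (erule (1) eventually_elim2) simp

lemma L2_eq_scale: "L2_eq \<Omega> u u' \<Longrightarrow> L2_eq \<Omega> (\<lambda>x. c * u x) (\<lambda>x. c * u' x)"
  unfolding L2_eq_def by (erule eventually_mono) simp

lemma L2_eq_sum:
  "(\<And>i. i \<in> I \<Longrightarrow> L2_eq \<Omega> (u i) (v i)) \<Longrightarrow> L2_eq \<Omega> (\<lambda>x. \<Sum>i\<in>I. u i x) (\<lambda>x. \<Sum>i\<in>I. v i x)"
  by (induction I rule: infinite_finite_induct) (auto intro: L2_eq_add)

lemma L2_inner_commute: "L2_inner \<Omega> u v = L2_inner \<Omega> v u"
  by (simp add: L2_inner_def mult.commute)

lemma L2_inner_add_left:
  "u \<in> L2_space \<Omega> \<Longrightarrow> v \<in> L2_space \<Omega> \<Longrightarrow> w \<in> L2_space \<Omega> \<Longrightarrow>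
    L2_inner \<Omega> (\<lambda>x. u x + v x) w = L2_inner \<Omega> u w + L2_inner \<Omega> v w"
  by (simp add: L2_inner_def distrib_right L2_integrable_mult)

lemma L2_inner_add_right:
  "w \<in> L2_space \<Omega> \<Longrightarrow> u \<in> L2_space \<Omega> \<Longrightarrow> v \<in> L2_space \<Omega> \<Longrightarrow>
    L2_inner \<Omega> w (\<lambda>x. u x + v x) = L2_inner \<Omega> w u + L2_inner \<Omega> w v"
  by (simp add: L2_inner_def distrib_left L2_integrable_mult)

lemma L2_inner_diff_left:
  "u \<in> L2_space \<Omega> \<Longrightarrow> v \<in> L2_space \<Omega> \<Longrightarrow> w \<in> L2_space \<Omega> \<Longrightarrow>
    L2_inner \<Omega> (\<lambda>x. u x - v x) w = L2_inner \<Omega> u w - L2_inner \<Omega> v w"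
  by (simp add: L2_inner_def left_diff_distrib L2_integrable_mult)

lemma L2_inner_scale_left: "L2_inner \<Omega> (\<lambda>x. c * u x) w = c * L2_inner \<Omega> u w"
  by (simp add: L2_inner_def mult.assoc)

lemma L2_inner_scale_right: "L2_inner \<Omega> w (\<lambda>x. c * u x) = c * L2_inner \<Omega> w u"
  by (simp add: L2_inner_def mult.left_commute)

lemma L2_inner_sum_left:
  assumes "\<And>i. i \<in> I \<Longrightarrow> u i \<in> L2_space \<Omega>" "w \<in> L2_space \<Omega>"
  shows "L2_inner \<Omega> (\<lambda>x. \<Sum>i\<in>I. u i x) w = (\<Sum>i\<in>I. L2_inner \<Omega> (u i) w)"
  using assms(1)
proof (induction I rule: infinite_finite_induct)
  case (insert i I)
  then show ?case
    using assms(2) by (simp add: L2_inner_add_left L2_sum)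
qed (simp_all add: L2_inner_def)

lemma L2_inner_cong:
  assumes "u \<in> L2_space \<Omega>" "v \<in> L2_space \<Omega>" "L2_eq \<Omega> u u'" "L2_eq \<Omega> v v'"
  shows "L2_inner \<Omega> u v = L2_inner \<Omega> u' v'"
  unfolding L2_inner_def
  using assms L2_space_cong[OF assms(1,3)] L2_space_cong[OF assms(2,4)]
  by (intro integral_cong_AE borel_measurable_times L2_measurable) (auto simp: L2_eq_def)

lemma L2_inner_self_nonneg: "0 \<le> L2_inner \<Omega> u u"
  by (simp add: L2_inner_def)

lemma L2_norm_nonneg [simp]: "0 \<le> L2_norm \<Omega> u"
  by (simp add: L2_norm_def L2_inner_self_nonneg)

lemma L2_norm_sq: "(L2_norm \<Omega> u)\<^sup>2 = L2_inner \<Omega> u u"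
  by (simp add: L2_norm_def L2_inner_self_nonneg)

lemma L2_norm_zero [simp]: "L2_norm \<Omega> (\<lambda>x. 0) = 0"
  by (simp add: L2_norm_def L2_inner_def)

lemma L2_norm_cong: "u \<in> L2_space \<Omega> \<Longrightarrow> L2_eq \<Omega> u v \<Longrightarrow> L2_norm \<Omega> u = L2_norm \<Omega> v"
  by (simp add: L2_norm_def L2_inner_cong[of u u v v])

lemma L2_norm_scale: "L2_norm \<Omega> (\<lambda>x. c * u x) = \<bar>c\<bar> * L2_norm \<Omega> u"
proof -
  have "L2_inner \<Omega> (\<lambda>x. c * u x) (\<lambda>x. c * u x) = c\<^sup>2 * L2_inner \<Omega> u u"
    by (simp add: L2_inner_scale_left L2_inner_scale_right power2_eq_square)
  then show ?thesis
    by (simp add: L2_norm_def real_sqrt_mult)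
qed

lemma L2_norm_minus_commute: "L2_norm \<Omega> (\<lambda>x. u x - v x) = L2_norm \<Omega> (\<lambda>x. v x - u x)"
  using L2_norm_scale[of "-1" "\<lambda>x. u x - v x"] by simp

lemma L2_norm_add_sq:
  assumes "u \<in> L2_space \<Omega>" "v \<in> L2_space \<Omega>"
  shows "(L2_norm \<Omega> (\<lambda>x. u x + v x))\<^sup>2 = (L2_norm \<Omega> u)\<^sup>2 + 2 * L2_inner \<Omega> u v + (L2_norm \<Omega> v)\<^sup>2"
  unfolding L2_norm_sq L2_inner_add_left[OF assms L2_add[OF assms]]
    L2_inner_add_right[OF assms(1) assms] L2_inner_add_right[OF assms(2) assms]
  by (simp add: L2_inner_commute[of v u])

text \<open>The discriminant argument for t -> ||u + t v||^2, which is minimal at t = -b/c. The form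
  is only semidefinite on functions, so c = 0 is a separate case that cannot be settled by v =
  0.\<close>

lemma L2_Cauchy_Schwarz:
  assumes u: "u \<in> L2_space \<Omega>" and v: "v \<in> L2_space \<Omega>"
  shows "\<bar>L2_inner \<Omega> u v\<bar> \<le> L2_norm \<Omega> u * L2_norm \<Omega> v"
proof -
  define a b c where "a = (L2_norm \<Omega> u)\<^sup>2" and "b = L2_inner \<Omega> u v" and "c = (L2_norm \<Omega> v)\<^sup>2"
  have q: "0 \<le> a + 2 * t * b + t\<^sup>2 * c" for t
  proof -
    have "a + 2 * t * b + t\<^sup>2 * c = (L2_norm \<Omega> (\<lambda>x. u x + t * v x))\<^sup>2"
      using L2_norm_add_sq[OF u L2_scale[OF v, of t]]
      by (simp add: a_def b_def c_def L2_inner_scale_right L2_norm_scale power_mult_distrib)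
    then show ?thesis by simp
  qed
  have "c \<ge> 0" by (simp add: c_def)
  have "b\<^sup>2 \<le> a * c"
  proof (cases "c = 0")
    case True
    have "b = 0"
    proof (rule ccontr)
      assume "b \<noteq> 0"
      \<comment> \<open>For c = 0 the nonnegative expression a + 2 t b is affine in t; this t gives
        it the value -1.\<close>
      then have "2 * (- (a + 1) / (2 * b)) * b = - (a + 1)" by simp
      then show False using q[of "- (a + 1) / (2 * b)"] True by simp
    qed
    then show ?thesis using True by simp
  next
    case False
    then have "c > 0" using \<open>c \<ge> 0\<close> by simp
    have "0 \<le> a + 2 * (- b / c) * b + (- b / c)\<^sup>2 * c" by (rule q)
    also have "\<dots> = a - b\<^sup>2 / c"
      using \<open>c > 0\<close> by (simp add: power2_eq_square)
    finally show ?thesis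
      using \<open>c > 0\<close> by (simp add: divide_le_eq)
  qed
  then have "\<bar>b\<bar>\<^sup>2 \<le> (L2_norm \<Omega> u * L2_norm \<Omega> v)\<^sup>2"
    by (simp add: a_def c_def power_mult_distrib)
  then show ?thesis
    unfolding b_def by (rule power2_le_imp_le) simp
qed

lemma L2_norm_triangle:
  assumes u: "u \<in> L2_space \<Omega>" and v: "v \<in> L2_space \<Omega>"
  shows "L2_norm \<Omega> (\<lambda>x. u x + v x) \<le> L2_norm \<Omega> u + L2_norm \<Omega> v"
proof (rule power2_le_imp_le)
  show "(L2_norm \<Omega> (\<lambda>x. u x + v x))\<^sup>2 \<le> (L2_norm \<Omega> u + L2_norm \<Omega> v)\<^sup>2"
    using L2_Cauchy_Schwarz[OF u v] by (simp add: L2_norm_add_sq[OF u v] power2_sum)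
qed simp

lemma L2_norm_le_diff:
  assumes u: "u \<in> L2_space \<Omega>" and v: "v \<in> L2_space \<Omega>"
  shows "\<bar>L2_norm \<Omega> u - L2_norm \<Omega> v\<bar> \<le> L2_norm \<Omega> (\<lambda>x. u x - v x)"
  using L2_norm_triangle[OF L2_diff[OF u v] v] L2_norm_triangle[OF L2_diff[OF v u] u]
    L2_norm_minus_commute[of u v] by simp

lemma L2_norm_tendsto:
  assumes "\<And>n. u n \<in> L2_space \<Omega>" "v \<in> L2_space \<Omega>"
    and lim: "(\<lambda>n. L2_norm \<Omega> (\<lambda>x. u n x - v x)) \<longlonglongrightarrow> 0"
  shows "(\<lambda>n. L2_norm \<Omega> (u n)) \<longlonglongrightarrow> L2_norm \<Omega> v"
  by (rule LIM_zero_cancel, rule Lim_null_comparison[OF _ lim]) (simp add: assms L2_norm_le_diff)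

lemma L2_inner_tendsto:
  assumes u: "\<And>n. u n \<in> L2_space \<Omega>" "v \<in> L2_space \<Omega>" and w: "w \<in> L2_space \<Omega>"
    and lim: "(\<lambda>n. L2_norm \<Omega> (\<lambda>x. u n x - v x)) \<longlonglongrightarrow> 0"
  shows "(\<lambda>n. L2_inner \<Omega> (u n) w) \<longlonglongrightarrow> L2_inner \<Omega> v w"
proof (rule LIM_zero_cancel, rule Lim_null_comparison)
  show "\<forall>\<^sub>F n in sequentially. norm (L2_inner \<Omega> (u n) w - L2_inner \<Omega> v w)
      \<le> L2_norm \<Omega> (\<lambda>x. u n x - v x) * L2_norm \<Omega> w"
    using L2_Cauchy_Schwarz[OF L2_diff[OF u] w] by (simp add: L2_inner_diff_left[OF u w])
  show "(\<lambda>n. L2_norm \<Omega> (\<lambda>x. u n x - v x) * L2_norm \<Omega> w) \<longlonglongrightarrow> 0"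
    using tendsto_mult_right[OF lim, of "L2_norm \<Omega> w"] by simp
qed

lemma L2_imp_integrable: "u \<in> L2_space \<Omega> \<Longrightarrow> integrable (lebesgue_on \<Omega>) u"
  using L2_integrable_mult[of u "\<lambda>_. 1"] by simp

lemma L2_abs: "u \<in> L2_space \<Omega> \<Longrightarrow> (\<lambda>x. \<bar>u x\<bar>) \<in> L2_space \<Omega>"
  by (auto simp: L2_space_def)

text \<open>Cauchy-Schwarz against the constant 1, which lies in \<open>L2_space \<Omega>\<close>
  because \<Omega> has finite measure.\<close>

lemma L1_le_L2:
  assumes "u \<in> L2_space \<Omega>"
  shows "(LINT x|lebesgue_on \<Omega>. \<bar>u x\<bar>) \<le> L2_norm \<Omega> u * L2_norm \<Omega> (\<lambda>x. 1)"
proof -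
  have "L2_norm \<Omega> (\<lambda>x. \<bar>u x\<bar>) = L2_norm \<Omega> u"
    by (simp add: L2_norm_def L2_inner_def)
  then show ?thesis
    using L2_Cauchy_Schwarz[OF L2_abs[OF assms], of "\<lambda>x. 1"] by (simp add: L2_inner_def)
qed

text \<open>On a finite measure space \<open>L\<^sup>2\<close>-Cauchy implies \<open>L\<^sup>1\<close>-Cauchy, which gives an almost everywhere
  convergent subsequence; Fatou's lemma turns its limit into the \<open>L\<^sup>2\<close>-limit.\<close>

lemma L2_complete:
  assumes f: "\<And>n. f n \<in> L2_space \<Omega>"
    and C: "\<And>e. e > 0 \<Longrightarrow> \<exists>N. \<forall>i\<ge>N. \<forall>j\<ge>N. L2_norm \<Omega> (\<lambda>x. f i x - f j x) < e"
  obtains g where "g \<in> L2_space \<Omega>" "(\<lambda>n. L2_norm \<Omega> (\<lambda>x. f n x - g x)) \<longlonglongrightarrow> 0"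
proof -
  let ?M = "lebesgue_on \<Omega>"
  have [measurable]: "f n \<in> borel_measurable ?M" for n
    using f by (rule L2_measurable)
  obtain r where r: "strict_mono r" and ae: "AE x in ?M. Cauchy (\<lambda>i. f (r i) x)"
  proof (rule cauchy_L1_AE_cauchy_subseq[of ?M f])
    fix e :: real assume "e > 0"
    \<comment> \<open>The summand 1 keeps \<open>c\<close> positive even when \<Omega> is
      empty.\<close>
    define c where "c = L2_norm \<Omega> (\<lambda>x. 1) + 1"
    have "c > 0" unfolding c_def using L2_norm_nonneg[of "\<lambda>x. 1"] by linarith
    obtain N where N: "\<And>i j. i \<ge> N \<Longrightarrow> j \<ge> N \<Longrightarrow> L2_norm \<Omega> (\<lambda>x. f i x - f j x) < e / c"
      using C[of "e / c"] \<open>e > 0\<close> \<open>c > 0\<close> by auto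
    have "(LINT x|?M. norm (f i x - f j x)) < e" if "i \<ge> N" "j \<ge> N" for i j
    proof -
      have "(LINT x|?M. norm (f i x - f j x)) \<le> L2_norm \<Omega> (\<lambda>x. f i x - f j x) * L2_norm \<Omega> (\<lambda>x. 1)"
        using L1_le_L2[OF L2_diff[OF f f]] by simp
      also have "\<dots> \<le> L2_norm \<Omega> (\<lambda>x. f i x - f j x) * c"
        by (intro mult_left_mono) (auto simp: c_def)
      also have "\<dots> < e"
        using N[OF that] \<open>c > 0\<close> by (simp add: pos_less_divide_eq)
      finally show ?thesis .
    qed
    then show "\<exists>N. \<forall>i\<ge>N. \<forall>j\<ge>N. (LINT x|?M. norm (f i x - f j x)) < e"
      by blast
  qed (auto intro: L2_imp_integrable f)
  define g where "g x = lim (\<lambda>i. f (r i) x)" for x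
  have [measurable]: "g \<in> borel_measurable ?M"
    unfolding g_def by measurable
  have ae': "AE x in ?M. (\<lambda>i. f (r i) x) \<longlonglongrightarrow> g x"
    using ae by eventually_elim (auto simp: g_def Cauchy_convergent_iff convergent_LIMSEQ_iff)
  have nn: "(\<integral>\<^sup>+x. ennreal ((f n x - f m x)\<^sup>2) \<partial>?M) = ennreal ((L2_norm \<Omega> (\<lambda>x. f n x - f m x))\<^sup>2)" for n m
    unfolding L2_norm_sq L2_inner_def using L2_integrable_sq[OF L2_diff[OF f f]]
    by (subst nn_integral_eq_integral) (auto simp: power2_eq_square)
  have key: "\<exists>N. \<forall>n\<ge>N. (\<lambda>x. f n x - g x) \<in> L2_space \<Omega> \<and> L2_norm \<Omega> (\<lambda>x. f n x - g x) \<le> e" if "e > 0" for e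
  proof -
    obtain N where N: "\<And>i j. i \<ge> N \<Longrightarrow> j \<ge> N \<Longrightarrow> L2_norm \<Omega> (\<lambda>x. f i x - f j x) < e"
      using C[OF \<open>e > 0\<close>] by blast
    have "(\<lambda>x. f n x - g x) \<in> L2_space \<Omega> \<and> L2_norm \<Omega> (\<lambda>x. f n x - g x) \<le> e" if "n \<ge> N" for n
    proof -
      have "(\<integral>\<^sup>+x. ennreal ((f n x - g x)\<^sup>2) \<partial>?M) = (\<integral>\<^sup>+x. liminf (\<lambda>i. ennreal ((f n x - f (r i) x)\<^sup>2)) \<partial>?M)"
      proof (rule nn_integral_cong_AE)
        show "AE x in ?M. ennreal ((f n x - g x)\<^sup>2) = liminf (\<lambda>i. ennreal ((f n x - f (r i) x)\<^sup>2))"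
          using ae'
        proof eventually_elim
          case (elim x)
          then have "(\<lambda>i. ennreal ((f n x - f (r i) x)\<^sup>2)) \<longlonglongrightarrow> ennreal ((f n x - g x)\<^sup>2)"
            by (intro tendsto_ennrealI tendsto_intros)
          then show ?case
            by (rule lim_imp_Liminf[OF trivial_limit_sequentially, symmetric])
        qed
      qed
      also have "\<dots> \<le> liminf (\<lambda>i. \<integral>\<^sup>+x. ennreal ((f n x - f (r i) x)\<^sup>2) \<partial>?M)"
        by (rule nn_integral_liminf) simp
      also have "\<dots> \<le> limsup (\<lambda>i. \<integral>\<^sup>+x. ennreal ((f n x - f (r i) x)\<^sup>2) \<partial>?M)"
        by (rule Liminf_le_Limsup) simp
      also have "\<dots> \<le> ennreal (e\<^sup>2)"
      proof (rule Limsup_bounded)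
        show "\<forall>\<^sub>F i in sequentially. (\<integral>\<^sup>+x. ennreal ((f n x - f (r i) x)\<^sup>2) \<partial>?M) \<le> ennreal (e\<^sup>2)"
          using eventually_ge_at_top[of N]
        proof eventually_elim
          case (elim i)
          then have "L2_norm \<Omega> (\<lambda>x. f n x - f (r i) x) \<le> e"
            using N[OF \<open>n \<ge> N\<close>, of "r i"] seq_suble[OF r, of i] by linarith
          then have "(L2_norm \<Omega> (\<lambda>x. f n x - f (r i) x))\<^sup>2 \<le> e\<^sup>2"
            by (rule power_mono) simp
          then show ?case
            unfolding nn by (rule ennreal_leI)
        qed
      qed
      finally have le: "(\<integral>\<^sup>+x. ennreal ((f n x - g x)\<^sup>2) \<partial>?M) \<le> ennreal (e\<^sup>2)" .
      have int: "integrable ?M (\<lambda>x. (f n x - g x)\<^sup>2)"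
        using le_less_trans[OF le ennreal_less_top] by (intro integrableI_nonneg) auto
      then have L2: "(\<lambda>x. f n x - g x) \<in> L2_space \<Omega>"
        by (simp add: L2_space_def)
      have "ennreal ((L2_norm \<Omega> (\<lambda>x. f n x - g x))\<^sup>2) \<le> ennreal (e\<^sup>2)"
        using le nn_integral_eq_integral[OF int]
        unfolding L2_norm_sq L2_inner_def by (simp flip: power2_eq_square)
      then have "L2_norm \<Omega> (\<lambda>x. f n x - g x) \<le> e"
        using \<open>e > 0\<close> power2_le_imp_le[of "L2_norm \<Omega> (\<lambda>x. f n x - g x)" e] by (simp add: ennreal_le_iff)
      then show ?thesis using L2 by simp
    qed
    then show ?thesis by blast
  qed
  obtain N where "(\<lambda>x. f N x - g x) \<in> L2_space \<Omega>"
    using key[of 1] by auto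
  then have "g \<in> L2_space \<Omega>"
    using L2_diff[OF f[of N], of "\<lambda>x. f N x - g x"] by simp
  moreover have "(\<lambda>n. L2_norm \<Omega> (\<lambda>x. f n x - g x)) \<longlonglongrightarrow> 0"
  proof (rule LIMSEQ_I)
    fix e :: real assume "e > 0"
    obtain N where "\<forall>n\<ge>N. L2_norm \<Omega> (\<lambda>x. f n x - g x) \<le> e / 2"
      using key[of "e / 2"] \<open>e > 0\<close> by auto
    then show "\<exists>no. \<forall>n\<ge>no. norm (L2_norm \<Omega> (\<lambda>x. f n x - g x) - 0) < e"
      using \<open>e > 0\<close> by (intro exI[of _ N]) force
  qed
  ultimately show ?thesis by (rule that)
qed

end

section \<open>Smooth functions with compact support\<close>

lemma partial_deriv_eq: "(f has_derivative f') (at x) \<Longrightarrow> partial_deriv j f x = f' j"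
  unfolding partial_deriv_def by (metis frechet_derivative_at)

lemma partial_deriv_has_derivative:
  "f differentiable (at x) \<Longrightarrow> (f has_derivative (\<lambda>j. partial_deriv j f x)) (at x)"
  unfolding partial_deriv_def by (simp add: frechet_derivative_works[symmetric])

lemma partial_deriv_add:
  assumes "f differentiable (at x)" "g differentiable (at x)"
  shows "partial_deriv j (\<lambda>x. f x + g x) x = partial_deriv j f x + partial_deriv j g x"
  by (rule partial_deriv_eq) (intro derivative_intros partial_deriv_has_derivative assms)

lemma partial_deriv_mult:
  fixes f g :: "'a::euclidean_space \<Rightarrow> real"
  assumes "f differentiable (at x)" "g differentiable (at x)"
  shows "partial_deriv j (\<lambda>x. f x * g x) x = f x * partial_deriv j g x + partial_deriv j f x * g x"
  by (rule partial_deriv_eq[OF has_derivative_mult]) (intro partial_deriv_has_derivative assms)+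

lemma partial_deriv_const [simp]: "partial_deriv j (\<lambda>x. c) = (\<lambda>x. 0)"
  by (rule ext, rule partial_deriv_eq) (rule has_derivative_const)

text \<open>\<open>Ck_on\<close> asks for continuity only of the derivatives of top order; those of
  lower order are continuous because they are differentiable.\<close>

lemma Ck_on_Suc_D: "Ck_on (Suc k) UNIV f \<Longrightarrow> Ck_on k UNIV f"
proof (induction k arbitrary: f)
  case 0
  then show ?case
    by (auto simp: differentiable_imp_continuous_within intro!: continuous_at_imp_continuous_on)
next
  case (Suc k)
  then show ?case
    by (metis Ck_on.simps(2))
qed

lemma Ck_on_const: "Ck_on k UNIV (\<lambda>x::'a::euclidean_space. c)"
proof (induction k arbitrary: c)
  case (Suc k)
  show ?case using Suc[of 0] by simp
qed simp

lemma Ck_on_add: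
  "Ck_on k UNIV f \<Longrightarrow> Ck_on k UNIV g \<Longrightarrow> Ck_on k UNIV (\<lambda>x. f x + g x)"
proof (induction k arbitrary: f g)
  case 0
  then show ?case by (auto intro: continuous_on_add)
next
  case (Suc k)
  have "partial_deriv j (\<lambda>x. f x + g x) = (\<lambda>x. partial_deriv j f x + partial_deriv j g x)" for j
    using Suc.prems by (intro ext partial_deriv_add) auto
  then show ?case
    using Suc by (auto intro: differentiable_add)
qed

lemma Ck_on_mult:
  "Ck_on k UNIV f \<Longrightarrow> Ck_on k UNIV g \<Longrightarrow> Ck_on k UNIV (\<lambda>x. f x * g x)"
proof (induction k arbitrary: f g)
  case 0
  then show ?case by (auto intro: continuous_on_mult)
next
  case (Suc k)
  have "partial_deriv j (\<lambda>x. f x * g x) = (\<lambda>x. f x * partial_deriv j g x + partial_deriv j f x * g x)" for j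
    using Suc.prems by (intro ext partial_deriv_mult) auto
  moreover have "Ck_on k UNIV f" "Ck_on k UNIV g"
    using Suc.prems by (auto intro: Ck_on_Suc_D)
  ultimately show ?case
    using Suc.prems by (auto intro!: differentiable_mult Ck_on_add Suc.IH)
qed

lemma Ck_on_prod:
  assumes "\<And>i. i \<in> I \<Longrightarrow> Ck_on k UNIV (f i)"
  shows "Ck_on k UNIV (\<lambda>x. \<Prod>i\<in>I. f i x)"
  using assms by (induction I rule: infinite_finite_induct) (auto intro: Ck_on_mult Ck_on_const)

section \<open>The flat function exp(-1/t) and smooth bumps on boxes\<close>

definition flat_exp :: "nat \<Rightarrow> real \<Rightarrow> real" where
  "flat_exp n t = (if t > 0 then (1 / t) ^ n * exp (- (1 / t)) else 0)"

text \<open>With s = 1/t, the term of order n + 2 in the exponential series gives s^(n+2)/(n+2)!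
  \<le> exp s. The resulting quadratic decay makes the difference quotient at 0 vanish.\<close>

lemma flat_exp_bound: "\<bar>flat_exp n t\<bar> \<le> fact (n + 2) * t\<^sup>2"
proof (cases "t > 0")
  case True
  define s where "s = 1 / t"
  have s: "s > 0" using True by (simp add: s_def)
  have "s ^ (n + 2) / fact (n + 2) \<le> exp s"
  proof -
    have "(\<Sum>k\<in>{n+2}. s ^ k /\<^sub>R fact k) \<le> (\<Sum>k. s ^ k /\<^sub>R fact k)"
      using s by (intro sum_le_suminf summable_exp_generic) auto
    then show ?thesis by (simp add: exp_def field_simps)
  qed
  then have "s ^ n * s\<^sup>2 \<le> fact (n + 2) * exp s"
    by (simp add: pos_divide_le_eq power_add power2_eq_square ac_simps)
  then have "s ^ n * exp (- s) \<le> fact (n + 2) * (1 / s)\<^sup>2"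
    using s by (simp add: exp_minus field_simps)
  then show ?thesis
    using True by (simp add: flat_exp_def s_def)
qed (simp add: flat_exp_def)

text \<open>Differentiating t^(-n) * exp(-1/t) produces the members n + 2 and n + 1 of the same
  family. Closure under differentiation is the reason for the parameter \<open>n\<close>: it lets
  smoothness be proved by induction.\<close>

lemma flat_exp_deriv:
  "(flat_exp n has_real_derivative flat_exp (n + 2) t - real n * flat_exp (n + 1) t) (at t)"
proof -
  consider "t > 0" | "t < 0" | "t = 0" by linarith
  then show ?thesis
  proof cases
    case 1
    have "((\<lambda>t. (1 / t) ^ n * exp (- (1 / t))) has_real_derivative
       flat_exp (n + 2) t - real n * flat_exp (n + 1) t) (at t)"
      using 1 apply (auto intro!: derivative_eq_intros simp: flat_exp_def power2_eq_square)
      apply (cases n; simp add: field_simps)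
      done
    then show ?thesis
      by (rule has_field_derivative_transform_within_open[of _ _ _ "{0<..}"])
        (use 1 in \<open>auto simp: flat_exp_def\<close>)
  next
    case 2
    have "((\<lambda>t. 0) has_real_derivative flat_exp (n + 2) t - real n * flat_exp (n + 1) t) (at t)"
      using 2 by (simp add: flat_exp_def)
    then show ?thesis
      by (rule has_field_derivative_transform_within_open[of _ _ _ "{..<0}"])
        (use 2 in \<open>auto simp: flat_exp_def\<close>)
  next
    case 3
    have "((\<lambda>h. (flat_exp n (0 + h) - flat_exp n 0) / h) \<longlongrightarrow> 0) (at 0)"
    proof (rule Lim_null_comparison)
      show "\<forall>\<^sub>F h in at 0. norm ((flat_exp n (0 + h) - flat_exp n 0) / h) \<le> fact (n + 2) * \<bar>h\<bar>"
      proof (intro always_eventually allI)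
        fix h :: real
        show "norm ((flat_exp n (0 + h) - flat_exp n 0) / h) \<le> fact (n + 2) * \<bar>h\<bar>"
        proof (cases "h = 0")
          case False
          have "\<bar>flat_exp n h\<bar> \<le> fact (n + 2) * \<bar>h\<bar> * \<bar>h\<bar>"
            using flat_exp_bound[of n h] by (simp add: power2_eq_square mult.assoc)
          then have "\<bar>flat_exp n h\<bar> / \<bar>h\<bar> \<le> fact (n + 2) * \<bar>h\<bar>"
            using False by (subst pos_divide_le_eq) auto
          then show ?thesis
            by (simp add: flat_exp_def[of _ 0])
        qed simp
      qed
      have "((\<lambda>h::real. fact (n + 2) * \<bar>h\<bar>) \<longlongrightarrow> fact (n + 2) * \<bar>0\<bar>) (at 0)"
        by (intro tendsto_intros)
      then show "((\<lambda>h::real. fact (n + 2) * \<bar>h\<bar>) \<longlongrightarrow> 0) (at 0)"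
        by simp
    qed
    then show ?thesis
      using 3 by (simp add: DERIV_def flat_exp_def[of _ 0])
  qed
qed

text \<open>Affine arguments are preserved by partial differentiation, which only adds the constant
  factor j \<bullet> v and moves \<open>n\<close>; the induction hypothesis for all \<open>n\<close>
  then applies to both resulting terms.\<close>

lemma Ck_on_flat_exp: "Ck_on k UNIV (\<lambda>x::'a::euclidean_space. flat_exp n (x \<bullet> v + c))"
proof (induction k arbitrary: n)
  case 0
  have "continuous_on UNIV (flat_exp n)"
    using flat_exp_deriv by (blast intro: continuous_at_imp_continuous_on DERIV_isCont)
  then show ?case
    by (auto intro!: continuous_on_compose2[of UNIV "flat_exp n"] continuous_intros)
next
  case (Suc k)
  have D: "((\<lambda>x. flat_exp n (x \<bullet> v + c)) has_derivative
     (\<lambda>j. (j \<bullet> v) * (flat_exp (n + 2) (x \<bullet> v + c) - real n * flat_exp (n + 1) (x \<bullet> v + c)))) (at x)" for x :: 'a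
  proof -
    have "((\<lambda>x. x \<bullet> v + c) has_derivative (\<lambda>j. j \<bullet> v)) (at x)"
      by (auto intro!: derivative_eq_intros)
    from has_derivative_compose[OF this flat_exp_deriv[unfolded has_field_derivative_def]]
    show ?thesis by (simp add: mult.commute)
  qed
  have p: "partial_deriv j (\<lambda>x. flat_exp n (x \<bullet> v + c)) =
     (\<lambda>x. (j \<bullet> v) * (flat_exp (n + 2) (x \<bullet> v + c) + (- real n) * flat_exp (n + 1) (x \<bullet> v + c)))" for j
    using partial_deriv_eq[OF D] by (intro ext) simp
  show ?case
    unfolding Ck_on.simps p differentiable_def
    using D by (intro conjI ballI exI Ck_on_mult Ck_on_add Suc.IH Ck_on_const)
qed

text \<open>A product of one-sided flat functions, one for each face, vanishes off the open box. The
  parameter \<open>m\<close> steepens it: inside, every factor exp(-1/(m t)) tends to 1, so the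
  bumps approach the indicator of the box while staying between 0 and 1.\<close>

definition box_bump :: "'a::euclidean_space \<Rightarrow> 'a \<Rightarrow> real \<Rightarrow> 'a \<Rightarrow> real" where
  "box_bump a b m x = (\<Prod>j\<in>Basis. flat_exp 0 (m * (x \<bullet> j - a \<bullet> j)) * flat_exp 0 (m * (b \<bullet> j - x \<bullet> j)))"

lemma flat_exp_0_range: "0 \<le> flat_exp 0 t" "flat_exp 0 t \<le> 1"
  by (auto simp: flat_exp_def)

lemma box_bump_eq_0:
  assumes "m > 0" "x \<notin> box a b"
  shows "box_bump a b m x = 0"
proof -
  obtain j where "j \<in> Basis" "x \<bullet> j \<le> a \<bullet> j \<or> b \<bullet> j \<le> x \<bullet> j"
    using assms(2) by (auto simp: mem_box not_less)
  then have "flat_exp 0 (m * (x \<bullet> j - a \<bullet> j)) * flat_exp 0 (m * (b \<bullet> j - x \<bullet> j)) = 0"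
    using assms(1) by (auto simp: flat_exp_def zero_less_mult_iff)
  then show ?thesis
    using \<open>j \<in> Basis\<close> unfolding box_bump_def by (intro prod_zero) auto
qed

lemma box_bump_range: "0 \<le> box_bump a b m x" "box_bump a b m x \<le> 1"
  unfolding box_bump_def
  by (auto intro!: prod_nonneg prod_le_1 mult_le_one simp: flat_exp_0_range)

lemma box_bump_tendsto: "(\<lambda>n. box_bump a b (real (Suc n)) x) \<longlonglongrightarrow> indicator (box a b) x"
proof (cases "x \<in> box a b")
  case True
  have *: "(\<lambda>n. flat_exp 0 (real (Suc n) * t)) \<longlonglongrightarrow> 1" if "t > 0" for t
  proof -
    have "(\<lambda>n. exp (- (1 / t * inverse (real (Suc n))))) \<longlonglongrightarrow> exp (- (1 / t * 0))"
      by (intro tendsto_intros LIMSEQ_inverse_real_of_nat)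
    moreover have "flat_exp 0 (real (Suc n) * t) = exp (- (1 / t * inverse (real (Suc n))))" for n
      using that by (simp add: flat_exp_def field_simps zero_less_mult_iff del: of_nat_Suc)
    ultimately show ?thesis by simp
  qed
  have "(\<lambda>n. box_bump a b (real (Suc n)) x) \<longlonglongrightarrow> (\<Prod>j\<in>(Basis::'a set). 1 * 1)"
    unfolding box_bump_def using True by (intro tendsto_prod tendsto_mult *) (auto simp: mem_box)
  then show ?thesis using True by simp
qed (simp add: box_bump_eq_0 del: of_nat_Suc)

lemma box_bump_test:
  assumes "m > 0" "cbox a b \<subseteq> \<Omega>"
  shows "box_bump a b m \<in> test_functions \<Omega>"
proof -
  have "Ck_on k UNIV (box_bump a b m)" for k
  proof -
    have "box_bump a b m = (\<lambda>x. \<Prod>j\<in>Basis. flat_exp 0 (x \<bullet> (m *\<^sub>R j) + (- m * (a \<bullet> j))) *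
        flat_exp 0 (x \<bullet> (- m *\<^sub>R j) + m * (b \<bullet> j)))"
      by (simp add: box_bump_def fun_eq_iff algebra_simps)
    then show ?thesis
      by (simp only:) (intro Ck_on_prod Ck_on_mult Ck_on_flat_exp)
  qed
  moreover have sub: "closure {x. box_bump a b m x \<noteq> 0} \<subseteq> cbox a b"
    using box_bump_eq_0[OF assms(1), of _ a b] box_subset_cbox[of a b]
    by (intro closure_minimal) (auto simp: closed_cbox)
  moreover have "compact (closure {x. box_bump a b m x \<noteq> 0})"
    using sub compact_cbox by (metis closed_closure compact_Int_closed inf.absorb2)
  ultimately show ?thesis
    using assms(2) by (auto simp: test_functions_def)
qed


section \<open>Test functions: closure properties, bounds and integrals of derivatives\<close>

lemma test_functions_Ck: "\<psi> \<in> test_functions \<Omega> \<Longrightarrow> Ck_on k UNIV \<psi>"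
  by (simp add: test_functions_def)

lemma test_functions_differentiable: "\<psi> \<in> test_functions \<Omega> \<Longrightarrow> \<psi> differentiable (at x)"
  using test_functions_Ck[of \<psi> \<Omega> 1] by simp

lemma test_functions_continuous: "\<psi> \<in> test_functions \<Omega> \<Longrightarrow> continuous_on S \<psi>"
  using test_functions_Ck[of \<psi> \<Omega> 0] by (auto intro: continuous_on_subset)

lemma test_functions_mult:
  assumes "\<psi> \<in> test_functions \<Omega>" "\<xi> \<in> test_functions \<Omega>"
  shows "(\<lambda>x. \<psi> x * \<xi> x) \<in> test_functions \<Omega>"
proof -
  have sub: "closure {x. \<psi> x * \<xi> x \<noteq> 0} \<subseteq> closure {x. \<psi> x \<noteq> 0}"
    by (intro closure_mono) auto
  moreover have "compact (closure {x. \<psi> x * \<xi> x \<noteq> 0})"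
    using sub assms(1) by (metis (mono_tags, lifting) closed_closure compact_Int_closed inf.absorb2
        mem_Collect_eq test_functions_def)
  ultimately show ?thesis
    using assms by (auto simp: test_functions_def intro: Ck_on_mult)
qed

text \<open>Off the closed support the function vanishes on an open set, so its derivative vanishes
  there too and the closed support cannot grow.\<close>

lemma partial_deriv_test_function:
  assumes "\<psi> \<in> test_functions \<Omega>" "j \<in> Basis"
  shows "partial_deriv j \<psi> \<in> test_functions \<Omega>"
proof -
  have "partial_deriv j \<psi> x = 0" if "x \<notin> closure {x. \<psi> x \<noteq> 0}" for x
  proof (rule partial_deriv_eq)
    show "(\<psi> has_derivative (\<lambda>_. 0)) (at x)"
    proof (rule has_derivative_transform_within_open)
      show "((\<lambda>_. 0) has_derivative (\<lambda>_. 0)) (at x)"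
        by (rule has_derivative_const)
      show "x \<in> - closure {x. \<psi> x \<noteq> 0}" "open (- closure {x. \<psi> x \<noteq> 0})"
        using that by auto
      show "0 = \<psi> y" if "y \<in> - closure {x. \<psi> x \<noteq> 0}" for y
        using that closure_subset[of "{x. \<psi> x \<noteq> 0}"] by auto
    qed
  qed
  then have sub: "closure {x. partial_deriv j \<psi> x \<noteq> 0} \<subseteq> closure {x. \<psi> x \<noteq> 0}"
    by (intro closure_minimal) auto
  moreover have "compact (closure {x. partial_deriv j \<psi> x \<noteq> 0})"
    using sub assms(1) by (metis (mono_tags, lifting) closed_closure compact_Int_closed inf.absorb2
        mem_Collect_eq test_functions_def)
  moreover have "Ck_on k UNIV (partial_deriv j \<psi>)" for k
    using test_functions_Ck[OF assms(1), of "Suc k"] assms(2) by simp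
  ultimately show ?thesis
    using assms(1) by (auto simp: test_functions_def)
qed

lemma test_functions_bounded:
  assumes "\<psi> \<in> test_functions \<Omega>"
  obtains B where "B \<ge> 0" "\<And>x. \<bar>\<psi> x\<bar> \<le> B"
proof -
  have "compact (\<psi> ` closure {x. \<psi> x \<noteq> 0})"
    using assms by (intro compact_continuous_image test_functions_continuous) (auto simp: test_functions_def)
  then have "\<exists>B. \<forall>x\<in>closure {x. \<psi> x \<noteq> 0}. \<bar>\<psi> x\<bar> \<le> B"
    by (auto dest!: compact_imp_bounded simp: bounded_iff)
  then obtain B where B: "\<And>x. x \<in> closure {x. \<psi> x \<noteq> 0} \<Longrightarrow> \<bar>\<psi> x\<bar> \<le> B"
    by blast
  have "\<bar>\<psi> x\<bar> \<le> max B 0" for x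
    using B[of x] closure_subset[of "{x. \<psi> x \<noteq> 0}"] by (cases "\<psi> x = 0") (auto simp: subset_iff)
  then show ?thesis
    by (intro that[of "max B 0"]) auto
qed

lemma test_functions_outside: "\<psi> \<in> test_functions \<Omega> \<Longrightarrow> x \<notin> \<Omega> \<Longrightarrow> \<psi> x = 0"
  using closure_subset[of "{x. \<psi> x \<noteq> 0}"] by (auto simp: test_functions_def)

text \<open>Translation invariance makes the integrals of the difference quotients vanish.\<close>

lemma integral_partial_deriv_test_function:
  assumes \<psi>: "\<psi> \<in> test_functions \<Omega>" and j: "j \<in> Basis"
  shows "(LINT x|lborel. partial_deriv j \<psi> x) = 0"
proof -
  note [measurable] = borel_measurable_continuous_onI[OF test_functions_continuous[OF \<psi>]]
    borel_measurable_continuous_onI[OF test_functions_continuous[OF partial_deriv_test_function[OF \<psi> j]]]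
  obtain B where B: "B \<ge> 0" "\<And>x. \<bar>partial_deriv j \<psi> x\<bar> \<le> B"
    using test_functions_bounded[OF partial_deriv_test_function[OF \<psi> j]] by blast
  have "bounded {x. \<psi> x \<noteq> 0}"
    using \<psi> by (auto simp: test_functions_def intro: bounded_subset[OF compact_imp_bounded closure_subset])
  then obtain R where R: "\<And>x. \<psi> x \<noteq> 0 \<Longrightarrow> norm x \<le> R"
    by (auto simp: bounded_iff)
  define q where "q n x = real (Suc n) * (\<psi> (x + (1 / real (Suc n)) *\<^sub>R j) - \<psi> x)" for n x
  have line: "((\<lambda>t. \<psi> (x + t *\<^sub>R j)) has_real_derivative partial_deriv j \<psi> (x + t *\<^sub>R j)) (at t)" for x t
  proof -
    have "((\<lambda>t. x + t *\<^sub>R j) has_derivative (\<lambda>t. t *\<^sub>R j)) (at t)"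
      by (auto intro!: derivative_eq_intros)
    from has_derivative_compose[OF this partial_deriv_has_derivative[OF test_functions_differentiable[OF \<psi>]]]
    have D: "((\<lambda>t. \<psi> (x + t *\<^sub>R j)) has_derivative (\<lambda>s. partial_deriv (s *\<^sub>R j) \<psi> (x + t *\<^sub>R j))) (at t)" .
    have "partial_deriv (s *\<^sub>R j) \<psi> y = s * partial_deriv j \<psi> y" for s y
      using linear_frechet_derivative[OF test_functions_differentiable[OF \<psi>, of y]]
      by (simp add: partial_deriv_def linear_cmul)
    with D show ?thesis
      by (simp add: has_field_derivative_def mult.commute[of _ "partial_deriv j \<psi> _"])
  qed
  \<comment> \<open>Domination of the difference quotients: the mean value theorem bounds them by
    \<open>B\<close>, and beyond radius R + 1 both values of \<psi> vanish because the step 1/(n +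
    1) is at most 1.\<close>
  have qb: "\<bar>q n x\<bar> \<le> B * indicator (cball 0 (R + 1)) x" for n x
  proof (cases "x \<in> cball 0 (R + 1)")
    case True
    define h where "h = 1 / real (Suc n)"
    have h: "h > 0" by (simp add: h_def)
    obtain z where "\<psi> (x + h *\<^sub>R j) - \<psi> (x + 0 *\<^sub>R j) = (h - 0) * partial_deriv j \<psi> (x + z *\<^sub>R j)"
      using MVT2[OF h, of "\<lambda>t. \<psi> (x + t *\<^sub>R j)" "\<lambda>t. partial_deriv j \<psi> (x + t *\<^sub>R j)"] line by blast
    then have "q n x = partial_deriv j \<psi> (x + z *\<^sub>R j)"
      unfolding q_def h_def[symmetric] by (simp add: h_def field_simps del: of_nat_Suc)
    then show ?thesis using B True by simp
  next
    case False
    then have "norm x > R + 1" by simp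
    moreover have "norm x \<le> norm (x + (1 / real (Suc n)) *\<^sub>R j) + 1"
    proof -
      have "norm x = norm (x + (1 / real (Suc n)) *\<^sub>R j - (1 / real (Suc n)) *\<^sub>R j)" by simp
      also have "\<dots> \<le> norm (x + (1 / real (Suc n)) *\<^sub>R j) + norm ((1 / real (Suc n)) *\<^sub>R j)"
        by (rule norm_triangle_ineq4)
      also have "norm ((1 / real (Suc n)) *\<^sub>R j) \<le> 1"
        using j by simp
      finally show ?thesis by simp
    qed
    ultimately have "\<psi> (x + (1 / real (Suc n)) *\<^sub>R j) = 0" "\<psi> x = 0"
      using R[of "x + (1 / real (Suc n)) *\<^sub>R j"] R[of x] by linarith+
    then show ?thesis using B by (simp add: q_def)
  qed
  obtain B' where B': "B' \<ge> 0" "\<And>x. \<bar>\<psi> x\<bar> \<le> B'"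
    using test_functions_bounded[OF \<psi>] by blast
  have int: "integrable lborel \<psi>"
  proof (rule Bochner_Integration.integrable_bound)
    show "integrable lborel (\<lambda>x::'a. B' * indicator (cball 0 R) x)"
      by (intro integrable_mult_right integrable_real_indicator) (use emeasure_bounded_finite[of "cball (0::'a) R"] in auto)
    have "\<bar>\<psi> x\<bar> \<le> B' * indicator (cball 0 R) x" for x
      using B' R[of x] by (cases "\<psi> x = 0") auto
    then show "AE x in lborel. norm (\<psi> x) \<le> norm (B' * indicator (cball 0 R) x)"
      by (auto intro!: always_eventually order_trans[OF _ abs_ge_self])
  qed simp
  have q0: "(LINT x|lborel. q n x) = 0" for n
  proof -
    define v where "v = (1 / real (Suc n)) *\<^sub>R j"
    have "integrable (distr lborel borel ((+) v)) \<psi>"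
      using int by (simp add: lborel_distr_plus)
    then have i: "integrable lborel (\<lambda>x. \<psi> (v + x))"
      by (subst (asm) integrable_distr_eq) auto
    have "(LINT x|lborel. \<psi> x) = (LINT x|distr lborel borel ((+) v). \<psi> x)"
      by (simp add: lborel_distr_plus)
    also have "\<dots> = (LINT x|lborel. \<psi> (v + x))"
      by (subst integral_distr) auto
    finally show ?thesis
      unfolding q_def v_def[symmetric] using i int by (simp add: add.commute[of _ v])
  qed
  have "(\<lambda>n. LINT x|lborel. q n x) \<longlonglongrightarrow> (LINT x|lborel. partial_deriv j \<psi> x)"
  proof (rule integral_dominated_convergence)
    show "integrable lborel (\<lambda>x::'a. B * indicator (cball 0 (R + 1)) x)"
      by (intro integrable_mult_right integrable_real_indicator) (use emeasure_bounded_finite[of "cball (0::'a) (R + 1)"] in auto)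
    show "AE x in lborel. (\<lambda>n. q n x) \<longlonglongrightarrow> partial_deriv j \<psi> x"
    proof (intro always_eventually allI)
      fix x
      have "((\<lambda>h. (\<psi> (x + (0 + h) *\<^sub>R j) - \<psi> (x + 0 *\<^sub>R j)) / h) \<longlongrightarrow> partial_deriv j \<psi> (x + 0 *\<^sub>R j)) (at 0)"
        using line[of x 0] unfolding DERIV_def by simp
      moreover have "filterlim (\<lambda>n. 1 / real (Suc n)) (at 0) sequentially"
        using LIMSEQ_inverse_real_of_nat by (intro filterlim_atI) (auto simp: inverse_eq_divide)
      ultimately have "(\<lambda>n. (\<psi> (x + (0 + 1 / real (Suc n)) *\<^sub>R j) - \<psi> (x + 0 *\<^sub>R j)) / (1 / real (Suc n)))
          \<longlonglongrightarrow> partial_deriv j \<psi> (x + 0 *\<^sub>R j)"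
        by (rule filterlim_compose)
      then show "(\<lambda>n. q n x) \<longlonglongrightarrow> partial_deriv j \<psi> x"
        by (simp add: q_def mult.commute del: of_nat_Suc)
    qed
    show "AE x in lborel. norm (q n x) \<le> B * indicator (cball 0 (R + 1)) x" for n
      using qb by simp
  qed (unfold q_def, measurable)
  then show ?thesis
    unfolding q0 by (simp add: LIMSEQ_const_iff)
qed

section \<open>Weak derivatives\<close>

text \<open>A Dynkin class argument: open boxes are stable under intersection and generate the Borel
  sets. Lebesgue sets differ from Borel sets by null sets, and an integrable function with the same
  set integrals as 0 is 0 almost everywhere.\<close>

lemma integrable_zero_on_boxes:
  fixes h :: "'a::euclidean_space \<Rightarrow> real"
  assumes int: "integrable lebesgue h"
    and box: "\<And>c d. (LINT x|lebesgue. indicator (box c d) x * h x) = 0"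
  shows "AE x in lebesgue. h x = 0"
proof -
  have intA: "integrable lebesgue (\<lambda>x. indicator A x * h x)" if "A \<in> sets lebesgue" for A
    using integrable_mult_indicator[OF that int] by simp
  \<comment> \<open>The complement step of the induction needs the integral over the whole space,
    obtained by exhausting the space with cubes.\<close>
  have total: "(LINT x|lebesgue. h x) = 0"
  proof -
    have "(\<lambda>n. LINT x|lebesgue. indicator (box (- (real n *\<^sub>R One)) (real n *\<^sub>R One)) x * h x) \<longlonglongrightarrow> (LINT x|lebesgue. h x)"
    proof (rule integral_dominated_convergence[where w = "\<lambda>x. \<bar>h x\<bar>"])
      show "AE x in lebesgue. (\<lambda>n. indicator (box (- (real n *\<^sub>R One)) (real n *\<^sub>R One)) x * h x) \<longlonglongrightarrow> h x"
      proof (intro always_eventually allI)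
        fix x :: 'a
        obtain N where N: "norm x < real N"
          using reals_Archimedean2 by blast
        have "x \<in> box (- (real n *\<^sub>R One)) (real n *\<^sub>R One)" if "n \<ge> N" for n
        proof -
          have "\<bar>x \<bullet> j\<bar> < real n" if "j \<in> Basis" for j
            using Basis_le_norm[OF that, of x] N \<open>n \<ge> N\<close> by linarith
          then show ?thesis
            by (auto simp: mem_box abs_less_iff minus_less_iff)
        qed
        then have "\<forall>\<^sub>F n in sequentially. indicator (box (- (real n *\<^sub>R One)) (real n *\<^sub>R One)) x * h x = h x"
          by (intro eventually_sequentiallyI[of N]) auto
        then show "(\<lambda>n. indicator (box (- (real n *\<^sub>R One)) (real n *\<^sub>R One)) x * h x) \<longlonglongrightarrow> h x"
          by (rule tendsto_eventually)
      qed
    qed (use int intA in \<open>auto intro!: always_eventually borel_measurable_integrable simp: indicator_def\<close>)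
    then show ?thesis
      by (simp add: box LIMSEQ_const_iff)
  qed
  have borel: "(LINT x|lebesgue. indicator A x * h x) = 0" if "A \<in> sets borel" for A
  proof -
    have "Int_stable (range (\<lambda>(a, b). box a b :: 'a set))"
      by (auto simp: Int_stable_def Int_interval box_Int_box)
    moreover have "range (\<lambda>(a, b). box a b :: 'a set) \<subseteq> Pow UNIV"
      by simp
    moreover have "A \<in> sigma_sets UNIV (range (\<lambda>(a, b). box a b))"
      using that unfolding borel_eq_box by simp
    ultimately show ?thesis
    proof (induction rule: sigma_sets_induct_disjoint)
      case (basic A)
      then show ?case using box by auto
    next
      case empty
      then show ?case by simp
    next
      case (compl A)
      then have "A \<in> sets borel" by (simp add: borel_eq_box)
      then have A: "A \<in> sets lebesgue" by simp
      have "indicator (UNIV - A) x * h x = h x - indicator A x * h x" for x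
        by (auto simp: indicator_def)
      then show ?case
        using compl int intA[OF A] by (simp add: total)
    next
      case (union A)
      have [measurable]: "A i \<in> sets lebesgue" for i
        using union(2) by (auto simp: borel_eq_box image_subset_iff intro!: sets_completionI_sets)
      have "(LINT x:(\<Union>(range A))|lebesgue. h x) = (\<Sum>i. LINT x:(A i)|lebesgue. h x)"
        using union(1) int
        by (intro lebesgue_integral_countable_add)
          (auto simp: disjoint_family_on_def set_integrable_def intro: intA)
      then show ?case
        using union(3) by (simp add: set_lebesgue_integral_def)
    qed
  qed
  have "(LINT x:A|lebesgue. h x) = (LINT x:A|lebesgue. 0)" if A: "A \<in> sets lebesgue" for A
  proof -
    obtain C N where CN: "C \<in> sets borel" "negligible N" "C \<union> N = A"
      using sets_lebesgue_almost_borel[OF A] by metis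
    have "AE x in lebesgue. indicator A x * h x = indicator C x * h x"
      using CN(2) unfolding negligible_iff_null_sets
      by (rule AE_I') (use CN(3) in \<open>auto simp: indicator_def\<close>)
    then have "(LINT x|lebesgue. indicator A x * h x) = (LINT x|lebesgue. indicator C x * h x)"
      using intA[OF A] intA[of C] CN(1) by (intro integral_cong_AE) auto
    then show ?thesis
      using borel[OF CN(1)] by (simp add: set_lebesgue_integral_def)
  qed
  then show ?thesis
    using density_unique_real[OF int, of "\<lambda>x. 0"] by simp
qed


context bounded_open
begin

text \<open>Fundamental lemma of the calculus of variations. On a closed box inside \<Omega> the
  function is integrable; bumps converge boundedly to indicators of smaller boxes, so its integrals
  over all of these vanish. Countably many such boxes exhaust \<Omega>.\<close>

lemma locally_integrable_zero:
  assumes g: "locally_integrable_on g \<Omega>"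
    and zero: "\<And>\<psi>. \<psi> \<in> test_functions \<Omega> \<Longrightarrow> (LINT x|lebesgue_on \<Omega>. g x * \<psi> x) = 0"
  shows "L2_eq \<Omega> g (\<lambda>x. 0)"
proof -
  have box0: "AE x in lebesgue. x \<in> cbox a b \<longrightarrow> g x = 0" if ab: "cbox a b \<subseteq> \<Omega>" for a b
  proof -
    \<comment> \<open>\<open>g\<close> is only locally integrable. Cutting it off to a box with
      closure inside \<Omega> gives a globally integrable function, as
      \<open>integrable_zero_on_boxes\<close> requires.\<close>
    define h where "h x = (if x \<in> box a b then g x else 0)" for x
    have ig: "integrable (lebesgue_on (cbox a b)) g"
      using g ab by (simp add: locally_integrable_on_def)
    have "integrable lebesgue (\<lambda>x. indicator (cbox a b) x *\<^sub>R g x)"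
      using ig by (subst (asm) integrable_restrict_space) auto
    then have ic: "integrable lebesgue (\<lambda>x. \<bar>indicator (cbox a b) x * g x\<bar>)"
      by simp
    have mg: "(\<lambda>x. if x \<in> cbox a b then g x else 0) \<in> borel_measurable lebesgue"
      using ig by (intro borel_measurable_if_I) auto
    have sub: "integrable lebesgue (\<lambda>x. indicator (box c d) x * h x) \<and> (LINT x|lebesgue. indicator (box c d) x * h x) = 0" for c d
    proof -
      \<comment> \<open>Intersecting with \<open>box a b\<close> yields a box whose bumps have
        support in \<open>cbox a b\<close>, hence in \<Omega>, so that they are admissible test
        functions.\<close>
      obtain c' d' where c': "box c d \<inter> box a b = box c' d'"
        by (rule that[OF box_Int_box])
      show ?thesis
      proof (cases "box c' d' = {}")
        case True
        then have z: "(\<lambda>x. indicator (box c d) x * h x) = (\<lambda>x. 0)"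
          using c' by (auto simp: h_def indicator_def fun_eq_iff)
        show ?thesis
          unfolding z by simp
      next
        case False
        have eq: "indicator (box c d) x * h x = g x * indicator (box c' d') x" for x
          using c' by (auto simp: h_def indicator_def)
        have "box c' d' \<subseteq> box a b"
          using c' by blast
        then have sub: "cbox c' d' \<subseteq> cbox a b"
          using False closure_mono[of "box c' d'" "box a b"] closure_box[of c' d'] closure_box[of a b]
          by (cases "box a b = {}") auto
        define f where "f n x = g x * box_bump c' d' (real (Suc n)) x" for n x
        have test: "box_bump c' d' (real (Suc n)) \<in> test_functions \<Omega>" for n
          using sub ab by (intro box_bump_test) auto
        have fm: "f n \<in> borel_measurable lebesgue" for n
        proof -
          have "f n = (\<lambda>x. (if x \<in> cbox a b then g x else 0) * box_bump c' d' (real (Suc n)) x)"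
            using box_bump_eq_0[of "real (Suc n)" _ c' d'] sub box_subset_cbox[of c' d']
            by (auto simp: f_def fun_eq_iff)
          moreover have "box_bump c' d' (real (Suc n)) \<in> borel_measurable lebesgue"
            using borel_measurable_continuous_onI[OF test_functions_continuous[OF test[of n]]]
            by (auto intro: measurable_completion)
          ultimately show ?thesis
            using mg by auto
        qed
        have lim: "(\<lambda>n. f n x) \<longlonglongrightarrow> indicator (box c d) x * h x" for x
          unfolding f_def eq by (intro tendsto_intros box_bump_tendsto)
        have bound: "norm (f n x) \<le> \<bar>indicator (cbox a b) x * g x\<bar>" for n x
        proof (cases "x \<in> box c' d'")
          case True
          then have "x \<in> cbox a b" using sub box_subset_cbox[of c' d'] by auto
          then show ?thesis
            using box_bump_range[of c' d' "real (Suc n)" x]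
            by (auto simp: f_def abs_mult intro!: mult_left_le simp del: of_nat_Suc)
        next
          case False
          then show ?thesis
            by (simp add: f_def box_bump_eq_0 del: of_nat_Suc)
        qed
        have mlim: "(\<lambda>x. indicator (box c d) x * h x) \<in> borel_measurable lebesgue"
          using fm lim by (rule borel_measurable_LIMSEQ_metric)
        have f0: "(LINT x|lebesgue. f n x) = 0" for n
        proof -
          have "(LINT x|lebesgue_on \<Omega>. f n x) = 0"
            unfolding f_def by (rule zero[OF test])
          moreover have "(\<lambda>x. indicator \<Omega> x *\<^sub>R f n x) = f n"
            using test_functions_outside[OF test, of _ n] by (auto simp: f_def indicator_def fun_eq_iff)
          ultimately show ?thesis
            by (subst (asm) integral_restrict_space) simp_all
        qed
        have "(\<lambda>n. LINT x|lebesgue. f n x) \<longlonglongrightarrow> (LINT x|lebesgue. indicator (box c d) x * h x)"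
          using lim bound by (intro integral_dominated_convergence[where s = f, OF mlim fm ic]) auto
        then have "(LINT x|lebesgue. indicator (box c d) x * h x) = 0"
          by (simp add: f0 LIMSEQ_const_iff)
        moreover have "integrable lebesgue (\<lambda>x. indicator (box c d) x * h x)"
          using lim bound by (intro integrable_dominated_convergence[where s = f, OF mlim fm ic]) auto
        ultimately show ?thesis by blast
      qed
    qed
    have "h x = indicator (box a b) x * h x" for x
      by (simp add: h_def indicator_def)
    then have "integrable lebesgue h"
      using sub[of a b] by presburger
    then have "AE x in lebesgue. h x = 0"
      using sub by (intro integrable_zero_on_boxes) auto
    moreover have "AE x in lebesgue. x \<notin> cbox a b - box a b"
      using negligible_frontier_interval[of a b]
      unfolding negligible_iff_null_sets by (rule AE_not_in)
    ultimately show ?thesis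
      by eventually_elim (auto simp: h_def)
  qed
  define a' b' where "a' f = (\<Sum>i\<in>Basis. fst (f i) *\<^sub>R i)" and "b' f = (\<Sum>i\<in>Basis. snd (f i) *\<^sub>R i)"
    for f :: "'a \<Rightarrow> real \<times> real"
  \<comment> \<open>An open set is the union of the closed boxes with rational corners that it
    contains; countability of \<open>I\<close> allows the exceptional null sets to be
    joined.\<close>
  define I where "I = {f\<in>Basis \<rightarrow>\<^sub>E \<rat> \<times> \<rat>. cbox (a' f) (b' f) \<subseteq> \<Omega>}"
  have U: "\<Omega> = (\<Union>f\<in>I. cbox (a' f) (b' f))"
    unfolding I_def a'_def b'_def by (rule open_UNION_cbox[OF open_domain])
  have "countable (Basis \<rightarrow>\<^sub>E (\<rat> \<times> \<rat> :: (real \<times> real) set) :: ('a \<Rightarrow> real \<times> real) set)"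
    by (intro countable_PiE) (auto intro: countable_rat)
  then have "countable I"
    unfolding I_def by (rule countable_subset[rotated]) auto
  then have "AE x in lebesgue. \<forall>f\<in>I. x \<in> cbox (a' f) (b' f) \<longrightarrow> g x = 0"
    using box0 by (subst AE_ball_countable) (auto simp: I_def)
  then have "AE x in lebesgue. x \<in> \<Omega> \<longrightarrow> g x = 0"
    by eventually_elim (use U in blast)
  then show ?thesis
    unfolding L2_eq_def by (subst AE_restrict_space_iff) auto
qed

lemma test_function_L2:
  assumes "\<psi> \<in> test_functions \<Omega>"
  shows "\<psi> \<in> L2_space \<Omega>"
proof -
  have m: "\<psi> \<in> borel_measurable (lebesgue_on \<Omega>)"
    by (intro continuous_imp_measurable_on_sets_lebesgue test_functions_continuous[OF assms]) simp
  obtain B where B: "B \<ge> 0" "\<And>x. \<bar>\<psi> x\<bar> \<le> B"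
    using test_functions_bounded[OF assms] by blast
  have "(\<psi> x)\<^sup>2 \<le> B\<^sup>2" for x
    using B by (metis abs_le_square_iff abs_of_nonneg)
  then have "integrable (lebesgue_on \<Omega>) (\<lambda>x. (\<psi> x)\<^sup>2)"
    using m by (intro integrable_const_bound[where B = "B\<^sup>2"]) auto
  then show ?thesis
    using m by (simp add: L2_space_def)
qed

lemma L2_locally_integrable: "w \<in> L2_space \<Omega> \<Longrightarrow> locally_integrable_on w \<Omega>"
  unfolding locally_integrable_on_def
proof (intro allI impI)
  fix K assume "w \<in> L2_space \<Omega>" and K: "compact K \<and> K \<subseteq> \<Omega>"
  then have "integrable (lebesgue_on \<Omega>) w"
    by (intro L2_imp_integrable)
  moreover have KL: "K \<in> sets lebesgue"
    using K by (simp add: compact_imp_closed)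
  ultimately show "integrable (lebesgue_on K) w"
    using K set_integrable_subset[of lebesgue \<Omega> w K]
    by (simp add: set_integrable_def integrable_restrict_space)
qed

text \<open>Local integrability suffices because the product lives on the compact support of \<psi>,
  where \<psi> is bounded.\<close>

lemma integrable_mult_test:
  assumes g: "locally_integrable_on g \<Omega>" and \<psi>: "\<psi> \<in> test_functions \<Omega>"
  shows "integrable (lebesgue_on \<Omega>) (\<lambda>x. g x * \<psi> x)"
proof -
  define K where "K = closure {x. \<psi> x \<noteq> 0}"
  have K: "compact K" "K \<subseteq> \<Omega>" and KL: "K \<in> sets lebesgue"
    using \<psi> by (auto simp: test_functions_def K_def)
  obtain B where B: "B \<ge> 0" "\<And>x. \<bar>\<psi> x\<bar> \<le> B"
    using test_functions_bounded[OF \<psi>] by blast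
  have "integrable (lebesgue_on K) g"
    using g K by (simp add: locally_integrable_on_def)
  then have i: "integrable lebesgue (\<lambda>x. indicator K x * g x)"
    using KL by (simp add: integrable_restrict_space)
  have "integrable lebesgue (\<lambda>x. indicator K x * g x * \<psi> x)"
  proof (rule Bochner_Integration.integrable_bound)
    show "integrable lebesgue (\<lambda>x. B * (indicator K x * g x))"
      using i by simp
    have "\<psi> \<in> borel_measurable lebesgue"
      using borel_measurable_continuous_onI[OF test_functions_continuous[OF \<psi>]]
      by (auto intro: measurable_completion)
    then show "(\<lambda>x. indicator K x * g x * \<psi> x) \<in> borel_measurable lebesgue"
      using borel_measurable_integrable[OF i] by (rule borel_measurable_times[rotated])
    show "AE x in lebesgue. norm (indicator K x * g x * \<psi> x) \<le> norm (B * (indicator K x * g x))"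
    proof (intro always_eventually allI)
      fix x
      have "\<bar>indicator K x * g x\<bar> * \<bar>\<psi> x\<bar> \<le> \<bar>indicator K x * g x\<bar> * B"
        by (intro mult_left_mono B) simp
      then show "norm (indicator K x * g x * \<psi> x) \<le> norm (B * (indicator K x * g x))"
        using B(1) by (simp add: abs_mult mult.commute)
    qed
  qed
  moreover have "indicator K x * g x * \<psi> x = indicator \<Omega> x * (g x * \<psi> x)" for x
    using K(2) closure_subset[of "{x. \<psi> x \<noteq> 0}"]
    by (cases "\<psi> x = 0") (auto simp: K_def indicator_def)
  ultimately show ?thesis
    by (simp add: integrable_restrict_space)
qed

text \<open>This makes the choice in \<open>weak_deriv\<close> harmless: every candidate agrees with
  the chosen one almost everywhere.\<close>

lemma weak_deriv_unique:
  assumes "is_weak_deriv \<Omega> j w g" "is_weak_deriv \<Omega> j w h"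
  shows "L2_eq \<Omega> g h"
proof -
  have l: "locally_integrable_on g \<Omega>" "locally_integrable_on h \<Omega>"
    using assms by (auto simp: is_weak_deriv_def)
  have "L2_eq \<Omega> (\<lambda>x. g x - h x) (\<lambda>x. 0)"
  proof (rule locally_integrable_zero)
    show "locally_integrable_on (\<lambda>x. g x - h x) \<Omega>"
      using l by (simp add: locally_integrable_on_def)
    fix \<psi> assume \<psi>: "\<psi> \<in> test_functions \<Omega>"
    show "(LINT x|lebesgue_on \<Omega>. (g x - h x) * \<psi> x) = 0"
      using assms \<psi> integrable_mult_test[OF l(1) \<psi>] integrable_mult_test[OF l(2) \<psi>]
      by (simp add: is_weak_deriv_def left_diff_distrib)
  qed
  then show ?thesis
    by (simp add: L2_eq_def)
qed

lemma is_weak_deriv_weak_deriv: "is_weak_deriv \<Omega> j w g \<Longrightarrow> is_weak_deriv \<Omega> j w (weak_deriv \<Omega> j w)"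
  unfolding weak_deriv_def by (rule someI[where P = "is_weak_deriv \<Omega> j w"])

lemma weak_deriv_eqI: "is_weak_deriv \<Omega> j w g \<Longrightarrow> L2_eq \<Omega> (weak_deriv \<Omega> j w) g"
  by (rule weak_deriv_unique[OF is_weak_deriv_weak_deriv])

lemma weak_deriv_L2:
  "is_weak_deriv \<Omega> j w g \<Longrightarrow> g \<in> L2_space \<Omega> \<Longrightarrow> weak_deriv \<Omega> j w \<in> L2_space \<Omega>"
  by (rule L2_space_cong[OF _ L2_eq_sym[OF weak_deriv_eqI]])

lemma is_weak_deriv_L2I:
  assumes "w \<in> L2_space \<Omega>" "g \<in> L2_space \<Omega>"
    and "\<And>\<psi>. \<psi> \<in> test_functions \<Omega> \<Longrightarrow> L2_inner \<Omega> w (partial_deriv j \<psi>) = - L2_inner \<Omega> g \<psi>"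
  shows "is_weak_deriv \<Omega> j w g"
  using assms by (auto simp: is_weak_deriv_def L2_inner_def L2_locally_integrable)

lemma is_weak_deriv_inner:
  "is_weak_deriv \<Omega> j w g \<Longrightarrow> \<psi> \<in> test_functions \<Omega> \<Longrightarrow> L2_inner \<Omega> w (partial_deriv j \<psi>) = - L2_inner \<Omega> g \<psi>"
  by (auto simp: is_weak_deriv_def L2_inner_def)

text \<open>Integration by parts without boundary terms: the product of two test functions is a test
  function, so the integral of its partial derivative is 0.\<close>

lemma is_weak_deriv_test_function:
  assumes \<psi>: "\<psi> \<in> test_functions \<Omega>" and j: "j \<in> Basis"
  shows "is_weak_deriv \<Omega> j \<psi> (partial_deriv j \<psi>)"
proof (rule is_weak_deriv_L2I)
  show "\<psi> \<in> L2_space \<Omega>" "partial_deriv j \<psi> \<in> L2_space \<Omega>"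
    by (intro test_function_L2 partial_deriv_test_function \<psi> j)+
  fix \<xi> assume \<xi>: "\<xi> \<in> test_functions \<Omega>"
  have m: "(\<lambda>x. \<psi> x * \<xi> x) \<in> test_functions \<Omega>"
    by (rule test_functions_mult[OF \<psi> \<xi>])
  have eq: "partial_deriv j (\<lambda>x. \<psi> x * \<xi> x) = (\<lambda>x. \<psi> x * partial_deriv j \<xi> x + partial_deriv j \<psi> x * \<xi> x)"
    by (intro ext partial_deriv_mult test_functions_differentiable[OF \<psi>] test_functions_differentiable[OF \<xi>])
  \<comment> \<open>The derivative of the product vanishes outside \<Omega>, so the integral may be
    taken over the whole space.\<close>
  have "(LINT x|lebesgue_on \<Omega>. partial_deriv j (\<lambda>x. \<psi> x * \<xi> x) x) = (LINT x|lebesgue. partial_deriv j (\<lambda>x. \<psi> x * \<xi> x) x)"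
  proof -
    have "(\<lambda>x. indicator \<Omega> x *\<^sub>R partial_deriv j (\<lambda>x. \<psi> x * \<xi> x) x) = partial_deriv j (\<lambda>x. \<psi> x * \<xi> x)"
      using test_functions_outside[OF partial_deriv_test_function[OF m j]] by (auto simp: indicator_def fun_eq_iff)
    then show ?thesis
      by (subst integral_restrict_space) simp_all
  qed
  also have "\<dots> = (LINT x|lborel. partial_deriv j (\<lambda>x. \<psi> x * \<xi> x) x)"
    using borel_measurable_continuous_onI[OF test_functions_continuous[OF partial_deriv_test_function[OF m j]]]
    by (intro integral_completion) simp
  also have "\<dots> = 0"
    by (rule integral_partial_deriv_test_function[OF m j])
  finally have "(LINT x|lebesgue_on \<Omega>. \<psi> x * partial_deriv j \<xi> x + partial_deriv j \<psi> x * \<xi> x) = 0"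
    unfolding eq .
  moreover have "integrable (lebesgue_on \<Omega>) (\<lambda>x. \<psi> x * partial_deriv j \<xi> x)"
    "integrable (lebesgue_on \<Omega>) (\<lambda>x. partial_deriv j \<psi> x * \<xi> x)"
    by (intro L2_integrable_mult test_function_L2 partial_deriv_test_function \<psi> \<xi> j)+
  ultimately show "L2_inner \<Omega> \<psi> (partial_deriv j \<xi>) = - L2_inner \<Omega> (partial_deriv j \<psi>) \<xi>"
    by (simp add: L2_inner_def)
qed

end

section \<open>Linearity of weak derivatives and convergent series in
  \<open>L2_space\<close>\<close>

context bounded_open
begin

lemma is_weak_deriv_cong:
  assumes "w \<in> L2_space \<Omega>" "g \<in> L2_space \<Omega>" "L2_eq \<Omega> w w'" "is_weak_deriv \<Omega> j w g" "j \<in> Basis"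
  shows "is_weak_deriv \<Omega> j w' g"
proof (rule is_weak_deriv_L2I)
  show "w' \<in> L2_space \<Omega>"
    using assms(1,3) by (rule L2_space_cong)
  show "g \<in> L2_space \<Omega>" by fact
  fix \<psi> assume \<psi>: "\<psi> \<in> test_functions \<Omega>"
  have "L2_inner \<Omega> w' (partial_deriv j \<psi>) = L2_inner \<Omega> w (partial_deriv j \<psi>)"
    by (rule L2_inner_cong[symmetric])
      (use assms \<psi> in \<open>auto intro: test_function_L2 partial_deriv_test_function\<close>)
  then show "L2_inner \<Omega> w' (partial_deriv j \<psi>) = - L2_inner \<Omega> g \<psi>"
    using is_weak_deriv_inner[OF assms(4) \<psi>] by simp
qed

lemma is_weak_deriv_add_scale:
  assumes "u \<in> L2_space \<Omega>" "g \<in> L2_space \<Omega>" "is_weak_deriv \<Omega> j u g"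
    and "v \<in> L2_space \<Omega>" "h \<in> L2_space \<Omega>" "is_weak_deriv \<Omega> j v h" and j: "j \<in> Basis"
  shows "is_weak_deriv \<Omega> j (\<lambda>x. u x + c * v x) (\<lambda>x. g x + c * h x)"
proof (rule is_weak_deriv_L2I)
  show "(\<lambda>x. u x + c * v x) \<in> L2_space \<Omega>" "(\<lambda>x. g x + c * h x) \<in> L2_space \<Omega>"
    using assms by (auto intro: L2_add L2_scale)
  fix \<psi> assume \<psi>: "\<psi> \<in> test_functions \<Omega>"
  have "\<psi> \<in> L2_space \<Omega>" "partial_deriv j \<psi> \<in> L2_space \<Omega>"
    using \<psi> j by (auto intro: test_function_L2 partial_deriv_test_function)
  then show "L2_inner \<Omega> (\<lambda>x. u x + c * v x) (partial_deriv j \<psi>) = - L2_inner \<Omega> (\<lambda>x. g x + c * h x) \<psi>"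
    using assms is_weak_deriv_inner[OF assms(3) \<psi>] is_weak_deriv_inner[OF assms(6) \<psi>]
    by (simp add: L2_inner_add_left L2_inner_scale_left L2_scale)
qed

lemma L2_sums_inner:
  assumes "L2_sums \<Omega> f g" "w \<in> L2_space \<Omega>"
  shows "(\<lambda>k. L2_inner \<Omega> (f k) w) sums L2_inner \<Omega> g w"
proof -
  have f: "\<And>k. f k \<in> L2_space \<Omega>" and g: "g \<in> L2_space \<Omega>"
    and lim: "(\<lambda>n. L2_norm \<Omega> (\<lambda>x. (\<Sum>k<n. f k x) - g x)) \<longlonglongrightarrow> 0"
    using assms(1) by (auto simp: L2_sums_def)
  have "(\<lambda>n. L2_inner \<Omega> (\<lambda>x. \<Sum>k<n. f k x) w) \<longlonglongrightarrow> L2_inner \<Omega> g w"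
    by (rule L2_inner_tendsto[OF _ g assms(2) lim]) (intro L2_sum f)
  then show ?thesis
    by (simp add: sums_def L2_inner_sum_left f assms(2))
qed

text \<open>Whole blocks are bounded instead of single terms, which preserves the gain from
  orthogonality. The lemma serves both the eigenfunction expansions and their termwise
  derivatives.\<close>

lemma L2_series:
  assumes f: "\<And>k. f k \<in> L2_space \<Omega>"
    and a: "summable a"
    and le: "\<And>m n. (L2_norm \<Omega> (\<lambda>x. \<Sum>k=m..<n. f k x))\<^sup>2 \<le> (\<Sum>k=m..<n. a k)"
  obtains g where "L2_sums \<Omega> f g" "(L2_norm \<Omega> g)\<^sup>2 \<le> suminf a"
proof -
  define S where "S n = (\<lambda>x. \<Sum>k<n. f k x)" for n
  have S: "S n \<in> L2_space \<Omega>" for n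
    unfolding S_def by (intro L2_sum f)
  have d: "L2_norm \<Omega> (\<lambda>x. S n x - S m x) < e"
    if N: "\<And>m n. m \<ge> N \<Longrightarrow> norm (sum a {m..<n}) < e\<^sup>2" and "m \<ge> N" "m \<le> n" "e > 0" for N m n e
  proof -
    have "(\<lambda>x. S n x - S m x) = (\<lambda>x. \<Sum>k=m..<n. f k x)"
      using sum_diff_nat_ivl[of 0 m n "\<lambda>k. f k _"] \<open>m \<le> n\<close> by (simp add: S_def fun_eq_iff atLeast0LessThan)
    then have "(L2_norm \<Omega> (\<lambda>x. S n x - S m x))\<^sup>2 < e\<^sup>2"
      using le[of m n] N[OF \<open>m \<ge> N\<close>, of n] by simp
    then show ?thesis
      using \<open>e > 0\<close> by (simp add: power_less_imp_less_base[of _ 2])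
  qed
  obtain g where g: "g \<in> L2_space \<Omega>" and lim: "(\<lambda>n. L2_norm \<Omega> (\<lambda>x. S n x - g x)) \<longlonglongrightarrow> 0"
  proof (rule L2_complete[OF S])
    fix e :: real assume "e > 0"
    then have "e\<^sup>2 > 0" by simp
    then obtain N where N: "\<And>m n. m \<ge> N \<Longrightarrow> norm (sum a {m..<n}) < e\<^sup>2"
      using a unfolding summable_Cauchy by blast
    have "L2_norm \<Omega> (\<lambda>x. S i x - S j x) < e" if "i \<ge> N" "j \<ge> N" for i j
    proof (cases "j \<le> i")
      case True
      then show ?thesis using d[OF N] that \<open>e > 0\<close> by blast
    next
      case False
      then show ?thesis
        using d[OF N \<open>i \<ge> N\<close>, of j] \<open>e > 0\<close> L2_norm_minus_commute[of "S i" "S j"] by simp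
    qed
    then show "\<exists>N. \<forall>i\<ge>N. \<forall>j\<ge>N. L2_norm \<Omega> (\<lambda>x. S i x - S j x) < e"
      by blast
  qed
  have "(\<lambda>n. (L2_norm \<Omega> (S n))\<^sup>2) \<longlonglongrightarrow> (L2_norm \<Omega> g)\<^sup>2"
    by (intro tendsto_power L2_norm_tendsto S g lim)
  moreover have "(\<lambda>n. \<Sum>k<n. a k) \<longlonglongrightarrow> suminf a"
    using a by (rule summable_LIMSEQ)
  moreover have "(L2_norm \<Omega> (S n))\<^sup>2 \<le> (\<Sum>k<n. a k)" for n
    using le[of 0 n] by (simp add: S_def atLeast0LessThan)
  ultimately have "(L2_norm \<Omega> g)\<^sup>2 \<le> suminf a"
    by (intro LIMSEQ_le) auto
  moreover have "L2_sums \<Omega> f g"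
    using f g lim by (simp add: L2_sums_def S_def)
  ultimately show ?thesis
    using that by blast
qed

end

section \<open>Eigenfunction expansions\<close>

locale eigensystem = bounded_open \<Omega> for \<Omega> :: "'a::euclidean_space set" +
  fixes \<theta> :: "nat \<Rightarrow> real" and \<phi> :: "nat \<Rightarrow> 'a \<Rightarrow> real"
  assumes eigensystem: "dirichlet_eigensystem \<Omega> \<theta> \<phi>"
begin

lemma theta_ge: "\<theta> 0 \<le> \<theta> k" and theta0_pos: "0 < \<theta> 0"
  using eigensystem by (auto simp: dirichlet_eigensystem_def mono_def)

lemma theta_pos: "0 < \<theta> k"
  using theta_ge[of k] theta0_pos by simp

lemma phi_orthonormal: "L2_inner \<Omega> (\<phi> i) (\<phi> k) = (if i = k then 1 else 0)"
  using eigensystem by (auto simp: dirichlet_eigensystem_def)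

lemma phi_complete: "w \<in> L2_space \<Omega> \<Longrightarrow> (\<And>k. L2_inner \<Omega> w (\<phi> k) = 0) \<Longrightarrow> L2_eq \<Omega> w (\<lambda>x. 0)"
  using eigensystem by (auto simp: dirichlet_eigensystem_def)

lemma phi_H10: "\<phi> k \<in> H10_space \<Omega>"
  using eigensystem by (auto simp: dirichlet_eigensystem_def dirichlet_eigenfunction_def)

lemma phi_L2: "\<phi> k \<in> L2_space \<Omega>"
  using phi_H10[of k] by (auto simp: H10_space_def H1_space_def)

lemma phi_eigen:
  "\<psi> \<in> test_functions \<Omega> \<Longrightarrow>
    (\<Sum>j\<in>Basis. L2_inner \<Omega> (weak_deriv \<Omega> j (\<phi> k)) (partial_deriv j \<psi>)) = \<theta> k * L2_inner \<Omega> (\<phi> k) \<psi>"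
  using eigensystem by (auto simp: dirichlet_eigensystem_def dirichlet_eigenfunction_def)

lemma phi_weak_deriv:
  assumes "j \<in> Basis"
  shows "is_weak_deriv \<Omega> j (\<phi> k) (weak_deriv \<Omega> j (\<phi> k))" and "weak_deriv \<Omega> j (\<phi> k) \<in> L2_space \<Omega>"
proof -
  obtain g where "g \<in> L2_space \<Omega>" "is_weak_deriv \<Omega> j (\<phi> k) g"
    using phi_H10[of k] assms by (auto simp: H10_space_def H1_space_def)
  then show "is_weak_deriv \<Omega> j (\<phi> k) (weak_deriv \<Omega> j (\<phi> k))" "weak_deriv \<Omega> j (\<phi> k) \<in> L2_space \<Omega>"
    by (auto intro: is_weak_deriv_weak_deriv weak_deriv_L2)
qed

text \<open>The weak eigenvalue equation extends from test functions to \<open>H\<^sup>1\<^sub>0\<close> by density.\<close>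

lemma grad_phi_orthogonal:
  "(\<Sum>j\<in>Basis. L2_inner \<Omega> (weak_deriv \<Omega> j (\<phi> i)) (weak_deriv \<Omega> j (\<phi> k))) = (if i = k then \<theta> i else 0)"
proof -
  obtain \<psi> where \<psi>: "\<And>n. \<psi> n \<in> test_functions \<Omega>"
    and lim: "(\<lambda>n. H1_norm \<Omega> (\<lambda>x. \<phi> k x - \<psi> n x)) \<longlonglongrightarrow> 0"
    using phi_H10[of k] by (auto simp: H10_space_def)
  have \<psi>L: "\<psi> n \<in> L2_space \<Omega>" "j \<in> Basis \<Longrightarrow> partial_deriv j (\<psi> n) \<in> L2_space \<Omega>" for n j
    using \<psi> by (auto intro: test_function_L2 partial_deriv_test_function)
  \<comment> \<open>\<open>weak_deriv\<close> of the difference is a representative chosen on its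
    own; it agrees with the difference of the derivatives almost everywhere, which is enough for
    norms.\<close>
  have wd: "L2_norm \<Omega> (weak_deriv \<Omega> j (\<lambda>x. \<phi> k x - \<psi> n x)) = L2_norm \<Omega> (\<lambda>x. partial_deriv j (\<psi> n) x - weak_deriv \<Omega> j (\<phi> k) x)"
    if j: "j \<in> Basis" for j n
  proof -
    have "is_weak_deriv \<Omega> j (\<lambda>x. \<phi> k x + - 1 * \<psi> n x) (\<lambda>x. weak_deriv \<Omega> j (\<phi> k) x + - 1 * partial_deriv j (\<psi> n) x)"
      by (intro is_weak_deriv_add_scale phi_L2 phi_weak_deriv \<psi>L is_weak_deriv_test_function \<psi> j)
    then have d: "is_weak_deriv \<Omega> j (\<lambda>x. \<phi> k x - \<psi> n x) (\<lambda>x. weak_deriv \<Omega> j (\<phi> k) x - partial_deriv j (\<psi> n) x)"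
      by simp
    have "(\<lambda>x. weak_deriv \<Omega> j (\<phi> k) x - partial_deriv j (\<psi> n) x) \<in> L2_space \<Omega>"
      using j by (intro L2_diff phi_weak_deriv \<psi>L)
    then have "L2_norm \<Omega> (weak_deriv \<Omega> j (\<lambda>x. \<phi> k x - \<psi> n x)) = L2_norm \<Omega> (\<lambda>x. weak_deriv \<Omega> j (\<phi> k) x - partial_deriv j (\<psi> n) x)"
      using weak_deriv_eqI[OF d] weak_deriv_L2[OF d] by (intro L2_norm_cong)
    then show ?thesis
      by (simp add: L2_norm_minus_commute[of "partial_deriv j (\<psi> n)"])
  qed
  have H1sq: "(H1_norm \<Omega> w)\<^sup>2 = (L2_norm \<Omega> w)\<^sup>2 + (\<Sum>j\<in>Basis. (L2_norm \<Omega> (weak_deriv \<Omega> j w))\<^sup>2)" for w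
    unfolding H1_norm_def by (intro real_sqrt_pow2 add_nonneg_nonneg sum_nonneg) auto
  have H1nn: "0 \<le> H1_norm \<Omega> w" for w
    unfolding H1_norm_def by (intro real_sqrt_ge_zero add_nonneg_nonneg sum_nonneg) auto
  have le0: "L2_norm \<Omega> w \<le> H1_norm \<Omega> w" for w
    by (rule power2_le_imp_le[OF _ H1nn]) (simp add: H1sq sum_nonneg)
  have le1: "L2_norm \<Omega> (weak_deriv \<Omega> j w) \<le> H1_norm \<Omega> w" if "j \<in> Basis" for j w
    by (rule power2_le_imp_le[OF _ H1nn])
      (use member_le_sum[OF that, of "\<lambda>j. (L2_norm \<Omega> (weak_deriv \<Omega> j w))\<^sup>2"] in \<open>simp add: H1sq add_increasing\<close>)
  have lim0: "(\<lambda>n. L2_norm \<Omega> (\<lambda>x. \<psi> n x - \<phi> k x)) \<longlonglongrightarrow> 0"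
    by (rule Lim_null_comparison[OF _ lim])
      (use le0[of "\<lambda>x. \<phi> k x - \<psi> _ x"] in \<open>simp add: L2_norm_minus_commute[of "\<psi> _"]\<close>)
  have lim1: "(\<lambda>n. L2_norm \<Omega> (\<lambda>x. partial_deriv j (\<psi> n) x - weak_deriv \<Omega> j (\<phi> k) x)) \<longlonglongrightarrow> 0" if j: "j \<in> Basis" for j
    by (rule Lim_null_comparison[OF _ lim])
      (use le1[OF j, of "\<lambda>x. \<phi> k x - \<psi> _ x"] in \<open>simp add: wd[OF j]\<close>)
  \<comment> \<open>The equation for \<phi> i is tested with the approximations of \<phi> k.
    Convergence in the H^1 norm controls both sides, and orthonormality evaluates the limit.\<close>
  have "(\<lambda>n. \<Sum>j\<in>Basis. L2_inner \<Omega> (partial_deriv j (\<psi> n)) (weak_deriv \<Omega> j (\<phi> i)))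
      \<longlonglongrightarrow> (\<Sum>j\<in>Basis. L2_inner \<Omega> (weak_deriv \<Omega> j (\<phi> k)) (weak_deriv \<Omega> j (\<phi> i)))"
    by (intro tendsto_sum L2_inner_tendsto \<psi>L phi_weak_deriv lim1)
  moreover have "(\<lambda>n. \<theta> i * L2_inner \<Omega> (\<psi> n) (\<phi> i)) \<longlonglongrightarrow> \<theta> i * L2_inner \<Omega> (\<phi> k) (\<phi> i)"
    by (intro tendsto_mult_left L2_inner_tendsto \<psi>L phi_L2 lim0)
  moreover have "(\<Sum>j\<in>Basis. L2_inner \<Omega> (partial_deriv j (\<psi> n)) (weak_deriv \<Omega> j (\<phi> i))) = \<theta> i * L2_inner \<Omega> (\<psi> n) (\<phi> i)" for n
    using phi_eigen[OF \<psi>[of n], of i] by (simp add: L2_inner_commute)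
  ultimately have "(\<Sum>j\<in>Basis. L2_inner \<Omega> (weak_deriv \<Omega> j (\<phi> k)) (weak_deriv \<Omega> j (\<phi> i))) = \<theta> i * L2_inner \<Omega> (\<phi> k) (\<phi> i)"
    using LIMSEQ_unique by auto
  then show ?thesis
    by (simp add: L2_inner_commute phi_orthonormal)
qed

section \<open>Orthonormal expansions, Parseval's identity and Bessel's inequality\<close>

lemma norm_phi_sum:
  "finite I \<Longrightarrow> (L2_norm \<Omega> (\<lambda>x. \<Sum>k\<in>I. c k * \<phi> k x))\<^sup>2 = (\<Sum>k\<in>I. (c k)\<^sup>2)"
proof -
  assume I: "finite I"
  define s where "s = (\<lambda>x. \<Sum>k\<in>I. c k * \<phi> k x)"
  have s: "s \<in> L2_space \<Omega>"
    unfolding s_def by (intro L2_sum L2_scale phi_L2)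
  have L: "L2_inner \<Omega> s w = (\<Sum>k\<in>I. c k * L2_inner \<Omega> (\<phi> k) w)" if "w \<in> L2_space \<Omega>" for w
    unfolding s_def using that
    by (subst L2_inner_sum_left) (auto intro: L2_scale phi_L2 simp: L2_inner_scale_left)
  have "L2_inner \<Omega> (\<phi> i) s = (if i \<in> I then c i else 0)" for i
    unfolding L2_inner_commute[of "\<phi> i" s] L[OF phi_L2]
    using I by (simp add: phi_orthonormal if_distrib cong: if_cong)
  then show "(L2_norm \<Omega> (\<lambda>x. \<Sum>k\<in>I. c k * \<phi> k x))\<^sup>2 = (\<Sum>k\<in>I. (c k)\<^sup>2)"
    unfolding s_def[symmetric] L2_norm_sq L[OF s] by (simp add: power2_eq_square)
qed

text \<open>The representative is determined by the coefficient sequence: two expansions with the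
  same coefficients are the very same function, not merely equal almost everywhere. The
  identification of \<open>S_op\<close> and \<open>R_op\<close> relies on this.\<close>

definition embed :: "(nat \<Rightarrow> real) \<Rightarrow> 'a \<Rightarrow> real" where
  "embed c = L2_suminf \<Omega> (\<lambda>k x. c k * \<phi> k x)"

lemma embed_sums:
  assumes "summable (\<lambda>k. (c k)\<^sup>2)"
  shows "L2_sums \<Omega> (\<lambda>k x. c k * \<phi> k x) (embed c)"
proof -
  obtain g where "L2_sums \<Omega> (\<lambda>k x. c k * \<phi> k x) g"
    by (rule L2_series[of "\<lambda>k x. c k * \<phi> k x" "\<lambda>k. (c k)\<^sup>2"])
      (use assms in \<open>auto intro: L2_scale phi_L2 simp: norm_phi_sum\<close>)
  then show ?thesis
    unfolding embed_def L2_suminf_def by (rule someI[where P = "L2_sums \<Omega> _"])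
qed

lemma embed_L2: "summable (\<lambda>k. (c k)\<^sup>2) \<Longrightarrow> embed c \<in> L2_space \<Omega>"
  using embed_sums[of c] by (simp add: L2_sums_def)

lemma embed_inner:
  assumes "summable (\<lambda>k. (c k)\<^sup>2)"
  shows "L2_inner \<Omega> (embed c) (\<phi> i) = c i"
proof -
  have "(\<lambda>k. if k = i then c k else 0) sums L2_inner \<Omega> (embed c) (\<phi> i)"
    using L2_sums_inner[OF embed_sums[OF assms] phi_L2[of i]]
    by (simp add: L2_inner_scale_left phi_orthonormal if_distrib cong: if_cong)
  then show ?thesis
    using sums_single[of i c] sums_unique2 by blast
qed

lemma embed_norm:
  assumes "summable (\<lambda>k. (c k)\<^sup>2)"
  shows "L2_norm \<Omega> (embed c) = sqrt (\<Sum>k. (c k)\<^sup>2)"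
proof -
  have "(\<lambda>n. (L2_norm \<Omega> (\<lambda>x. \<Sum>k<n. c k * \<phi> k x))\<^sup>2) \<longlonglongrightarrow> (L2_norm \<Omega> (embed c))\<^sup>2"
    using embed_sums[OF assms] unfolding L2_sums_def
    by (intro tendsto_power L2_norm_tendsto) (auto intro: L2_sum L2_scale phi_L2)
  then have "(L2_norm \<Omega> (embed c))\<^sup>2 = (\<Sum>k. (c k)\<^sup>2)"
    by (simp add: norm_phi_sum sums_unique flip: sums_def)
  then show ?thesis
    by (intro real_sqrt_unique[symmetric]) auto
qed

lemma L2_eq_phiI:
  assumes "u \<in> L2_space \<Omega>" "v \<in> L2_space \<Omega>" "\<And>k. L2_inner \<Omega> u (\<phi> k) = L2_inner \<Omega> v (\<phi> k)"
  shows "L2_eq \<Omega> u v"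
  using phi_complete[of "\<lambda>x. u x - v x"] assms
  by (simp add: L2_diff L2_inner_diff_left phi_L2) (simp add: L2_eq_def)

text \<open>Pairing the truncated expansion s with u gives <s,u> = ||s||^2, so Cauchy-Schwarz yields
  ||s|| \<le> ||u||.\<close>

lemma Bessel:
  assumes u: "u \<in> L2_space \<Omega>"
  shows "(\<Sum>k<n. (L2_inner \<Omega> u (\<phi> k))\<^sup>2) \<le> (L2_norm \<Omega> u)\<^sup>2"
proof -
  define s where "s = (\<lambda>x. \<Sum>k<n. L2_inner \<Omega> u (\<phi> k) * \<phi> k x)"
  have s: "s \<in> L2_space \<Omega>"
    unfolding s_def by (intro L2_sum L2_scale phi_L2)
  have "L2_inner \<Omega> s u = (\<Sum>k<n. (L2_inner \<Omega> u (\<phi> k))\<^sup>2)"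
    unfolding s_def using u
    by (subst L2_inner_sum_left)
      (auto intro: L2_scale phi_L2 simp: L2_inner_scale_left L2_inner_commute[of "\<phi> _" u] power2_eq_square)
  moreover have sq: "(L2_norm \<Omega> s)\<^sup>2 = (\<Sum>k<n. (L2_inner \<Omega> u (\<phi> k))\<^sup>2)"
    unfolding s_def by (rule norm_phi_sum) simp
  ultimately have "(L2_norm \<Omega> s)\<^sup>2 \<le> L2_norm \<Omega> s * L2_norm \<Omega> u"
    using L2_Cauchy_Schwarz[OF s u] by simp
  then have "L2_norm \<Omega> s \<le> L2_norm \<Omega> u"
    using L2_norm_nonneg[of s] L2_norm_nonneg[of u]
    by (cases "L2_norm \<Omega> s = 0") (auto simp: power2_eq_square mult_le_cancel_left)
  then have "(L2_norm \<Omega> s)\<^sup>2 \<le> (L2_norm \<Omega> u)\<^sup>2"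
    by (rule power_mono) simp
  then show ?thesis
    by (simp add: sq)
qed

definition coefs :: "('a \<Rightarrow> real) \<Rightarrow> l2" where
  "coefs u = Abs_l2 (\<lambda>k. L2_inner \<Omega> u (\<phi> k))"

lemma coord_coefs: "u \<in> L2_space \<Omega> \<Longrightarrow> coord (coefs u) k = L2_inner \<Omega> u (\<phi> k)"
  unfolding coefs_def by (subst coord_Abs_l2) (auto intro: l2_boundI(1)[OF Bessel])

lemma norm_coefs_le: "u \<in> L2_space \<Omega> \<Longrightarrow> norm (coefs u) \<le> L2_norm \<Omega> u"
  unfolding coefs_def by (rule l2_boundI(2)[OF Bessel]) auto

lemma coefs_cong:
  assumes "u \<in> L2_space \<Omega>" "L2_eq \<Omega> u v"
  shows "coefs u = coefs v"
proof -
  have "L2_inner \<Omega> u (\<phi> k) = L2_inner \<Omega> v (\<phi> k)" for k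
    by (rule L2_inner_cong) (use assms phi_L2 in auto)
  then show ?thesis
    by (simp add: coefs_def)
qed

lemma coefs_add_scale:
  assumes "u \<in> L2_space \<Omega>" "v \<in> L2_space \<Omega>"
  shows "coefs (\<lambda>x. u x + c * v x) = coefs u + c *\<^sub>R coefs v"
  using assms
  by (intro l2_eqI) (simp add: coord_coefs L2_add L2_scale L2_inner_add_left L2_inner_scale_left phi_L2)

text \<open>Linearity holds only almost everywhere, because the three series limits are chosen
  independently; completeness of the eigenfunctions reduces it to comparing coefficients.\<close>

lemma embed_add_scale:
  "L2_eq \<Omega> (embed (coord (x + c *\<^sub>R y))) (\<lambda>t. embed (coord x) t + c * embed (coord y) t)"
proof (rule L2_eq_phiI)
  have e: "embed (coord z) \<in> L2_space \<Omega>" for z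
    by (intro embed_L2 summable_coord)
  then show "embed (coord (x + c *\<^sub>R y)) \<in> L2_space \<Omega>"
    "(\<lambda>t. embed (coord x) t + c * embed (coord y) t) \<in> L2_space \<Omega>"
    by (intro e L2_add L2_scale)+
  show "L2_inner \<Omega> (embed (coord (x + c *\<^sub>R y))) (\<phi> k) =
      L2_inner \<Omega> (\<lambda>t. embed (coord x) t + c * embed (coord y) t) (\<phi> k)" for k
    unfolding L2_inner_add_left[OF e L2_scale[OF e] phi_L2] L2_inner_scale_left embed_inner[OF summable_coord]
    by simp
qed

subsection \<open>The energy space\<close>

text \<open>The passage from energy coordinates to plain L^2 coefficients. It is bounded because the
  eigenvalues stay above \<theta> 0 > 0, and boundedness later lets it pass through the Bochner
  integral.\<close>

definition weight :: "l2 \<Rightarrow> l2" where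
  "weight x = Abs_l2 (\<lambda>k. coord x k / sqrt (\<theta> k))"

lemma coord_weight [simp]: "coord (weight x) k = coord x k / sqrt (\<theta> k)"
proof -
  have "summable (\<lambda>k. (coord x k / sqrt (\<theta> k))\<^sup>2)"
  proof (rule summable_comparison_test')
    show "summable (\<lambda>k. (coord x k)\<^sup>2 / \<theta> 0)"
      by (simp add: summable_divide)
    show "norm ((coord x k / sqrt (\<theta> k))\<^sup>2) \<le> (coord x k)\<^sup>2 / \<theta> 0" for k
      using theta_ge[of k] theta0_pos theta_pos[of k] by (simp add: power_divide divide_left_mono)
  qed
  then show ?thesis
    by (simp add: weight_def coord_Abs_l2)
qed

lemma bounded_linear_weight: "bounded_linear weight"
proof (rule bounded_linear_intro)
  show "weight (x + y) = weight x + weight y" "weight (r *\<^sub>R x) = r *\<^sub>R weight x" for x y r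
    by (auto intro!: l2_eqI simp: add_divide_distrib)
  show "norm (weight x) \<le> norm x * (1 / sqrt (\<theta> 0))" for x
  proof -
    have "(norm (weight x))\<^sup>2 \<le> (\<Sum>k. (coord x k)\<^sup>2 / \<theta> 0)"
      unfolding norm_l2_sq
    proof (rule suminf_le[OF _ summable_coord])
      show "(coord (weight x) k)\<^sup>2 \<le> (coord x k)\<^sup>2 / \<theta> 0" for k
        using theta_ge[of k] theta0_pos theta_pos[of k] by (simp add: power_divide divide_left_mono)
    qed (simp add: summable_divide)
    also have "\<dots> = (norm x * (1 / sqrt (\<theta> 0)))\<^sup>2"
      using theta0_pos by (simp add: suminf_divide norm_l2_sq power_divide)
    finally show ?thesis
      by (rule power2_le_imp_le) (use theta0_pos in simp)
  qed
qed

text \<open>\<open>energy\<close> identifies \<open>\<ell>\<^sup>2\<close> isometrically with \<open>D\<^sup>1(\<Omega>)\<close>.\<close>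

definition energy :: "l2 \<Rightarrow> 'a \<Rightarrow> real" where
  "energy x = embed (coord (weight x))"

lemma energy_L2: "energy x \<in> L2_space \<Omega>"
  unfolding energy_def by (rule embed_L2) (rule summable_coord)

lemma energy_inner: "L2_inner \<Omega> (energy x) (\<phi> k) = coord x k / sqrt (\<theta> k)"
  unfolding energy_def by (subst embed_inner) (rule summable_coord, simp)

lemma energy_add_scale: "L2_eq \<Omega> (energy (x + c *\<^sub>R y)) (\<lambda>t. energy x t + c * energy y t)"
proof -
  interpret weight: bounded_linear weight by (rule bounded_linear_weight)
  show ?thesis
    unfolding energy_def weight.add weight.scaleR by (rule embed_add_scale)
qed

text \<open>Termwise differentiation of the expansion. Gradients of different eigenfunctions are
  orthogonal, and the weights 1/sqrt \<theta> cancel the squared gradient norms \<theta>, so the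
  differentiated series converges. Its limit is a weak derivative because pairing with a test
  function commutes with both series.\<close>

lemma energy_weak_deriv:
  assumes j: "j \<in> Basis"
  shows "\<exists>g\<in>L2_space \<Omega>. is_weak_deriv \<Omega> j (energy x) g \<and> L2_norm \<Omega> g \<le> norm x"
proof -
  define y where "y = coord (weight x)"
  have le: "(L2_norm \<Omega> (\<lambda>t. \<Sum>k=m..<n. y k * weak_deriv \<Omega> j (\<phi> k) t))\<^sup>2 \<le> (\<Sum>k=m..<n. (coord x k)\<^sup>2)" for m n
  proof -
    define G where "G i = (\<lambda>t. \<Sum>k=m..<n. y k * weak_deriv \<Omega> i (\<phi> k) t)" for i
    have G: "i \<in> Basis \<Longrightarrow> G i \<in> L2_space \<Omega>" for i
      unfolding G_def by (intro L2_sum L2_scale phi_weak_deriv)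
    have inner: "L2_inner \<Omega> (G i) (G i) =
        (\<Sum>k=m..<n. \<Sum>l=m..<n. y k * y l * L2_inner \<Omega> (weak_deriv \<Omega> i (\<phi> k)) (weak_deriv \<Omega> i (\<phi> l)))" if i: "i \<in> Basis" for i
    proof -
      have "L2_inner \<Omega> (G i) w = (\<Sum>k=m..<n. y k * L2_inner \<Omega> (weak_deriv \<Omega> i (\<phi> k)) w)" if "w \<in> L2_space \<Omega>" for w
        unfolding G_def using that i
        by (subst L2_inner_sum_left) (auto intro: L2_scale phi_weak_deriv simp: L2_inner_scale_left)
      note * = this
      have "L2_inner \<Omega> (G i) (G i) = (\<Sum>k=m..<n. y k * L2_inner \<Omega> (G i) (weak_deriv \<Omega> i (\<phi> k)))"
        using G[OF i] by (subst *) (auto simp: L2_inner_commute[of "weak_deriv \<Omega> i (\<phi> _)" "G i"])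
      also have "\<dots> = (\<Sum>k=m..<n. y k * (\<Sum>l=m..<n. y l * L2_inner \<Omega> (weak_deriv \<Omega> i (\<phi> l)) (weak_deriv \<Omega> i (\<phi> k))))"
        using i by (intro sum.cong refl arg_cong2[where f = times] *) (auto intro: phi_weak_deriv)
      finally show ?thesis
        by (simp add: sum_distrib_left mult.assoc L2_inner_commute)
    qed
    \<comment> \<open>Orthogonality concerns full gradients, not a single direction; therefore the
      j-th component is first enlarged to the sum over all directions.\<close>
    have "(L2_norm \<Omega> (G j))\<^sup>2 \<le> (\<Sum>i\<in>Basis. (L2_norm \<Omega> (G i))\<^sup>2)"
      using j by (intro member_le_sum) auto
    also have "\<dots> = (\<Sum>i\<in>Basis. \<Sum>k=m..<n. \<Sum>l=m..<n. y k * y l * L2_inner \<Omega> (weak_deriv \<Omega> i (\<phi> k)) (weak_deriv \<Omega> i (\<phi> l)))"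
      unfolding L2_norm_sq by (intro sum.cong refl inner)
    also have "\<dots> = (\<Sum>k=m..<n. \<Sum>l=m..<n. y k * y l * (\<Sum>i\<in>Basis. L2_inner \<Omega> (weak_deriv \<Omega> i (\<phi> k)) (weak_deriv \<Omega> i (\<phi> l))))"
      by (subst sum.swap, rule sum.cong[OF refl], subst sum.swap) (simp add: sum_distrib_left)
    also have "\<dots> = (\<Sum>k=m..<n. y k * y k * \<theta> k)"
      by (simp add: grad_phi_orthogonal if_distrib sum.delta cong: if_cong)
    also have "\<dots> = (\<Sum>k=m..<n. (coord x k)\<^sup>2)"
    proof (intro sum.cong refl)
      show "y k * y k * \<theta> k = (coord x k)\<^sup>2" for k
        using theta_pos[of k] by (simp add: y_def power2_eq_square)
    qed
    finally show ?thesis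
      unfolding G_def .
  qed
  obtain g where g: "L2_sums \<Omega> (\<lambda>k t. y k * weak_deriv \<Omega> j (\<phi> k) t) g" "(L2_norm \<Omega> g)\<^sup>2 \<le> (\<Sum>k. (coord x k)\<^sup>2)"
    by (rule L2_series[OF _ summable_coord le]) (use j in \<open>auto intro: L2_scale phi_weak_deriv\<close>)
  have gL: "g \<in> L2_space \<Omega>"
    using g(1) by (simp add: L2_sums_def)
  have "is_weak_deriv \<Omega> j (energy x) g"
  proof (rule is_weak_deriv_L2I[OF energy_L2 gL])
    fix \<psi> assume \<psi>: "\<psi> \<in> test_functions \<Omega>"
    \<comment> \<open>The same numerical series is summed twice, once through the expansion of the
      function and once through that of \<open>g\<close>; uniqueness of the sum is the weak
      derivative identity.\<close>
    have "(\<lambda>k. y k * L2_inner \<Omega> (\<phi> k) (partial_deriv j \<psi>)) sums L2_inner \<Omega> (energy x) (partial_deriv j \<psi>)"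
      using L2_sums_inner[OF embed_sums[OF summable_coord], of "partial_deriv j \<psi>" "weight x"] \<psi> j
      by (simp add: energy_def y_def L2_inner_scale_left test_function_L2 partial_deriv_test_function del: coord_weight)
    moreover have "(\<lambda>k. y k * L2_inner \<Omega> (\<phi> k) (partial_deriv j \<psi>)) sums (- L2_inner \<Omega> g \<psi>)"
      using sums_minus[OF L2_sums_inner[OF g(1) test_function_L2[OF \<psi>]]] j
      by (simp add: is_weak_deriv_inner[OF phi_weak_deriv(1) \<psi>] L2_inner_scale_left)
    ultimately show "L2_inner \<Omega> (energy x) (partial_deriv j \<psi>) = - L2_inner \<Omega> g \<psi>"
      by (rule sums_unique2)
  qed
  moreover have "L2_norm \<Omega> g \<le> norm x"
    using g(2) norm_l2_sq[of x] power2_le_imp_le[of "L2_norm \<Omega> g" "norm x"] by simp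
  ultimately show ?thesis
    using gL by blast
qed

lemma energy_deriv:
  assumes "j \<in> Basis"
  shows "weak_deriv \<Omega> j (energy x) \<in> L2_space \<Omega>"
    and "is_weak_deriv \<Omega> j (energy x) (weak_deriv \<Omega> j (energy x))"
    and "L2_norm \<Omega> (weak_deriv \<Omega> j (energy x)) \<le> norm x"
proof -
  obtain g where g: "g \<in> L2_space \<Omega>" "is_weak_deriv \<Omega> j (energy x) g" "L2_norm \<Omega> g \<le> norm x"
    using energy_weak_deriv[OF assms] by blast
  show "weak_deriv \<Omega> j (energy x) \<in> L2_space \<Omega>" "is_weak_deriv \<Omega> j (energy x) (weak_deriv \<Omega> j (energy x))"
    using g by (auto intro: is_weak_deriv_weak_deriv weak_deriv_L2)
  show "L2_norm \<Omega> (weak_deriv \<Omega> j (energy x)) \<le> norm x"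
    using g L2_norm_cong[OF g(1) L2_eq_sym[OF weak_deriv_eqI[OF g(2)]]] by simp
qed

lemma weak_deriv_energy_add_scale:
  assumes j: "j \<in> Basis"
  shows "L2_eq \<Omega> (weak_deriv \<Omega> j (energy (x + c *\<^sub>R y)))
    (\<lambda>t. weak_deriv \<Omega> j (energy x) t + c * weak_deriv \<Omega> j (energy y) t)"
proof (rule weak_deriv_eqI)
  have "is_weak_deriv \<Omega> j (\<lambda>t. energy x t + c * energy y t)
      (\<lambda>t. weak_deriv \<Omega> j (energy x) t + c * weak_deriv \<Omega> j (energy y) t)"
    by (intro is_weak_deriv_add_scale energy_L2 energy_deriv j)
  then show "is_weak_deriv \<Omega> j (energy (x + c *\<^sub>R y))
      (\<lambda>t. weak_deriv \<Omega> j (energy x) t + c * weak_deriv \<Omega> j (energy y) t)"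
    using j by (intro is_weak_deriv_cong[OF _ _ L2_eq_sym[OF energy_add_scale]])
      (auto intro!: L2_add L2_scale energy_L2 energy_deriv)
qed

lemma directional_op_L2: "directional_op \<Omega> \<eta> (energy x) \<in> L2_space \<Omega>"
  unfolding directional_op_def by (intro L2_sum L2_scale energy_deriv)

lemma directional_op_add_scale:
  "L2_eq \<Omega> (directional_op \<Omega> \<eta> (energy (x + c *\<^sub>R y)))
    (\<lambda>t. directional_op \<Omega> \<eta> (energy x) t + c * directional_op \<Omega> \<eta> (energy y) t)"
proof -
  have "L2_eq \<Omega> (directional_op \<Omega> \<eta> (energy (x + c *\<^sub>R y)))
      (\<lambda>t. \<Sum>j\<in>Basis. (\<eta> \<bullet> j) * (weak_deriv \<Omega> j (energy x) t + c * weak_deriv \<Omega> j (energy y) t))"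
    unfolding directional_op_def by (intro L2_eq_sum L2_eq_scale weak_deriv_energy_add_scale)
  then show ?thesis
    by (simp add: directional_op_def distrib_left sum.distrib sum_distrib_left mult.left_commute)
qed

lemma directional_op_norm_le:
  "L2_norm \<Omega> (directional_op \<Omega> \<eta> (energy x)) \<le> norm x * (\<Sum>j\<in>Basis. \<bar>\<eta> \<bullet> j\<bar>)"
proof -
  have "L2_norm \<Omega> (\<lambda>t. \<Sum>j\<in>I. (\<eta> \<bullet> j) * weak_deriv \<Omega> j (energy x) t) \<le> (\<Sum>j\<in>I. \<bar>\<eta> \<bullet> j\<bar> * norm x)"
    if "finite I" "I \<subseteq> Basis" for I
    using that
  proof (induction I)
    case (insert j I)
    have "L2_norm \<Omega> (\<lambda>t. (\<eta> \<bullet> j) * weak_deriv \<Omega> j (energy x) t + (\<Sum>j\<in>I. (\<eta> \<bullet> j) * weak_deriv \<Omega> j (energy x) t))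
        \<le> L2_norm \<Omega> (\<lambda>t. (\<eta> \<bullet> j) * weak_deriv \<Omega> j (energy x) t) + L2_norm \<Omega> (\<lambda>t. \<Sum>j\<in>I. (\<eta> \<bullet> j) * weak_deriv \<Omega> j (energy x) t)"
      using insert.prems by (intro L2_norm_triangle L2_sum L2_scale energy_deriv) auto
    also have "L2_norm \<Omega> (\<lambda>t. (\<eta> \<bullet> j) * weak_deriv \<Omega> j (energy x) t) \<le> \<bar>\<eta> \<bullet> j\<bar> * norm x"
      unfolding L2_norm_scale using insert.prems by (intro mult_left_mono energy_deriv) auto
    finally show ?case
      using insert by simp
  qed simp
  from this[of Basis] show ?thesis
    by (simp add: directional_op_def sum_distrib_left mult.commute)
qed

text \<open>Energy coordinates go in and plain L^2 coefficients come out; the return to energy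
  coordinates is left to the resolvent multiplier.\<close>

definition drift :: "'a \<Rightarrow> l2 \<Rightarrow> l2" where
  "drift \<eta> x = coefs (directional_op \<Omega> \<eta> (energy x))"

text \<open>\<open>coefs\<close> does not see null sets, so linearity of
  \<open>directional_op\<close> up to null sets becomes exact linearity in
  \<open>l2\<close>.\<close>

lemma bounded_linear_drift: "bounded_linear (drift \<eta>)"
proof (rule bounded_linear_intro)
  have *: "drift \<eta> (x + c *\<^sub>R y) = drift \<eta> x + c *\<^sub>R drift \<eta> y" for x y c
    unfolding drift_def coefs_cong[OF directional_op_L2 directional_op_add_scale]
    by (intro coefs_add_scale directional_op_L2)
  show add: "drift \<eta> (x + y) = drift \<eta> x + drift \<eta> y" for x y
    using *[of x 1 y] by simp
  have "drift \<eta> 0 = 0"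
    using add[of 0 0] by simp
  then show "drift \<eta> (r *\<^sub>R x) = r *\<^sub>R drift \<eta> x" for r x
    using *[of 0 r x] by simp
  show "norm (drift \<eta> x) \<le> norm x * (\<Sum>j\<in>Basis. \<bar>\<eta> \<bullet> j\<bar>)" for x
    unfolding drift_def
    by (rule order_trans[OF norm_coefs_le[OF directional_op_L2] directional_op_norm_le])
qed

end

section \<open>Mittag-Leffler functions\<close>

text \<open>Euler's integral is cut down to [R, R + 1], an interval of length 1 on which both
  factors are bounded below. As R is free, Gamma outgrows every geometric sequence.\<close>

lemma Gamma_real_ge_powr:
  fixes R x :: real
  assumes "R > 0" "x \<ge> 1"
  shows "R powr (x - 1) * exp (- (R + 1)) \<le> Gamma x"
proof (rule has_integral_le)
  show "((\<lambda>t. if t \<in> {R..R + 1} then R powr (x - 1) * exp (- (R + 1)) else 0) has_integral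
      R powr (x - 1) * exp (- (R + 1))) {0..}"
  proof (subst has_integral_restrict)
    show "{R..R + 1} \<subseteq> {0..}" using assms by auto
    show "((\<lambda>t. R powr (x - 1) * exp (- (R + 1))) has_integral R powr (x - 1) * exp (- (R + 1))) {R..R + 1}"
      using has_integral_const_real[of "R powr (x - 1) * exp (- (R + 1))" R "R + 1"] by simp
  qed
  show "((\<lambda>t. t powr (x - 1) / exp t) has_integral Gamma x) {0..}"
    using assms by (intro Gamma_integral_real) auto
  fix t :: real assume "t \<in> {0..}"
  show "(if t \<in> {R..R + 1} then R powr (x - 1) * exp (- (R + 1)) else 0) \<le> t powr (x - 1) / exp t"
  proof (cases "t \<in> {R..R + 1}")
    case True
    then have "R powr (x - 1) * exp (- (R + 1)) \<le> t powr (x - 1) * exp (- t)"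
      using assms by (intro mult_mono powr_mono2) auto
    then show ?thesis
      using True by (simp add: exp_minus divide_inverse)
  qed auto
qed

lemma mittag_leffler_summable:
  assumes \<alpha>: "\<alpha> > 0" and \<zeta>: "\<zeta> > 0"
  shows "summable (\<lambda>k. 1 / Gamma (\<alpha> * real k + \<zeta>) * z ^ k)" (is "summable ?f")
proof -
  \<comment> \<open>Since R^\<alpha> = 2 * (|z| + 1), the lower bound for Gamma grows like (2 * (|z|
    + 1))^k, leaving the ratio |z| / (2 * (|z| + 1)) \<le> 1/2. The factors independent of k are
    collected in \<open>C\<close>.\<close>
  define R where "R = (2 * (\<bar>z\<bar> + 1)) powr (1 / \<alpha>)"
  have R: "R > 0" "R powr \<alpha> = 2 * (\<bar>z\<bar> + 1)"
    using \<alpha> by (auto simp: R_def powr_powr)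
  define C where "C = exp (R + 1) * R powr (1 - \<zeta>)"
  show ?thesis
  proof (rule summable_comparison_test_ev)
    show "summable (\<lambda>k. C * (1 / 2) ^ k)"
      by (intro summable_mult summable_geometric) simp
    \<comment> \<open>From this index on \<alpha> * k + \<zeta> \<ge> 1, as the lower bound for
      Gamma requires.\<close>
    obtain N where N: "1 / \<alpha> \<le> real N"
      using real_arch_simple by blast
    show "\<forall>\<^sub>F k in sequentially. norm (?f k) \<le> C * (1 / 2) ^ k"
    proof (rule eventually_sequentiallyI[of N])
      fix k assume "k \<ge> N"
      define x where "x = \<alpha> * real k + \<zeta>"
      have "1 / \<alpha> \<le> real k"
        using N \<open>k \<ge> N\<close> by linarith
      then have x: "x \<ge> 1"
        using \<alpha> \<zeta> by (simp add: x_def divide_le_eq mult.commute add_increasing2)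
      have G: "R powr (x - 1) * exp (- (R + 1)) \<le> Gamma x"
        by (rule Gamma_real_ge_powr[OF R(1) x])
      have pos: "R powr (x - 1) * exp (- (R + 1)) > 0"
        using R by simp
      have "norm (?f k) = \<bar>z\<bar> ^ k / Gamma x"
        using x by (simp add: x_def[symmetric] abs_mult power_abs)
      also have "\<dots> \<le> \<bar>z\<bar> ^ k / (R powr (x - 1) * exp (- (R + 1)))"
        using G pos by (intro divide_left_mono mult_pos_pos) auto
      also have "R powr (x - 1) = R powr (\<alpha> * real k) / R powr (1 - \<zeta>)"
        using powr_diff[of R "\<alpha> * real k" "1 - \<zeta>"] by (simp add: x_def algebra_simps)
      also have "R powr (\<alpha> * real k) = (2 * (\<bar>z\<bar> + 1)) ^ k"
        using R by (simp add: powr_powr[symmetric] powr_realpow)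
      also have "\<bar>z\<bar> ^ k / ((2 * (\<bar>z\<bar> + 1)) ^ k / R powr (1 - \<zeta>) * exp (- (R + 1))) = C * (\<bar>z\<bar> / (2 * (\<bar>z\<bar> + 1))) ^ k"
        unfolding C_def exp_minus power_divide by (simp add: divide_inverse ac_simps)
      also have "\<dots> \<le> C * (1 / 2) ^ k"
        by (intro mult_left_mono power_mono) (auto simp: C_def divide_simps)
      finally show "norm (?f k) \<le> C * (1 / 2) ^ k" .
    qed
  qed
qed

lemma continuous_on_mittag_leffler:
  assumes "\<alpha> > 0" "\<zeta> > 0"
  shows "continuous_on S (mittag_leffler \<alpha> \<zeta>)"
proof -
  have "mittag_leffler \<alpha> \<zeta> = (\<lambda>z. \<Sum>k. 1 / Gamma (\<alpha> * real k + \<zeta>) * z ^ k)"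
    by (simp add: mittag_leffler_def fun_eq_iff)
  then show ?thesis
    using isCont_powser_converges_everywhere[OF mittag_leffler_summable[OF assms]]
    by (auto intro: continuous_at_imp_continuous_on)
qed

section \<open>Diagonal operators on \<open>\<ell>\<^sup>2\<close>\<close>

text \<open>\<open>Blinfun\<close> specifies a value only for bounded linear maps, so the facts
  below carry a bound on the multiplier.\<close>

definition diag :: "(nat \<Rightarrow> real) \<Rightarrow> l2 \<Rightarrow>\<^sub>L l2" where
  "diag m = Blinfun (\<lambda>x. Abs_l2 (\<lambda>k. m k * coord x k))"

lemma
  assumes "\<And>k. \<bar>m k\<bar> \<le> B"
  shows coord_diag: "coord (diag m x) k = m k * coord x k" and norm_diag_le: "norm (diag m) \<le> B"
proof -
  have B: "B \<ge> 0"
    using assms[of 0] by linarith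
  have le: "(\<Sum>k<n. (m k * coord x k)\<^sup>2) \<le> (norm x * B)\<^sup>2" for x n
  proof -
    have "(\<Sum>k<n. (m k * coord x k)\<^sup>2) \<le> (\<Sum>k<n. B\<^sup>2 * (coord x k)\<^sup>2)"
      unfolding power_mult_distrib using assms B
      by (intro sum_mono mult_right_mono) (auto simp flip: abs_le_square_iff)
    also have "\<dots> = B\<^sup>2 * (\<Sum>k<n. (coord x k)\<^sup>2)"
      by (simp add: sum_distrib_left)
    also have "\<dots> \<le> B\<^sup>2 * (norm x)\<^sup>2"
      by (intro mult_left_mono sum_coord_sq_le) simp
    finally show ?thesis
      by (simp add: power_mult_distrib mult.commute)
  qed
  have s: "summable (\<lambda>k. (m k * coord x k)\<^sup>2)" and n: "norm (Abs_l2 (\<lambda>k. m k * coord x k)) \<le> norm x * B" for x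
    using l2_boundI[OF le] B by auto
  define D where "D x = Abs_l2 (\<lambda>k. m k * coord x k)" for x
  have D: "coord (D x) k = m k * coord x k" for x k
    unfolding D_def by (subst coord_Abs_l2[OF s]) simp
  have bl: "bounded_linear D"
    by (rule bounded_linear_intro[OF _ _ n[folded D_def]]) (auto intro!: l2_eqI simp: D algebra_simps)
  have diag: "diag m = Blinfun D"
    by (simp add: diag_def D_def[abs_def])
  show "coord (diag m x) k = m k * coord x k"
    by (simp add: diag bounded_linear_Blinfun_apply[OF bl] D)
  show "norm (diag m) \<le> B"
    using B n by (intro norm_blinfun_bound) (simp_all add: diag bounded_linear_Blinfun_apply[OF bl] D_def mult.commute)
qed

lemma diag_diff:
  assumes "\<And>k. \<bar>m k\<bar> \<le> B" "\<And>k. \<bar>m' k\<bar> \<le> B'"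
  shows "diag m - diag m' = diag (\<lambda>k. m k - m' k)"
proof -
  have b: "\<bar>m k - m' k\<bar> \<le> B + B'" for k
    using assms[of k] by linarith
  show ?thesis
    by (intro blinfun_eqI l2_eqI)
      (simp add: blinfun.diff_left coord_diag[of _ B, OF assms(1)] coord_diag[of _ B', OF assms(2)]
        coord_diag[of _ "B + B'", OF b] left_diff_distrib)
qed

lemma continuous_on_bounded_interval:
  fixes f :: "real \<Rightarrow> real"
  assumes "continuous_on UNIV f"
  obtains B where "\<And>x. \<bar>x\<bar> \<le> r \<Longrightarrow> \<bar>f x\<bar> \<le> B"
proof -
  have "compact (f ` {-r..r})"
    using assms by (intro compact_continuous_image) (auto intro: continuous_on_subset)
  then have "\<exists>B. \<forall>x\<in>{-r..r}. \<bar>f x\<bar> \<le> B"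
    by (auto dest!: compact_imp_bounded simp: bounded_iff)
  then obtain B where "\<forall>x\<in>{-r..r}. \<bar>f x\<bar> \<le> B" ..
  then show ?thesis
    by (intro that[of B]) (auto simp: abs_le_iff)
qed

lemma multiplier_bound:
  fixes f :: "real \<Rightarrow> real"
  assumes "\<And>x. \<bar>x\<bar> \<le> \<bar>r\<bar> \<Longrightarrow> \<bar>f x\<bar> \<le> B" "\<And>k. \<bar>w k\<bar> \<le> 1" "\<And>k. \<bar>b k\<bar> \<le> 1"
  shows "\<bar>b k * f (w k * r)\<bar> \<le> B"
proof -
  have "\<bar>w k * r\<bar> \<le> \<bar>r\<bar>"
    using assms(2)[of k] by (simp add: abs_mult mult_left_le_one_le)
  then have "\<bar>f (w k * r)\<bar> \<le> B"
    by (rule assms(1))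
  moreover have "\<bar>b k\<bar> * \<bar>f (w k * r)\<bar> \<le> \<bar>f (w k * r)\<bar>"
    using assms(3)[of k] by (simp add: mult_left_le_one_le)
  ultimately show ?thesis
    by (simp add: abs_mult)
qed

text \<open>Norm continuity needs an estimate uniform in k. Because |w k| \<le> 1, the arguments w k
  * r of all modes lie in one compact interval, on which \<open>f\<close> is uniformly
  continuous.\<close>

lemma continuous_on_diag:
  fixes f :: "real \<Rightarrow> real"
  assumes f: "continuous_on UNIV f" and w: "\<And>k. \<bar>w k\<bar> \<le> 1" and b: "\<And>k. \<bar>b k\<bar> \<le> 1"
  shows "continuous_on UNIV (\<lambda>r. diag (\<lambda>k. b k * f (w k * r)))"
proof (rule continuous_at_imp_continuous_on, intro ballI, unfold continuous_at_eps_delta, intro allI impI)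
  fix r e :: real assume "e > 0"
  \<comment> \<open>The interval [-G, G] contains r and every r' at distance less than 1.\<close>
  define G where "G = \<bar>r\<bar> + 1"
  have "uniformly_continuous_on {-G..G} f"
    using f by (intro compact_uniformly_continuous) (auto intro: continuous_on_subset)
  then obtain d where d: "d > 0"
    "\<And>x y. x \<in> {-G..G} \<Longrightarrow> y \<in> {-G..G} \<Longrightarrow> dist y x < d \<Longrightarrow> dist (f y) (f x) < e / 2"
    unfolding uniformly_continuous_on_def using \<open>e > 0\<close> by (metis half_gt_zero)
  obtain B where B: "\<And>x. \<bar>x\<bar> \<le> G \<Longrightarrow> \<bar>f x\<bar> \<le> B"
    using continuous_on_bounded_interval[OF f, of G] by blast
  have "dist (diag (\<lambda>k. b k * f (w k * r'))) (diag (\<lambda>k. b k * f (w k * r))) < e"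
    if r': "dist r' r < min d 1" for r'
  proof -
    have abs: "\<bar>r\<bar> \<le> G" "\<bar>r'\<bar> \<le> G"
      using r' by (auto simp: G_def dist_real_def)
    have bd: "\<bar>b k * f (w k * s)\<bar> \<le> B" if "\<bar>s\<bar> \<le> G" for k s
      using that by (intro multiplier_bound B w b) auto
    have "\<bar>b k * f (w k * r') - b k * f (w k * r)\<bar> \<le> e / 2" for k
    proof -
      have i: "w k * s \<in> {-G..G}" if "\<bar>s\<bar> \<le> G" for s
      proof -
        have "\<bar>w k * s\<bar> \<le> \<bar>s\<bar>"
          using w[of k] by (simp add: abs_mult mult_left_le_one_le)
        then show ?thesis using that by (auto simp: abs_le_iff)
      qed
      have "\<bar>w k * r' - w k * r\<bar> \<le> \<bar>r' - r\<bar>"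
        using w[of k] unfolding right_diff_distrib[symmetric] abs_mult by (simp add: mult_left_le_one_le)
      then have "dist (f (w k * r')) (f (w k * r)) < e / 2"
        using r' abs by (intro d i) (auto simp: dist_real_def)
      moreover have "\<bar>b k * f (w k * r') - b k * f (w k * r)\<bar> \<le> \<bar>f (w k * r') - f (w k * r)\<bar>"
        using b[of k] unfolding right_diff_distrib[symmetric] abs_mult by (simp add: mult_left_le_one_le)
      ultimately show ?thesis
        by (simp add: dist_real_def)
    qed
    then have "norm (diag (\<lambda>k. b k * f (w k * r') - b k * f (w k * r))) \<le> e / 2"
      by (rule norm_diag_le)
    then show ?thesis
      using \<open>e > 0\<close> diag_diff[OF bd[OF abs(2)] bd[OF abs(1)]] by (simp add: dist_norm)
  qed
  then show "\<exists>d>0. \<forall>r'. dist r' r < d \<longrightarrow>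
      dist (diag (\<lambda>k. b k * f (w k * r'))) (diag (\<lambda>k. b k * f (w k * r))) < e"
    using d(1) by (intro exI[of _ "min d 1"]) auto
qed

section \<open>Linear Volterra equations with integrable kernels\<close>

text \<open>Continuity and the bound are asked only on the half-open interval, since the intended
  kernel is singular at 0 like s^(\<alpha> - 1); an integrable majorant takes the place of a uniform
  bound.\<close>

locale volterra_kernel =
  fixes K :: "real \<Rightarrow> 'b::{banach, second_countable_topology} \<Rightarrow>\<^sub>L 'b" and g :: "real \<Rightarrow> real" and T :: real
  assumes T_pos: "0 < T"
    and kernel_continuous: "continuous_on {0<..T} K"
    and kernel_bound: "\<And>s. s \<in> {0<..T} \<Longrightarrow> norm (K s) \<le> g s"
    and bound_integrable: "integrable lborel (\<lambda>s. indicator {0<..T} s * g s)"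
begin

text \<open>The kernel carries the integration variable and the unknown carries the shifted time.
  Thus the singularity stays at s = 0, one majorant serves every t, and the indicator absorbs the
  moving upper limit.\<close>

definition integrand :: "(real \<Rightarrow> 'b) \<Rightarrow> real \<Rightarrow> real \<Rightarrow> 'b" where
  "integrand y t s = indicator {0<..t} s *\<^sub>R K s (y (t - s))"

lemma integrand_bound:
  assumes "t \<in> {0..T}" "\<And>r. norm (y r) \<le> B"
  shows "norm (integrand y t s) \<le> B * (indicator {0<..T} s * g s)"
proof (cases "s \<in> {0<..t}")
  case True
  have "norm (K s (y (t - s))) \<le> norm (K s) * norm (y (t - s))"
    by (rule norm_blinfun)
  also have "\<dots> \<le> g s * B"
    using True assms by (intro mult_mono kernel_bound) (auto intro: order_trans[OF norm_ge_zero kernel_bound])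
  finally show ?thesis
    using True assms(1) by (simp add: integrand_def mult.commute)
next
  case False
  have "0 \<le> B"
    using assms(2)[of 0] norm_ge_zero[of "y 0"] by linarith
  moreover have "0 \<le> indicator {0<..T} s * g s"
    using order_trans[OF norm_ge_zero kernel_bound, of s] by (auto simp: indicator_def)
  ultimately show ?thesis
    using False by (simp add: integrand_def)
qed

lemma integrand_measurable:
  assumes "t \<in> {0..T}" "continuous_on UNIV y"
  shows "integrand y t \<in> borel_measurable borel"
proof -
  have "continuous_on {0<..t} (\<lambda>s. blinfun_apply (K s) (y (t - s)))"
    using assms
    by (intro continuous_intros continuous_on_subset[OF kernel_continuous] continuous_on_compose2[OF assms(2)]) auto
  then show ?thesis
    unfolding integrand_def by (intro borel_measurable_continuous_on_indicator) auto
qed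

lemma integrand_integrable:
  assumes "t \<in> {0..T}" "continuous_on UNIV y" "\<And>r. norm (y r) \<le> B"
  shows "integrable lborel (integrand y t)"
proof (rule Bochner_Integration.integrable_bound)
  show "integrable lborel (\<lambda>s. B * (indicator {0<..T} s * g s))"
    using bound_integrable by (rule integrable_mult_right)
  show "integrand y t \<in> borel_measurable lborel"
    using integrand_measurable[OF assms(1,2)] by simp
  show "AE s in lborel. norm (integrand y t s) \<le> norm (B * (indicator {0<..T} s * g s))"
    using integrand_bound[OF assms(1,3)] by (auto intro!: always_eventually order_trans[OF _ abs_ge_self] simp del: abs_mult)
qed

text \<open>Dominated convergence along sequences. As \<open>y\<close> is continuous on the whole
  line, the values of \<open>y\<close> converge for every s, and only the moving indicator needs
  care.\<close>

lemma convolution_continuous: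
  assumes y: "continuous_on UNIV y" "\<And>r. norm (y r) \<le> B"
  shows "continuous_on {0..T} (\<lambda>t. LINT s|lborel. integrand y t s)"
  unfolding continuous_on_sequentially
proof (intro allI ballI impI)
  fix X t assume t: "t \<in> {0..T}" and X: "(\<forall>n. X n \<in> {0..T}) \<and> X \<longlonglongrightarrow> t"
  have "(\<lambda>n. LINT s|lborel. integrand y (X n) s) \<longlonglongrightarrow> (LINT s|lborel. integrand y t s)"
  proof (rule integral_dominated_convergence)
    show "integrable lborel (\<lambda>s. B * (indicator {0<..T} s * g s))"
      using bound_integrable by (rule integrable_mult_right)
    show "integrand y t \<in> borel_measurable lborel" "integrand y (X n) \<in> borel_measurable lborel" for n
      using integrand_measurable[OF _ y(1)] t X by auto
    show "AE s in lborel. norm (integrand y (X n) s) \<le> B * (indicator {0<..T} s * g s)" for n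
      using integrand_bound[OF _ y(2)] X by auto
    \<comment> \<open>At s = t the indicator of (0, X n] may oscillate; this single point is
      discarded.\<close>
    have "AE s in lborel. s \<noteq> t"
      by (rule AE_lborel_singleton)
    then show "AE s in lborel. (\<lambda>n. integrand y (X n) s) \<longlonglongrightarrow> integrand y t s"
    proof eventually_elim
      case (elim s)
      have lim: "(\<lambda>n. K s (y (X n - s))) \<longlonglongrightarrow> K s (y (t - s))"
      proof (intro tendsto_intros)
        show "(\<lambda>n. y (X n - s)) \<longlonglongrightarrow> y (t - s)"
          using X y(1) by (intro continuous_on_tendsto_compose[OF y(1)] tendsto_intros) auto
      qed
      have ind: "\<forall>\<^sub>F n in sequentially. indicator {0<..X n} s = (indicator {0<..t} s :: real)"
      proof (cases "s < t")
        case True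
        then have "\<forall>\<^sub>F n in sequentially. s < X n"
          using X by (intro order_tendstoD) auto
        then show ?thesis
          by eventually_elim (use True in \<open>auto simp: indicator_def\<close>)
      next
        case False
        then have "\<forall>\<^sub>F n in sequentially. X n < s"
          using X elim by (intro order_tendstoD) auto
        then show ?thesis
          by eventually_elim (use False elim in \<open>auto simp: indicator_def\<close>)
      qed
      show ?case
        unfolding integrand_def by (rule tendsto_scaleR[OF tendsto_eventually[OF ind] lim])
    qed
  qed
  then show "((\<lambda>t. LINT s|lborel. integrand y t s) \<circ> X) \<longlonglongrightarrow> (LINT s|lborel. integrand y t s)"
    by (simp add: o_def)
qed

text \<open>Banach's fixed point theorem among bounded continuous functions on the whole line.
  Composition with \<open>clamp\<close> extends functions constantly beyond [0, T] and leaves them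
  unchanged on it; the Lipschitz constant is the integral of the majorant.\<close>

lemma solution_of_contraction:
  fixes f :: "real \<Rightarrow> 'b"
  assumes f: "continuous_on {0..T} f"
    and small: "(LINT s|lborel. indicator {0<..T} s * g s) < 1"
  obtains y where "continuous_on UNIV y" "bounded (range y)"
    "\<And>t. t \<in> {0..T} \<Longrightarrow> y t = f t + (LINT s|lborel. integrand y t s)"
proof -
  define c where "c = (LINT s|lborel. indicator {0<..T} s * g s)"
  have c0: "0 \<le> c"
    unfolding c_def using order_trans[OF norm_ge_zero kernel_bound]
    by (intro integral_nonneg_AE always_eventually) (auto simp: indicator_def)
  define clamp where "clamp t = max 0 (min T t)" for t
  have clamp: "clamp t \<in> {0..T}" "t \<in> {0..T} \<Longrightarrow> clamp t = t" for t
    using T_pos by (auto simp: clamp_def)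
  have clamp_cont: "continuous_on UNIV clamp"
    unfolding clamp_def by (intro continuous_intros)
  have yb: "norm (apply_bcontfun y r) \<le> norm y" for y :: "(real, 'b) bcontfun" and r
    by (rule norm_bounded)
  have yc: "continuous_on UNIV (apply_bcontfun y)" for y :: "(real, 'b) bcontfun"
    by simp
  define F where "F y t = f t + (LINT s|lborel. integrand y t s)" for y t
  have mem: "(\<lambda>t. F (apply_bcontfun y) (clamp t)) \<in> bcontfun" for y
  proof -
    have cont: "continuous_on {0..T} (F (apply_bcontfun y))"
      unfolding F_def by (intro continuous_on_add f convolution_continuous[OF yc yb])
    have "continuous_on UNIV (\<lambda>t. F (apply_bcontfun y) (clamp t))"
      using clamp(1) by (intro continuous_on_compose2[OF cont clamp_cont]) auto
    moreover have "bounded (range (\<lambda>t. F (apply_bcontfun y) (clamp t)))"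
      using clamp(1)
      by (intro bounded_subset[OF compact_imp_bounded[OF compact_continuous_image[OF cont compact_Icc]]]) auto
    ultimately show ?thesis
      by (simp add: bcontfun_def)
  qed
  define \<Phi> where "\<Phi> y = Bcontfun (\<lambda>t. F (apply_bcontfun y) (clamp t))" for y
  have \<Phi>: "apply_bcontfun (\<Phi> y) t = F (apply_bcontfun y) (clamp t)" for y t
    unfolding \<Phi>_def using mem by (simp add: Bcontfun_inverse)
  have "dist (\<Phi> y) (\<Phi> z) \<le> c * dist y z" for y z
  proof (rule dist_bound)
    fix t
    define t' where "t' = clamp t"
    have t': "t' \<in> {0..T}" using clamp by (simp add: t'_def)
    have "F (apply_bcontfun y) t' - F (apply_bcontfun z) t' = (LINT s|lborel. integrand (apply_bcontfun (y - z)) t' s)"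
      unfolding F_def add_diff_cancel_left
      by (subst Bochner_Integration.integral_diff[symmetric])
        (auto intro!: integrand_integrable[OF t' yc yb] Bochner_Integration.integral_cong
          simp: integrand_def blinfun.diff_right scaleR_diff_right)
    then have "dist (\<Phi> y t) (\<Phi> z t) = norm (LINT s|lborel. integrand (apply_bcontfun (y - z)) t' s)"
      by (simp add: \<Phi> dist_norm t'_def)
    also have "\<dots> \<le> (LINT s|lborel. norm (y - z) * (indicator {0<..T} s * g s))"
    proof (rule Bochner_Integration.integral_norm_bound_integral)
      show "integrable lborel (integrand (apply_bcontfun (y - z)) t')"
        by (rule integrand_integrable[OF t' yc yb])
      show "integrable lborel (\<lambda>s. norm (y - z) * (indicator {0<..T} s * g s))"
        using bound_integrable by (rule integrable_mult_right)
      show "norm (integrand (apply_bcontfun (y - z)) t' s) \<le> norm (y - z) * (indicator {0<..T} s * g s)" for s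
        by (rule integrand_bound[OF t' yb])
    qed
    also have "\<dots> = c * dist y z"
      by (simp add: c_def dist_norm)
    finally show "dist (\<Phi> y t) (\<Phi> z t) \<le> c * dist y z" .
  qed
  then obtain y where y: "\<Phi> y = y"
    using banach_fix_type[OF c0, of \<Phi>] small unfolding c_def by blast
  show ?thesis
  proof (rule that)
    show "continuous_on UNIV (apply_bcontfun y)" by (rule yc)
    show "bounded (range (apply_bcontfun y))"
      using yb by (auto simp: bounded_iff)
    show "apply_bcontfun y t = f t + (LINT s|lborel. integrand (apply_bcontfun y) t s)" if "t \<in> {0..T}" for t
      using \<Phi>[of y t] clamp(2)[OF that] by (simp add: y F_def)
  qed
qed

end

text \<open>The factor \<open>exp (- \<lambda> s)\<close> makes the kernel's \<open>L\<^sup>1\<close>-norm small; conjugating with it reduces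
  the general equation to the contractive one.\<close>

lemma (in volterra_kernel) solution_exists:
  fixes f :: "real \<Rightarrow> 'b"
  assumes f: "continuous_on {0..T} f" and K0: "K 0 = 0"
  obtains x where "continuous_on {0..T} x"
    "\<And>t. t \<in> {0..T} \<Longrightarrow> has_bochner_integral (lebesgue_on {0..t}) (\<lambda>\<tau>. K (t - \<tau>) (x \<tau>)) (x t - f t)"
proof -
  \<comment> \<open>Since exp (- (n * s)) tends to 0 for every s > 0, dominated convergence yields
    an integer rate \<open>n\<close> for which the weighted majorant has integral below 1.\<close>
  have "(\<lambda>n. LINT s|lborel. indicator {0<..T} s * (exp (- (real n * s)) * g s)) \<longlonglongrightarrow> (LINT s|(lborel :: real measure). (0::real))"
  proof (rule integral_dominated_convergence)
    show "integrable lborel (\<lambda>s. indicator {0<..T} s * g s)"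
      by (rule bound_integrable)
    have "indicator {0<..T} s * (exp (- (real n * s)) * g s) = exp (- (real n * s)) * (indicator {0<..T} s * g s)" for n s
      by simp
    then show "(\<lambda>s. indicator {0<..T} s * (exp (- (real n * s)) * g s)) \<in> borel_measurable lborel" for n
      by (simp only:) (rule borel_measurable_times[OF _ borel_measurable_integrable[OF bound_integrable]], measurable)
    show "AE s in lborel. (\<lambda>n. indicator {0<..T} s * (exp (- (real n * s)) * g s)) \<longlonglongrightarrow> 0"
    proof (intro always_eventually allI)
      fix s
      show "(\<lambda>n. indicator {0<..T} s * (exp (- (real n * s)) * g s)) \<longlonglongrightarrow> 0"
      proof (cases "s \<in> {0<..T}")
        case True
        then have "(\<lambda>n. exp (- s) ^ n) \<longlonglongrightarrow> 0"
          by (intro LIMSEQ_power_zero) auto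
        then have "(\<lambda>n. exp (- s) ^ n * g s) \<longlonglongrightarrow> 0 * g s"
          by (rule tendsto_mult_right)
        then show ?thesis
          using True by (simp flip: exp_of_nat_mult)
      qed simp
    qed
    show "AE s in lborel. norm (indicator {0<..T} s * (exp (- (real n * s)) * g s)) \<le> indicator {0<..T} s * g s" for n
    proof (intro always_eventually allI)
      fix s
      show "norm (indicator {0<..T} s * (exp (- (real n * s)) * g s)) \<le> indicator {0<..T} s * g s"
        using order_trans[OF norm_ge_zero kernel_bound, of s]
        by (auto simp: indicator_def abs_mult intro: mult_left_le_one_le)
    qed
  qed simp
  then have "\<forall>\<^sub>F n in sequentially. (LINT s|lborel. indicator {0<..T} s * (exp (- (real n * s)) * g s)) < 1"
    by (intro order_tendstoD) auto
  then obtain n where n: "(LINT s|lborel. indicator {0<..T} s * (exp (- (real n * s)) * g s)) < 1"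
    by (auto simp: eventually_sequentially)
  define E where "E s = exp (real n * s)" for s
  have E: "E s > 0" "exp (- (real n * s)) = inverse (E s)" "E (t - s) = E t / E s" for s t
    by (auto simp: E_def exp_minus exp_diff right_diff_distrib)
  interpret weighted: volterra_kernel "\<lambda>s. inverse (E s) *\<^sub>R K s" "\<lambda>s. inverse (E s) * g s" T
  proof
    show "0 < T" by (rule T_pos)
    show "continuous_on {0<..T} (\<lambda>s. inverse (E s) *\<^sub>R K s)"
      unfolding E_def by (intro continuous_intros kernel_continuous) auto
    show "norm (inverse (E s) *\<^sub>R K s) \<le> inverse (E s) * g s" if "s \<in> {0<..T}" for s
      using kernel_bound[OF that] E(1)[of s] by (simp add: mult_left_mono)
    show "integrable lborel (\<lambda>s. indicator {0<..T} s * (inverse (E s) * g s))"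
    proof (rule Bochner_Integration.integrable_bound[OF bound_integrable])
      have "indicator {0<..T} s * (inverse (E s) * g s) = inverse (E s) * (indicator {0<..T} s * g s)" for s
        by simp
      moreover have [measurable]: "E \<in> borel_measurable borel"
        unfolding E_def by measurable
      ultimately show "(\<lambda>s. indicator {0<..T} s * (inverse (E s) * g s)) \<in> borel_measurable lborel"
        by (simp only:) (rule borel_measurable_times[OF _ borel_measurable_integrable[OF bound_integrable]], measurable)
      show "AE s in lborel. norm (indicator {0<..T} s * (inverse (E s) * g s)) \<le> norm (indicator {0<..T} s * g s)"
      proof (intro always_eventually allI)
        fix s :: real
        have "s > 0 \<Longrightarrow> inverse (E s) \<le> 1"
          by (simp add: E_def flip: exp_minus)
        then show "norm (indicator {0<..T} s * (inverse (E s) * g s)) \<le> norm (indicator {0<..T} s * g s)"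
          using E(1)[of s] by (auto simp: indicator_def abs_mult intro: mult_left_le_one_le)
      qed
    qed
  qed
  have fE: "continuous_on {0..T} (\<lambda>t. inverse (E t) *\<^sub>R f t)"
    unfolding E_def by (intro continuous_intros f) auto
  obtain y where y: "continuous_on UNIV y" "bounded (range y)"
    "\<And>t. t \<in> {0..T} \<Longrightarrow> y t = inverse (E t) *\<^sub>R f t + (LINT s|lborel. weighted.integrand y t s)"
    by (rule weighted.solution_of_contraction[OF fE]) (use n in \<open>auto simp: E(2)\<close>)
  obtain B where B: "\<And>r. norm (y r) \<le> B"
    using y(2) by (auto simp: bounded_iff)
  define x where "x t = E t *\<^sub>R y t" for t
  show ?thesis
  proof (rule that)
    show "continuous_on {0..T} x"
      unfolding x_def E_def by (intro continuous_intros continuous_on_subset[OF y(1)]) auto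
    fix t assume t: "t \<in> {0..T}"
    have "has_bochner_integral lborel (weighted.integrand y t) (y t - inverse (E t) *\<^sub>R f t)"
      using y(3)[OF t] weighted.integrand_integrable[OF t y(1) B] by (simp add: has_bochner_integral_iff)
    then have "has_bochner_integral lborel (\<lambda>s. E t *\<^sub>R weighted.integrand y t s) (E t *\<^sub>R (y t - inverse (E t) *\<^sub>R f t))"
      by (intro has_bochner_integral_scaleR_right)
    moreover have "E t *\<^sub>R (y t - inverse (E t) *\<^sub>R f t) = x t - f t"
      using E(1)[of t] by (simp add: x_def scaleR_diff_right)
    \<comment> \<open>E t = E s * E (t - s): one factor cancels the weight of the kernel, the other
      turns y into x at time t - s.\<close>
    moreover have "E t *\<^sub>R weighted.integrand y t s = indicator {0<..t} s *\<^sub>R K s (x (t - s))" for s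
      by (simp add: weighted.integrand_def x_def E(3) blinfun.scaleR_left blinfun.scaleR_right divide_inverse mult.left_commute)
    ultimately have "has_bochner_integral lborel (\<lambda>s. indicator {0<..t} s *\<^sub>R K s (x (t - s))) (x t - f t)"
      by simp
    then have "has_bochner_integral lborel (\<lambda>\<tau>. indicator {0<..t} (t + - 1 * \<tau>) *\<^sub>R K (t + - 1 * \<tau>) (x (t - (t + - 1 * \<tau>)))) ((x t - f t) /\<^sub>R \<bar>- 1\<bar>)"
      by (subst (asm) lborel_has_bochner_integral_real_affine_iff[of "- 1" _ _ t]) auto
    \<comment> \<open>The substitution s = t - \<tau> maps (0, t] to [0, t); the endpoint \<tau> = t
      may be added because K 0 = 0.\<close>
    moreover have reflect: "(\<lambda>\<tau>. indicator {0<..t} (t + - 1 * \<tau>) *\<^sub>R K (t + - 1 * \<tau>) (x (t - (t + - 1 * \<tau>)))) =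
        (\<lambda>\<tau>. indicator {0..t} \<tau> *\<^sub>R K (t - \<tau>) (x \<tau>))"
    proof
      show "indicator {0<..t} (t + - 1 * \<tau>) *\<^sub>R K (t + - 1 * \<tau>) (x (t - (t + - 1 * \<tau>))) =
        indicator {0..t} \<tau> *\<^sub>R K (t - \<tau>) (x \<tau>)" for \<tau>
        by (cases "\<tau> = t") (auto simp: indicator_def K0)
    qed
    ultimately have *: "has_bochner_integral lborel (\<lambda>\<tau>. indicator {0..t} \<tau> *\<^sub>R K (t - \<tau>) (x \<tau>)) (x t - f t)"
      unfolding reflect by simp
    then have m: "(\<lambda>\<tau>. indicator {0..t} \<tau> *\<^sub>R K (t - \<tau>) (x \<tau>)) \<in> borel_measurable lborel"
      by (auto simp: has_bochner_integral_iff)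
    show "has_bochner_integral (lebesgue_on {0..t}) (\<lambda>\<tau>. K (t - \<tau>) (x \<tau>)) (x t - f t)"
      using * integrable_completion[OF m] integral_completion[OF m]
      by (auto simp: has_bochner_integral_iff integrable_restrict_space integral_restrict_space)
  qed
qed

section \<open>Transfer between \<open>\<ell>\<^sup>2\<close> and \<open>L\<^sup>2(\<Omega>)\<close>\<close>

lemma integrable_powr_indicator:
  fixes a T :: real
  assumes "a > -1" "T \<ge> 0"
  shows "integrable lborel (\<lambda>s. indicator {0<..T} s * s powr a)"
proof -
  have "(\<lambda>s. s powr a) integrable_on {0..T}"
    using has_integral_powr_from_0[OF assms] by blast
  then have "set_integrable lebesgue {0..T} (\<lambda>s. s powr a)"
    by (intro nonnegative_absolutely_integrable_1) auto
  \<comment> \<open>The endpoint 0 makes no difference, because 0 powr a = 0.\<close>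
  moreover have "(\<lambda>s. indicator {0..T} s *\<^sub>R s powr a) = (\<lambda>s. indicator {0<..T} s * s powr a)"
    by (auto simp: indicator_def fun_eq_iff)
  ultimately have "integrable lebesgue (\<lambda>s. indicator {0<..T} s * s powr a)"
    by (simp add: set_integrable_def)
  moreover have "(\<lambda>s. indicator {0<..T} s * s powr a) \<in> borel_measurable lborel"
    by measurable
  ultimately show ?thesis
    by (simp add: integrable_completion)
qed

context eigensystem
begin

lemma L2_inner_embed_coord [simp]: "L2_inner \<Omega> (embed (coord z)) (\<phi> k) = coord z k"
  by (rule embed_inner) simp

lemma embed_coord_L2: "embed (coord z) \<in> L2_space \<Omega>"
  by (rule embed_L2) simp

text \<open>Coefficients are recovered from the representative itself. Injectivity at the level of
  functions is what allows sums over the values of a simple function to be reindexed.\<close>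

lemma inj_embed_coord: "embed (coord z) = embed (coord w) \<longleftrightarrow> z = w"
  by (metis L2_inner_embed_coord l2_eqI)

lemma embed_diff_norm: "L2_norm \<Omega> (\<lambda>x. embed (coord z) x - embed (coord w) x) = norm (z - w)"
proof -
  have "L2_norm \<Omega> (embed (coord (z + (- 1) *\<^sub>R w))) = L2_norm \<Omega> (\<lambda>x. embed (coord z) x + - 1 * embed (coord w) x)"
    by (rule L2_norm_cong[OF embed_coord_L2 embed_add_scale])
  moreover have "L2_norm \<Omega> (embed (coord (z - w))) = norm (z - w)"
    unfolding norm_l2_eq by (rule embed_norm) (rule summable_coord)
  ultimately show ?thesis
    by simp
qed

lemma embed_sum_scale:
  "finite A \<Longrightarrow> L2_eq \<Omega> (embed (coord (\<Sum>w\<in>A. m w *\<^sub>R w))) (\<lambda>x. \<Sum>w\<in>A. m w * embed (coord w) x)"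
proof (rule L2_eq_phiI)
  assume A: "finite A"
  show "embed (coord (\<Sum>w\<in>A. m w *\<^sub>R w)) \<in> L2_space \<Omega>" "(\<lambda>x. \<Sum>w\<in>A. m w * embed (coord w) x) \<in> L2_space \<Omega>"
    by (intro embed_coord_L2 L2_sum L2_scale)+
  show "L2_inner \<Omega> (embed (coord (\<Sum>w\<in>A. m w *\<^sub>R w))) (\<phi> k) = L2_inner \<Omega> (\<lambda>x. \<Sum>w\<in>A. m w * embed (coord w) x) (\<phi> k)" for k
    unfolding L2_inner_embed_coord
    by (subst L2_inner_sum_left) (auto intro: L2_scale embed_coord_L2 phi_L2 simp: L2_inner_scale_left)
qed

text \<open>\<open>embed\<close> preserves distances, so it carries an approximating sequence of
  simple functions for the Bochner integral in \<open>l2\<close> to one for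
  \<open>has_L2_integral\<close>.\<close>

lemma has_L2_integral_embed:
  assumes int: "has_bochner_integral (lebesgue_on {a..b}) G v"
    and F: "\<And>\<tau>. \<tau> \<in> {a..b} \<Longrightarrow> F \<tau> = embed (coord (G \<tau>))"
  shows "has_L2_integral \<Omega> a b F (embed (coord v))"
proof -
  let ?M = "lebesgue_on {a..b}"
  let ?e = "\<lambda>z. embed (coord z)"
  have iG: "integrable ?M G"
    using int by (auto simp: has_bochner_integral_iff)
  from int obtain s where s: "\<And>i. Bochner_Integration.simple_bochner_integrable ?M (s i)"
    and lim0: "(\<lambda>i. \<integral>\<^sup>+x. norm (G x - s i x) \<partial>?M) \<longlonglongrightarrow> 0"
    and lim: "(\<lambda>i. Bochner_Integration.simple_bochner_integral ?M (s i)) \<longlonglongrightarrow> v"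
    by (auto elim!: has_bochner_integral.cases)
  have sf: "simple_function ?M (s i)" for i
    using s[of i] by (auto elim: Bochner_Integration.simple_bochner_integrable.cases)
  have si: "integrable ?M (s i)" for i
    using has_bochner_integral_simple_bochner_integrable[OF s] by (rule integrable.intros)
  have inorm: "integrable ?M (\<lambda>\<tau>. norm (G \<tau> - s i \<tau>))" for i
    by (intro integrable_norm Bochner_Integration.integrable_diff iG si)
  have nrm: "L2_norm \<Omega> (\<lambda>x. F \<tau> x - ?e (s i \<tau>) x) = norm (G \<tau> - s i \<tau>)" if "\<tau> \<in> space ?M" for \<tau> i
    using that by (simp add: F embed_diff_norm)
  have "(\<lambda>i. LINT \<tau>|?M. norm (G \<tau> - s i \<tau>)) \<longlonglongrightarrow> 0"
    using lim0 nn_integral_eq_integral[OF inorm]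
    by (subst ennreal_tendsto_0_iff[symmetric]) auto
  then have l1: "(\<lambda>i. LINT \<tau>|?M. L2_norm \<Omega> (\<lambda>x. F \<tau> x - ?e (s i \<tau>) x)) \<longlonglongrightarrow> 0"
    by (subst Bochner_Integration.integral_cong[OF refl nrm])
  \<comment> \<open>By injectivity the embedded simple function has the same level sets, so its
    elementary integral is indexed by the same values.\<close>
  have L2_si: "L2_simple_integral ?M (\<lambda>\<tau>. ?e (s i \<tau>)) = (\<lambda>x. \<Sum>w\<in>s i ` space ?M. measure ?M {\<tau> \<in> space ?M. s i \<tau> = w} * ?e w x)" for i
  proof -
    have "(\<lambda>\<tau>. ?e (s i \<tau>)) ` space ?M = ?e ` (s i ` space ?M)"
      by (simp only: image_image)
    moreover have "inj_on ?e (s i ` space ?M)"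
      by (simp add: inj_on_def inj_embed_coord)
    ultimately show ?thesis
      unfolding L2_simple_integral_def by (simp only: sum.reindex o_def inj_embed_coord)
  qed
  have "L2_norm \<Omega> (\<lambda>x. L2_simple_integral ?M (\<lambda>\<tau>. ?e (s i \<tau>)) x - ?e v x) = norm (Bochner_Integration.simple_bochner_integral ?M (s i) - v)" for i
  proof -
    have "finite (s i ` space ?M)"
      using sf by (rule simple_functionD)
    \<comment> \<open>The embedding of a sum and the sum of the embeddings agree only almost
      everywhere, which the norm does not see.\<close>
    from L2_eq_diff[OF embed_sum_scale[OF this] L2_eq_refl,
      of "\<lambda>w. measure ?M {\<tau> \<in> space ?M. s i \<tau> = w}" "?e v"]
    have "L2_norm \<Omega> (\<lambda>x. ?e (Bochner_Integration.simple_bochner_integral ?M (s i)) x - ?e v x) =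
        L2_norm \<Omega> (\<lambda>x. L2_simple_integral ?M (\<lambda>\<tau>. ?e (s i \<tau>)) x - ?e v x)"
      unfolding L2_si Bochner_Integration.simple_bochner_integral_def
      by (rule L2_norm_cong[OF L2_diff[OF embed_coord_L2 embed_coord_L2]])
    then show ?thesis
      by (simp add: embed_diff_norm)
  qed
  moreover have "(\<lambda>i. norm (Bochner_Integration.simple_bochner_integral ?M (s i) - v)) \<longlonglongrightarrow> 0"
    using lim by (simp add: tendsto_norm_zero_iff LIM_zero_iff)
  ultimately have l2: "(\<lambda>i. L2_norm \<Omega> (\<lambda>x. L2_simple_integral ?M (\<lambda>\<tau>. ?e (s i \<tau>)) x - ?e v x)) \<longlonglongrightarrow> 0"
    by simp
  have "AE \<tau> in ?M. F \<tau> \<in> L2_space \<Omega>"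
    using F embed_coord_L2 by (intro AE_I2) simp
  moreover have "simple_function ?M (\<lambda>\<tau>. ?e (s i \<tau>))" for i
    by (rule simple_function_compose1[OF sf])
  moreover have "integrable ?M (\<lambda>\<tau>. L2_norm \<Omega> (\<lambda>x. F \<tau> x - ?e (s i \<tau>) x))" for i
    by (rule Bochner_Integration.integrable_cong[OF refl nrm, THEN iffD2]) (auto intro: inorm)
  ultimately show ?thesis
    unfolding has_L2_integral_def Let_def
    by (intro conjI exI[of _ "\<lambda>i \<tau>. ?e (s i \<tau>)"] allI l1 l2 embed_coord_L2) (auto intro: embed_coord_L2)
qed

lemma energy_in_D: "energy z \<in> D_space \<Omega> \<theta> \<phi> 1"
  using theta_pos
  by (simp add: D_space_def energy_L2 energy_inner power_divide less_imp_le less_imp_neq[symmetric])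

lemma D_norm_energy_diff: "D_norm \<Omega> \<theta> \<phi> 1 (\<lambda>x. energy z x - energy w x) = norm (z - w)"
proof -
  have "\<theta> k powr 1 * (L2_inner \<Omega> (\<lambda>x. energy z x - energy w x) (\<phi> k))\<^sup>2 = (coord (z - w) k)\<^sup>2" for k
    using theta_pos[of k]
    by (simp add: L2_inner_diff_left energy_L2 phi_L2 energy_inner power_divide flip: diff_divide_distrib)
  then show ?thesis
    by (simp add: D_norm_def norm_l2_eq)
qed

section \<open>Existence of a mild solution\<close>

text \<open>The variable \<open>r\<close> stands for -(t^\<alpha>). The factor 1 puts the multiplier
  into the form b k * f (w k * r) of \<open>continuous_on_diag\<close>.\<close>

definition solution_multiplier :: "real \<Rightarrow> real \<Rightarrow> l2 \<Rightarrow>\<^sub>L l2" where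
  "solution_multiplier \<alpha> r = diag (\<lambda>k. 1 * mittag_leffler \<alpha> 1 (\<theta> k / (1 + \<theta> k) * r))"

text \<open>The resolvent family without its factor t^(\<alpha> - 1), hence continuous up to t = 0.
  The factor sqrt \<theta> expresses the output in energy coordinates.\<close>

definition resolvent_multiplier :: "real \<Rightarrow> real \<Rightarrow> l2 \<Rightarrow>\<^sub>L l2" where
  "resolvent_multiplier \<alpha> r = diag (\<lambda>k. sqrt (\<theta> k) / (1 + \<theta> k) * mittag_leffler \<alpha> \<alpha> (\<theta> k / (1 + \<theta> k) * r))"

text \<open>The second bound comes from sqrt \<theta> \<le> (\<theta> + 1)/2: the resolvent regains
  the derivative that \<open>directional_op\<close> costs.\<close>

lemma multiplier_le_1: "\<bar>\<theta> k / (1 + \<theta> k)\<bar> \<le> 1" "\<bar>sqrt (\<theta> k) / (1 + \<theta> k)\<bar> \<le> 1"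
proof -
  have "sqrt (\<theta> k) * 1 \<le> ((sqrt (\<theta> k))\<^sup>2 + 1\<^sup>2) / 2"
    using sum_squares_bound[of "sqrt (\<theta> k)" 1] by simp
  then have "sqrt (\<theta> k) \<le> 1 + \<theta> k"
    using theta_pos[of k] by simp
  then show "\<bar>\<theta> k / (1 + \<theta> k)\<bar> \<le> 1" "\<bar>sqrt (\<theta> k) / (1 + \<theta> k)\<bar> \<le> 1"
    using theta_pos[of k] by (simp_all add: abs_of_pos divide_le_eq)
qed

lemma coord_multiplier:
  fixes f :: "real \<Rightarrow> real"
  assumes "continuous_on UNIV f" "\<And>k. \<bar>w k\<bar> \<le> 1" "\<And>k. \<bar>b k\<bar> \<le> 1"
  shows "coord (diag (\<lambda>k. b k * f (w k * r)) x) k = b k * f (w k * r) * coord x k"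
proof -
  obtain B where "\<And>x. \<bar>x\<bar> \<le> \<bar>r\<bar> \<Longrightarrow> \<bar>f x\<bar> \<le> B"
    using continuous_on_bounded_interval[OF assms(1), of "\<bar>r\<bar>"] by blast
  then show ?thesis
    by (intro coord_diag[of _ B] multiplier_bound assms)
qed

lemma mild_solution_exists:
  assumes \<alpha>: "0 < \<alpha>" "\<alpha> < 1" and T: "0 < T" and u0: "u0 \<in> D_space \<Omega> \<theta> \<phi> 1"
  shows "\<exists>u \<in> C_into_D {0..T} \<Omega> \<theta> \<phi> 1. mild_solution \<Omega> \<theta> \<phi> \<alpha> (directional_op \<Omega> \<eta>) u0 T u"
proof -
  have E1: "continuous_on UNIV (mittag_leffler \<alpha> 1)" and E\<alpha>: "continuous_on UNIV (mittag_leffler \<alpha> \<alpha>)"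
    using \<alpha> by (auto intro: continuous_on_mittag_leffler)
  have u0L: "u0 \<in> L2_space \<Omega>" and sx0: "summable (\<lambda>k. (sqrt (\<theta> k) * L2_inner \<Omega> u0 (\<phi> k))\<^sup>2)"
    using u0 theta_pos by (auto simp: D_space_def power_mult_distrib less_imp_le)
  define x0 where "x0 = Abs_l2 (\<lambda>k. sqrt (\<theta> k) * L2_inner \<Omega> u0 (\<phi> k))"
  have x0: "coord x0 k = sqrt (\<theta> k) * L2_inner \<Omega> u0 (\<phi> k)" for k
    unfolding x0_def by (subst coord_Abs_l2[OF sx0]) simp
  define f where "f t = solution_multiplier \<alpha> (- (t powr \<alpha>)) x0" for t
  have powr_cont: "continuous_on {0..T} (\<lambda>t. - (t powr \<alpha>))"
    using \<alpha> by (intro continuous_intros continuous_on_powr') auto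
  have cS: "continuous_on UNIV (solution_multiplier \<alpha>)"
    unfolding solution_multiplier_def by (rule continuous_on_diag[where b = "\<lambda>_. 1", OF E1 multiplier_le_1(1)]) simp
  have cR: "continuous_on UNIV (resolvent_multiplier \<alpha>)"
    unfolding resolvent_multiplier_def by (intro continuous_on_diag[OF E\<alpha>] multiplier_le_1)
  have f: "continuous_on {0..T} f"
    unfolding f_def by (intro continuous_intros continuous_on_compose2[OF cS powr_cont]) auto
  define A where "A = Blinfun (drift \<eta>)"
  have A: "blinfun_apply A z = drift \<eta> z" for z
    by (simp add: A_def bounded_linear_Blinfun_apply[OF bounded_linear_drift])
  \<comment> \<open>The Volterra kernel in energy coordinates: first \<open>drift\<close>, then the
    resolvent. Since 0 powr (\<alpha> - 1) = 0, it satisfies K 0 = 0, in line with the convention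
    for \<open>R_op\<close>.\<close>
  define K where "K s = s powr (\<alpha> - 1) *\<^sub>R (resolvent_multiplier \<alpha> (- (s powr \<alpha>)) o\<^sub>L A)" for s
  \<comment> \<open>All Mittag-Leffler arguments that occur up to time T are bounded by T^\<alpha>,
    whatever the mode, so one constant bounds every resolvent multiplier.\<close>
  obtain B where B: "\<And>r. \<bar>r\<bar> \<le> T powr \<alpha> \<Longrightarrow> \<bar>mittag_leffler \<alpha> \<alpha> r\<bar> \<le> B"
    using continuous_on_bounded_interval[OF E\<alpha>] by blast
  have normR: "norm (resolvent_multiplier \<alpha> (- (s powr \<alpha>))) \<le> B" if s: "s \<in> {0<..T}" for s
    unfolding resolvent_multiplier_def
  proof (rule norm_diag_le, rule multiplier_bound[OF B multiplier_le_1])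
    fix r assume "\<bar>r\<bar> \<le> \<bar>- (s powr \<alpha>)\<bar>"
    also have "\<dots> \<le> T powr \<alpha>"
      using s \<alpha> by (auto intro: powr_mono2)
    finally show "\<bar>r\<bar> \<le> T powr \<alpha>" .
  qed
  interpret volterra_kernel K "\<lambda>s. s powr (\<alpha> - 1) * (B * norm A)" T
  proof
    show "0 < T" by (rule T)
    show "continuous_on {0<..T} K"
      unfolding K_def
      by (intro continuous_intros continuous_on_powr continuous_on_compose2[OF cR continuous_on_subset[OF powr_cont]]) auto
    show "norm (K s) \<le> s powr (\<alpha> - 1) * (B * norm A)" if "s \<in> {0<..T}" for s
    proof -
      have "norm (resolvent_multiplier \<alpha> (- (s powr \<alpha>)) o\<^sub>L A) \<le> B * norm A"
        by (rule order_trans[OF norm_blinfun_compose mult_right_mono[OF normR[OF that] norm_ge_zero]])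
      then show ?thesis
        by (simp add: K_def mult_left_mono)
    qed
    have "integrable lborel (\<lambda>s. indicator {0<..T} s * s powr (\<alpha> - 1) * (B * norm A))"
      using \<alpha> T by (intro integrable_mult_left integrable_powr_indicator) auto
    then show "integrable lborel (\<lambda>s. indicator {0<..T} s * (s powr (\<alpha> - 1) * (B * norm A)))"
      by (simp add: mult.assoc)
  qed
  obtain x where x: "continuous_on {0..T} x"
    "\<And>t. t \<in> {0..T} \<Longrightarrow> has_bochner_integral (lebesgue_on {0..t}) (\<lambda>\<tau>. K (t - \<tau>) (x \<tau>)) (x t - f t)"
    by (rule solution_exists[OF f]) (auto simp: K_def)
  \<comment> \<open>\<open>weight\<close> removes the factor sqrt \<theta> contained in
    \<open>x0\<close>. Both sides are then the chosen limit of one and the same coefficient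
    sequence, hence literally equal.\<close>
  have S: "S_op \<Omega> \<theta> \<phi> \<alpha> t u0 = energy (f t)" for t
  proof -
    have "mittag_leffler \<alpha> 1 (- \<theta> k * t powr \<alpha> / (1 + \<theta> k)) * L2_inner \<Omega> u0 (\<phi> k) = coord (weight (f t)) k" for k
    proof -
      have "coord (f t) k = 1 * mittag_leffler \<alpha> 1 (\<theta> k / (1 + \<theta> k) * - (t powr \<alpha>)) * coord x0 k"
        unfolding f_def solution_multiplier_def by (rule coord_multiplier[OF E1 multiplier_le_1(1)]) simp
      then show ?thesis
        using theta_pos[of k] by (simp add: x0)
    qed
    then show ?thesis
      by (simp only: S_op_def energy_def embed_def)
  qed
  \<comment> \<open>Here \<open>weight\<close> cancels the sqrt \<theta> of the resolvent multiplier
    and leaves the factor 1/(1 + \<theta>) of \<open>R_op\<close>; equality of the coefficient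
    sequences again gives equality of functions.\<close>
  have R: "R_op \<Omega> \<theta> \<phi> \<alpha> s (directional_op \<Omega> \<eta> (energy z)) = embed (coord (weight (K s z)))" for s z
  proof -
    have "s powr (\<alpha> - 1) / (1 + \<theta> k) * mittag_leffler \<alpha> \<alpha> (- \<theta> k * s powr \<alpha> / (1 + \<theta> k))
       * L2_inner \<Omega> (directional_op \<Omega> \<eta> (energy z)) (\<phi> k) = coord (weight (K s z)) k" for k
    proof -
      have "coord (resolvent_multiplier \<alpha> (- (s powr \<alpha>)) (A z)) k =
          sqrt (\<theta> k) / (1 + \<theta> k) * mittag_leffler \<alpha> \<alpha> (\<theta> k / (1 + \<theta> k) * - (s powr \<alpha>)) * coord (A z) k"
        unfolding resolvent_multiplier_def by (rule coord_multiplier[OF E\<alpha> multiplier_le_1])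
      moreover have "coord (A z) k = L2_inner \<Omega> (directional_op \<Omega> \<eta> (energy z)) (\<phi> k)"
        by (simp add: A drift_def coord_coefs directional_op_L2)
      ultimately show ?thesis
        using theta_pos[of k] by (simp add: K_def blinfun.scaleR_left)
    qed
    then show ?thesis
      by (simp only: R_op_def embed_def)
  qed
  define u where "u t = energy (x t)" for t
  have "u \<in> C_into_D {0..T} \<Omega> \<theta> \<phi> 1"
  proof -
    have "((\<lambda>s. norm (x s - x t)) \<longlongrightarrow> 0) (at t within {0..T})" if "t \<in> {0..T}" for t
      using x(1) that by (simp add: continuous_on_def tendsto_norm_zero_iff LIM_zero_iff)
    then show ?thesis
      by (simp add: C_into_D_def u_def energy_in_D D_norm_energy_diff)
  qed
  moreover have "mild_solution \<Omega> \<theta> \<phi> \<alpha> (directional_op \<Omega> \<eta>) u0 T u"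
    unfolding mild_solution_def
  proof (intro ballI exI conjI)
    fix t assume t: "t \<in> {0..T}"
    \<comment> \<open>Moving the bounded operator \<open>weight\<close> under the integral turns the
      \<open>l2\<close> equation into one between L^2 coefficients, with x t - f t in the role of
      the Volterra integral.\<close>
    have "has_bochner_integral (lebesgue_on {0..t}) (\<lambda>\<tau>. weight (K (t - \<tau>) (x \<tau>))) (weight (x t - f t))"
      by (rule has_bochner_integral_bounded_linear[OF bounded_linear_weight x(2)[OF t]])
    then show "has_L2_integral \<Omega> 0 t (\<lambda>\<tau>. R_op \<Omega> \<theta> \<phi> \<alpha> (t - \<tau>) (directional_op \<Omega> \<eta> (u \<tau>))) (energy (x t - f t))"
      unfolding energy_def[of "x t - f t"] by (rule has_L2_integral_embed) (simp only: u_def R)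
    show "L2_eq \<Omega> (u t) (\<lambda>y. S_op \<Omega> \<theta> \<phi> \<alpha> t u0 y + energy (x t - f t) y)"
      using energy_add_scale[of "f t" 1 "x t - f t"] by (simp add: S u_def)
  qed
  ultimately show ?thesis
    by blast
qed

end

theorem theorem3p3:
  fixes \<Omega> :: "(real ^ 'd) set" and \<eta> :: "real ^ 'd"
    and \<alpha> T :: real
    and \<theta> :: "nat \<Rightarrow> real" and \<phi> :: "nat \<Rightarrow> real ^ 'd \<Rightarrow> real"
    and u0 :: "real ^ 'd \<Rightarrow> real"
  assumes "0 < \<alpha>" and "\<alpha> < 1"
    and "open \<Omega>" and "connected \<Omega>" and "\<Omega> \<noteq> {}" and "bounded \<Omega>" and "Ck_boundary 2 \<Omega>"
    and "dirichlet_eigensystem \<Omega> \<theta> \<phi>"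
    and "0 < T"
    and "u0 \<in> D_space \<Omega> \<theta> \<phi> 1"
  shows "\<exists>u \<in> C_into_D {0..T} \<Omega> \<theta> \<phi> 1. mild_solution \<Omega> \<theta> \<phi> \<alpha> (directional_op \<Omega> \<eta>) u0 T u"
proof -
  interpret eigensystem \<Omega> \<theta> \<phi>
    using assms by unfold_locales auto
  show ?thesis
    using assms by (intro mild_solution_exists) auto
qed

end
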